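(* Let $d>1$ be an odd squarefree integer and let $D$ be any divisor of $d$. Let $E$ be the elliptic curve $y^2=x^3-dD^2x$ over $\mathbb{Q}$, and let $\delta_E$ be its congruence number. Then \[ 2\left\lfloor\frac{\omega(d)+1}{2}\right\rfloor+1\leq \nu_2(\delta_E). \]
   Context: $\nu_2$ denotes the $2$-adic valuation and $\omega(n)$ the number of distinct prime factors of $n$. Congruence number: let $E$ be an elliptic curve over $\mathbb{Q}$ of conductor $N$ and let $f_E=\sum_{n\ge 1} a_n q^n\in S_2(\Gamma_0(N))$ be its associated Hecke newform. The congruence number $\delta_E$ is the largest integer such that there is a modular form $g=\sum_{n\ge 1} b_n q^n\in S_2(\Gamma_0(N))$ with $b_n\in\mathbb{Z}$ for all $n$, orthogonal to $f_E$ with respect to the Petersson inner product, and with $a_n\equiv b_n \pmod{\delta_E}$ for all $n$. *)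

theory Defs
  imports
    "HOL-Analysis.Analysis"
    "HOL-Computational_Algebra.Computational_Algebra"
    "HOL-Number_Theory.Cong"
    "HOL-Algebra.Ideal_Product"
    "HOL-Algebra.Generated_Fields"
begin

section \<open>Cusp forms of weight 2 on the group Gamma0(N)\<close>

text \<open>Modular forms are functions on all of \<open>complex\<close>; only their values on the upper half
  plane matter.\<close>

definition upper_half_plane :: "complex set" where
  "upper_half_plane = {z. Im z > 0}"

definition SL2Z :: "(int ^ 2 ^ 2) set" where
  "SL2Z = {A. det A = 1}"

definition Gamma0 :: "nat \<Rightarrow> (int ^ 2 ^ 2) set" where
  "Gamma0 N = {A \<in> SL2Z. int N dvd A $ 2 $ 1}"

text \<open>The weight 2 slash action of \<open>SL2Z\<close>.\<close>

definition slash :: "(complex \<Rightarrow> complex) \<Rightarrow> int ^ 2 ^ 2 \<Rightarrow> complex \<Rightarrow> complex" where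
  "slash f A z =
     f ((of_int (A $ 1 $ 1) * z + of_int (A $ 1 $ 2)) / (of_int (A $ 2 $ 1) * z + of_int (A $ 2 $ 2)))
       / (of_int (A $ 2 $ 1) * z + of_int (A $ 2 $ 2)) ^ 2"

text \<open>Every cusp is \<open>A \<infinity>\<close> for some \<open>A\<close> in \<open>SL2Z\<close>, so the last condition is vanishing at all
  cusps.\<close>

definition cusp_forms :: "nat \<Rightarrow> (complex \<Rightarrow> complex) set" where
  "cusp_forms N =
     {f. f holomorphic_on upper_half_plane \<and>
         (\<forall>A\<in>Gamma0 N. \<forall>z\<in>upper_half_plane. slash f A z = f z) \<and>
         (\<forall>A\<in>SL2Z. (slash f A \<longlongrightarrow> 0) (filtercomap Im at_top))}"

definition q_expansion :: "(complex \<Rightarrow> complex) \<Rightarrow> (nat \<Rightarrow> complex) \<Rightarrow> bool" where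
  "q_expansion f a \<longleftrightarrow>
     (\<forall>z\<in>upper_half_plane. (\<lambda>n. a n * exp (2 * of_real pi * \<i> * z) ^ n) sums f z)"

definition fundamental_domain :: "complex set" where
  "fundamental_domain = {z \<in> upper_half_plane. \<bar>Re z\<bar> \<le> 1 / 2 \<and> 1 \<le> norm z}"

text \<open>The integral over the quotient of the upper half plane by \<open>Gamma0 N\<close> is split into
  translates of the fundamental domain of \<open>SL2Z\<close>, one for each coset in
  \<open>Gamma0 N \ SL2Z\<close>; the summand does not depend on the chosen representative. In weight 2 the
  factor \<open>y\<^sup>2\<close> of the integrand cancels the density \<open>y\<^sup>-\<^sup>2\<close> of the hyperbolic measure. The product
  is not normalised by the volume.\<close>

definition petersson :: "nat \<Rightarrow> (complex \<Rightarrow> complex) \<Rightarrow> (complex \<Rightarrow> complex) \<Rightarrow> complex" where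
  "petersson N f g =
     (\<Sum>C \<in> (\<lambda>A. (\<lambda>B. B ** A) ` Gamma0 N) ` SL2Z.
        LINT z:fundamental_domain|lborel.
          slash f (SOME A. A \<in> C) z * cnj (slash g (SOME A. A \<in> C) z))"

text \<open>The Hecke operator \<open>T_n\<close> on weight 2 forms of level \<open>N\<close>, for every \<open>n \<ge> 1\<close>:
  \<open>n * (\<Sum> (f((a z + b) / e) / e\<^sup>2))\<close> over \<open>a * e = n\<close>, \<open>a\<close> coprime to \<open>N\<close>, and \<open>b\<close> modulo \<open>e\<close>.
  For prime \<open>n\<close> not dividing \<open>N\<close> it acts on coefficients by \<open>a_m \<mapsto> a_{nm} + n a_{m/n}\<close>.\<close>

definition hecke :: "nat \<Rightarrow> nat \<Rightarrow> (complex \<Rightarrow> complex) \<Rightarrow> complex \<Rightarrow> complex" where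
  "hecke N n f z =
     (\<Sum>e | e dvd n \<and> coprime (n div e) N.
        \<Sum>b<e. of_nat n / of_nat e ^ 2 * f ((of_nat (n div e) * z + of_nat b) / of_nat e))"

text \<open>A newform of level \<open>N\<close>: a normalised eigenform of all Hecke operators, orthogonal to the
  old subspace, which is spanned by the forms \<open>g (e z)\<close> with \<open>g\<close> of proper level \<open>M\<close> and
  \<open>e * M\<close> dividing \<open>N\<close>.\<close>

definition newform :: "nat \<Rightarrow> (complex \<Rightarrow> complex) \<Rightarrow> bool" where
  "newform N f \<longleftrightarrow>
     f \<in> cusp_forms N \<and>
     (\<forall>M e g. M dvd N \<and> M \<noteq> N \<and> e * M dvd N \<and> g \<in> cusp_forms M
        \<longrightarrow> petersson N f (\<lambda>z. g (of_nat e * z)) = 0) \<and>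
     (\<forall>n\<ge>1. \<exists>c. \<forall>z\<in>upper_half_plane. hecke N n f z = c * f z) \<and>
     (\<exists>a. q_expansion f a \<and> a 1 = 1)"


section \<open>Weierstrass equations\<close>

text \<open>\<open>Weierstrass a1 a2 a3 a4 a6\<close> is the curve
  \<open>y\<^sup>2 + a1 x y + a3 y = x\<^sup>3 + a2 x\<^sup>2 + a4 x + a6\<close>.\<close>

datatype 'a weierstrass = Weierstrass (A1: 'a) (A2: 'a) (A3: 'a) (A4: 'a) (A6: 'a)

definition B2 :: "'a::comm_ring_1 weierstrass \<Rightarrow> 'a" where
  "B2 W = (A1 W)^2 + 4 * A2 W"

definition B4 :: "'a::comm_ring_1 weierstrass \<Rightarrow> 'a" where
  "B4 W = 2 * A4 W + A1 W * A3 W"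

definition B6 :: "'a::comm_ring_1 weierstrass \<Rightarrow> 'a" where
  "B6 W = (A3 W)^2 + 4 * A6 W"

definition B8 :: "'a::comm_ring_1 weierstrass \<Rightarrow> 'a" where
  "B8 W = (A1 W)^2 * A6 W + 4 * A2 W * A6 W - A1 W * A3 W * A4 W + A2 W * (A3 W)^2 - (A4 W)^2"

definition C4 :: "'a::comm_ring_1 weierstrass \<Rightarrow> 'a" where
  "C4 W = (B2 W)^2 - 24 * B4 W"

definition disc :: "'a::comm_ring_1 weierstrass \<Rightarrow> 'a" where
  "disc W = - ((B2 W)^2 * B8 W) - 8 * (B4 W)^3 - 27 * (B6 W)^2 + 9 * B2 W * B4 W * B6 W"

text \<open>Isomorphism via the substitution \<open>x = u\<^sup>2 x' + r\<close>, \<open>y = u\<^sup>3 y' + u\<^sup>2 s x' + t\<close>.\<close>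

definition weierstrass_iso :: "'a::field weierstrass \<Rightarrow> 'a weierstrass \<Rightarrow> bool" where
  "weierstrass_iso W W' \<longleftrightarrow>
     (\<exists>u r s t. u \<noteq> 0 \<and>
        u * A1 W' = A1 W + 2 * s \<and>
        u^2 * A2 W' = A2 W - s * A1 W + 3 * r - s^2 \<and>
        u^3 * A3 W' = A3 W + r * A1 W + 2 * t \<and>
        u^4 * A4 W' = A4 W - s * A3 W + 2 * r * A2 W - (t + r * s) * A1 W + 3 * r^2 - 2 * s * t \<and>
        u^6 * A6 W' = A6 W + r * A4 W + r^2 * A2 W + r^3 - t * A3 W - t^2 - r * t * A1 W)"

definition integral_models :: "rat weierstrass \<Rightarrow> int weierstrass set" where
  "integral_models E = {W. weierstrass_iso E (map_weierstrass of_int W)}"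

text \<open>A global minimal Weierstrass equation, that is, one minimal at every prime. It exists
  over the rationals, and what is derived from it below does not depend on the choice.\<close>

definition minimal_model :: "rat weierstrass \<Rightarrow> int weierstrass" where
  "minimal_model E =
     (SOME W. W \<in> integral_models E \<and>
        (\<forall>W'\<in>integral_models E. \<forall>p::nat. prime p \<longrightarrow>
           multiplicity (int p) (disc W) \<le> multiplicity (int p) (disc W')))"

text \<open>\<open>p + 1 - #E(F_p)\<close>, where \<open>#E(F_p)\<close> counts all points of the reduced minimal equation: the
  point at infinity and, for bad \<open>p\<close>, also the singular point. Hence the value is 1, -1 or 0 for
  split multiplicative, nonsplit multiplicative and additive reduction, as in the Euler factor of
  the L-function.\<close>

definition frobenius_trace :: "rat weierstrass \<Rightarrow> nat \<Rightarrow> int" where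
  "frobenius_trace E p =
     (let W = minimal_model E in
        int p + 1 - (1 + int (card {(x, y). x \<in> {0..<int p} \<and> y \<in> {0..<int p} \<and>
          [y^2 + A1 W * x * y + A3 W * y = x^3 + A2 W * x^2 + A4 W * x + A6 W] (mod int p)})))"


section \<open>Torsion points\<close>

datatype 'a point = Infinity | Affine 'a 'a

fun on_curve :: "'a::field weierstrass \<Rightarrow> 'a point \<Rightarrow> bool" where
  "on_curve W Infinity \<longleftrightarrow> True"
| "on_curve W (Affine x y) \<longleftrightarrow>
     y^2 + A1 W * x * y + A3 W * y = x^3 + A2 W * x^2 + A4 W * x + A6 W"

fun add_point :: "'a::field weierstrass \<Rightarrow> 'a point \<Rightarrow> 'a point \<Rightarrow> 'a point" where
  "add_point W Infinity Q = Q"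
| "add_point W P Infinity = P"
| "add_point W (Affine x1 y1) (Affine x2 y2) =
     (if x1 = x2 \<and> y1 + y2 + A1 W * x2 + A3 W = 0 then Infinity
      else
        let l = (if x1 = x2
                 then (3 * x1^2 + 2 * A2 W * x1 + A4 W - A1 W * y1) / (2 * y1 + A1 W * x1 + A3 W)
                 else (y2 - y1) / (x2 - x1));
            x3 = l^2 + A1 W * l - A2 W - x1 - x2
        in Affine x3 (- (l * (x3 - x1) + y1) - A1 W * x3 - A3 W))"

definition torsion :: "nat \<Rightarrow> 'a::field weierstrass \<Rightarrow> 'a point set" where
  "torsion n W = {P. on_curve W P \<and> (add_point W P ^^ n) Infinity = Infinity}"


section \<open>The conductor\<close>

definition complex_subring :: "complex set \<Rightarrow> complex ring" where
  "complex_subring K = \<lparr>carrier = K, monoid.mult = (*), one = 1, zero = 0, add = (+)\<rparr>"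

definition torsion_field :: "nat \<Rightarrow> rat weierstrass \<Rightarrow> complex set" where
  "torsion_field l E =
     generate_field (complex_subring UNIV)
       (\<Union>P\<in>torsion l (map_weierstrass of_rat E). set_point P)"

definition ring_of_integers :: "complex set \<Rightarrow> complex ring" where
  "ring_of_integers L = complex_subring {x \<in> L. algebraic_int x}"

definition galois_group :: "complex set \<Rightarrow> (complex \<Rightarrow> complex) set" where
  "galois_group L = ring_iso (complex_subring L) (complex_subring L) \<inter> extensional L"

definition prime_above :: "complex set \<Rightarrow> nat \<Rightarrow> complex set" where
  "prime_above L p = (SOME P. primeideal P (ring_of_integers L) \<and> of_nat p \<in> P)"

text \<open>The \<open>i\<close>-th ramification group (lower numbering) of the completion of \<open>L\<close> at a prime above
  \<open>p\<close>, over the \<open>p\<close>-adic numbers. Its Galois group is the decomposition group, and a \<open>\<sigma>\<close> satisfying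
  the congruence for \<open>i \<ge> 0\<close> lies there automatically. The powers of the prime are taken in
  the monoid of ideals.\<close>

definition ramification_group :: "complex set \<Rightarrow> nat \<Rightarrow> nat \<Rightarrow> (complex \<Rightarrow> complex) set" where
  "ramification_group L p i =
     {\<sigma> \<in> galois_group L. \<forall>x\<in>carrier (ring_of_integers L).
        \<sigma> x - x \<in> prime_above L p [^]\<^bsub>ideals_set (ring_of_integers L)\<^esub> Suc i}"

text \<open>The wild part of the conductor exponent at \<open>p\<close>,
  \<open>\<Sum>i\<ge>1. |G_i| / |G_0| * dim (V / V^{G_i})\<close>, where \<open>V = E[l]\<close> for a prime \<open>l \<noteq> p\<close>, the \<open>G_i\<close> are the
  ramification groups of the field generated by \<open>V\<close>, and \<open>dim\<close> is the dimension over the field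
  with \<open>l\<close> elements, written as the base \<open>l\<close> logarithm of the cardinality. The value is an integer
  and independent of \<open>l\<close>; we take \<open>l = 2\<close>, and \<open>l = 3\<close> for \<open>p = 2\<close>.\<close>

definition wild_exponent :: "rat weierstrass \<Rightarrow> nat \<Rightarrow> real" where
  "wild_exponent E p =
     (let l = (if p = 2 then 3 else 2);
          V = torsion l (map_weierstrass of_rat E);
          G = ramification_group (torsion_field l E) p
      in \<Sum>i. real (card (G (Suc i))) / real (card (G 0)) *
             log (real l) (real (card V) /
                           real (card {P \<in> V. \<forall>\<sigma>\<in>G (Suc i). map_point \<sigma> P = P})))"

text \<open>The cases are good, multiplicative and additive reduction.\<close>

definition conductor_exponent :: "rat weierstrass \<Rightarrow> nat \<Rightarrow> nat" where
  "conductor_exponent E p =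
     (if \<not> int p dvd disc (minimal_model E) then 0
      else if \<not> int p dvd C4 (minimal_model E) then 1
      else 2 + nat \<lfloor>wild_exponent E p\<rfloor>)"

definition conductor :: "rat weierstrass \<Rightarrow> nat" where
  "conductor E =
     (\<Prod>p | prime p \<and> int p dvd disc (minimal_model E). p ^ conductor_exponent E p)"


section \<open>The congruence number\<close>

text \<open>By strong multiplicity one there is at most one newform associated with \<open>E\<close>, and by the
  modularity theorem there is one.\<close>

definition associated_newform :: "rat weierstrass \<Rightarrow> (complex \<Rightarrow> complex) \<Rightarrow> bool" where
  "associated_newform E f \<longleftrightarrow>
     newform (conductor E) f \<and>
     (\<exists>a. q_expansion f a \<and> (\<forall>p. prime p \<longrightarrow> a p = of_int (frobenius_trace E p)))"

definition congruence_number :: "nat \<Rightarrow> (complex \<Rightarrow> complex) \<Rightarrow> nat" where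
  "congruence_number N f =
     (GREATEST m. \<exists>g\<in>cusp_forms N. \<exists>a b :: nat \<Rightarrow> int.
        q_expansion f (\<lambda>n. of_int (a n)) \<and> q_expansion g (\<lambda>n. of_int (b n)) \<and>
        petersson N f g = 0 \<and> (\<forall>n. [a n = b n] (mod int m)))"

end

(* Let f = sum a_k q^k be the newform of E, of level N, and w the number of primes dividing d. All
   primes dividing d are primes of additive reduction, so d^2 divides N and every quadratic twist f_S
   of f by the product of the Legendre symbols (./p), p in a set S of primes dividing d, is again a
   cusp form of level N. For q = 1 mod 4 prime to N one has a_q <> 0 (a binomial coefficient times
   a power of d D^2, modulo q), and some such q, dividing a number x^2 + 4, has twisting character -1;
   as the Hecke operator T_q is self-adjoint, f is orthogonal to all f_S with S nonempty.

   Fix signs s_p with product -1. The product of the factors 1 + s_p (k/p) is 2^w on the k with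
   (k/p) = s_p for all p and 0 on the other k prime to d, and expanding it shows that the part of f on
   these k, multiplied by 2^w, is f plus a combination of the f_S with S nonempty. On these k one has
   (k/d) = -1, which forces 4 | a_k: for a prime k = 3 mod 4 the coefficient vanishes, and for
   k = 1 mod 4 the sum of the symbols of x^3 - d D^2 x is twice a sum of evenly many signs. So f is
   congruent modulo 2^(w + 2) to a form orthogonal to it. As congruences can be combined by the Chinese
   remainder theorem, and the moduli are bounded because finitely many coefficients determine a form,
   2^(w + 2) divides the congruence number. The exact conductor at 2 is irrelevant. *)
theory Submission
  imports Defs "HOL-Real_Asymp.Real_Asymp" "HOL-Complex_Analysis.Complex_Analysis"
    "HOL-Number_Theory.Quadratic_Reciprocity" "HOL-Number_Theory.Residue_Primitive_Roots"
begin

text \<open>The congruence number is a \<open>GREATEST\<close>, so one large modulus says nothing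
  about its 2-adic valuation unless the set of moduli is bounded and closed under
  \<open>lcm\<close>. Boundedness takes a Sturm bound together with the definiteness of the
  Petersson product, which shows that no nonzero multiple of f is orthogonal to f. The prime q has
  to be 1 modulo 4 because a_q = 0 for q = 3 modulo 4, and then T_q cannot separate f from f_S; a
  prime factor of x^2 + 4 yields this congruence and the value of the character together.
  Reciprocity enters only at primes k = 1 modulo 4: it turns (k/d) = -1 into (d/k) = -1, and then
  x^2 - d D^2 has no root modulo k. The heaviest part is the self-adjointness of T_q, since the
  product is an integral over chosen coset representatives: it is unfolded into finitely many
  integrals over pieces of the fundamental domain, which an involution of the index set pairs off.
  The exponent w + 2 suffices because 2 floor((w + 1)/2) + 1 is w + 2 for odd w and w + 1 for even
  w.\<close>

no_notation fps_nth (infixl "$" 75)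

section \<open>Integer matrices and fractional linear maps\<close>

definition auto_factor :: "int ^ 2 ^ 2 \<Rightarrow> complex \<Rightarrow> complex" where
  "auto_factor A z = of_int (A $ 2 $ 1) * z + of_int (A $ 2 $ 2)"

definition frac_lin :: "int ^ 2 ^ 2 \<Rightarrow> complex \<Rightarrow> complex" where
  "frac_lin A z = (of_int (A $ 1 $ 1) * z + of_int (A $ 1 $ 2)) / auto_factor A z"

text \<open>The adjugate stands in for the inverse, so that all matrices stay integral: it is the
  inverse on \<open>SL2Z\<close>, and for any positive determinant it inverts the fractional linear
  map.\<close>

definition adj2 :: "int ^ 2 ^ 2 \<Rightarrow> int ^ 2 ^ 2" where
  "adj2 A = vector [vector [A $ 2 $ 2, - A $ 1 $ 2], vector [- A $ 2 $ 1, A $ 1 $ 1]]"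

definition mat2 :: "int \<Rightarrow> int \<Rightarrow> int \<Rightarrow> int \<Rightarrow> int ^ 2 ^ 2" where
  "mat2 a b c d = vector [vector [a, b], vector [c, d]]"

lemma mat2_nth [simp]:
  "mat2 a b c d $ 1 $ 1 = a" "mat2 a b c d $ 1 $ 2 = b"
  "mat2 a b c d $ 2 $ 1 = c" "mat2 a b c d $ 2 $ 2 = d"
  by (simp_all add: mat2_def vector_2)

lemma mat2_eq_iff:
  fixes A B :: "int ^ 2 ^ 2"
  shows "A = B \<longleftrightarrow> A $ 1 $ 1 = B $ 1 $ 1 \<and> A $ 1 $ 2 = B $ 1 $ 2 \<and> A $ 2 $ 1 = B $ 2 $ 1 \<and> A $ 2 $ 2 = B $ 2 $ 2"
  unfolding vec_eq_iff forall_2 by blast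

lemma mat2_mult_nth [simp]:
  fixes A B :: "int ^ 2 ^ 2"
  shows "(A ** B) $ i $ j = A $ i $ 1 * B $ 1 $ j + A $ i $ 2 * B $ 2 $ j"
  by (simp add: matrix_matrix_mult_def sum_2)

lemma adj2_nth [simp]:
  "adj2 A $ 1 $ 1 = A $ 2 $ 2" "adj2 A $ 1 $ 2 = - A $ 1 $ 2"
  "adj2 A $ 2 $ 1 = - A $ 2 $ 1" "adj2 A $ 2 $ 2 = A $ 1 $ 1"
  by (simp_all add: adj2_def vector_2)

lemma mat_nth2 [simp]:
  "(mat k :: int ^ 2 ^ 2) $ 1 $ 1 = k" "(mat k :: int ^ 2 ^ 2) $ 1 $ 2 = 0"
  "(mat k :: int ^ 2 ^ 2) $ 2 $ 1 = 0" "(mat k :: int ^ 2 ^ 2) $ 2 $ 2 = k"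
  by (simp_all add: mat_def)

lemma det_mult2:
  fixes A B :: "int ^ 2 ^ 2"
  shows "det (A ** B) = det A * det B"
  by (simp add: det_2 algebra_simps)

lemma det_adj2 [simp]: "det (adj2 A) = det A"
  by (simp add: det_2)

lemma adj2_adj2 [simp]: "adj2 (adj2 A) = A"
  by (simp add: mat2_eq_iff)

lemma adj2_mult: "adj2 (A ** B) = adj2 B ** adj2 A"
  by (simp add: mat2_eq_iff)

lemma mult_adj2: "A ** adj2 A = mat (det A)" "adj2 A ** A = mat (det A)"
  by (simp_all add: mat2_eq_iff det_2)

lemma mat2_mult_assoc:
  fixes A B C :: "int ^ 2 ^ 2"
  shows "(A ** B) ** C = A ** (B ** C)"
  by (simp add: mat2_eq_iff algebra_simps)

lemma mat2_mult_1 [simp]: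
  fixes A :: "int ^ 2 ^ 2"
  shows "mat 1 ** A = A" "A ** mat 1 = A"
  by (simp_all add: mat2_eq_iff)

lemma SL2Z_iff: "A \<in> SL2Z \<longleftrightarrow> det A = 1"
  by (simp add: SL2Z_def)

lemma SL2Z_one [simp]: "mat 1 \<in> SL2Z"
  by (simp add: SL2Z_iff det_2)

lemma SL2Z_mult: "A \<in> SL2Z \<Longrightarrow> B \<in> SL2Z \<Longrightarrow> A ** B \<in> SL2Z"
  by (simp add: SL2Z_iff det_mult2)

lemma SL2Z_adj2: "A \<in> SL2Z \<Longrightarrow> adj2 A \<in> SL2Z"
  by (simp add: SL2Z_iff)

lemma SL2Z_adj2_mult:
  fixes A B :: "int ^ 2 ^ 2"
  assumes "A \<in> SL2Z"
  shows "A ** adj2 A = mat 1" "adj2 A ** A = mat 1"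
    "A ** (adj2 A ** B) = B" "adj2 A ** (A ** B) = B"
proof -
  show *: "A ** adj2 A = mat 1" "adj2 A ** A = mat 1"
    using assms by (simp_all add: mult_adj2 SL2Z_iff)
  show "A ** (adj2 A ** B) = B" "adj2 A ** (A ** B) = B"
    by (simp_all only: * mat2_mult_assoc[symmetric] mat2_mult_1)
qed

lemma Gamma0_subset: "A \<in> Gamma0 N \<Longrightarrow> A \<in> SL2Z"
  by (simp add: Gamma0_def)

lemma Gamma0_one [simp]: "mat 1 \<in> Gamma0 N"
  by (simp add: Gamma0_def)

lemma Gamma0_mult: "A \<in> Gamma0 N \<Longrightarrow> B \<in> Gamma0 N \<Longrightarrow> A ** B \<in> Gamma0 N"
  by (auto simp: Gamma0_def SL2Z_mult)

lemma Gamma0_adj2: "A \<in> Gamma0 N \<Longrightarrow> adj2 A \<in> Gamma0 N"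
  by (auto simp: Gamma0_def SL2Z_adj2)

lemma slash_altdef: "slash f A z = f (frac_lin A z) / auto_factor A z ^ 2"
  by (simp add: slash_def frac_lin_def auto_factor_def)

lemma auto_factor_nonzero:
  assumes "det A > 0" "Im z > 0"
  shows "auto_factor A z \<noteq> 0"
proof
  assume *: "auto_factor A z = 0"
  hence "Im (auto_factor A z) = 0" "Re (auto_factor A z) = 0" by simp_all
  hence "A $ 2 $ 1 = 0" "A $ 2 $ 2 = 0" using assms(2) by (auto simp: auto_factor_def)
  thus False using assms(1) by (simp add: det_2)
qed

lemma Im_frac_lin:
  assumes "det A > 0" "Im z > 0"
  shows "Im (frac_lin A z) = of_int (det A) * Im z / norm (auto_factor A z) ^ 2"
proof -
  define j where "j = auto_factor A z"
  define a b c d where "a = real_of_int (A $ 1 $ 1)" and "b = real_of_int (A $ 1 $ 2)" 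
    and "c = real_of_int (A $ 2 $ 1)" and "d = real_of_int (A $ 2 $ 2)"
  have "frac_lin A z = (of_real a * z + of_real b) / j"
    by (simp add: frac_lin_def j_def a_def b_def)
  also have "\<dots> = (of_real a * z + of_real b) * cnj j / (norm j ^ 2)"
    by (subst complex_div_cnj) (simp)
  also have "Im \<dots> = Im ((of_real a * z + of_real b) * cnj j) / (norm j ^ 2)"
    by (metis Im_divide_of_real of_real_power)
  also have "Im ((of_real a * z + of_real b) * cnj j) = (a * d - b * c) * Im z"
    by (simp add: j_def auto_factor_def c_def d_def algebra_simps)
  also have "a * d - b * c = of_int (det A)"
    by (simp add: det_2 a_def b_def c_def d_def)
  finally show ?thesis by (simp add: j_def)
qed

lemma Im_frac_lin_pos:
  assumes "det A > 0" "Im z > 0"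
  shows "Im (frac_lin A z) > 0"
  using assms auto_factor_nonzero[OF assms] by (simp add: Im_frac_lin)

lemma auto_factor_mult:
  assumes "auto_factor B z \<noteq> 0"
  shows "auto_factor (A ** B) z = auto_factor A (frac_lin B z) * auto_factor B z"
  using assms unfolding frac_lin_def
  by (simp add: auto_factor_def field_simps)

lemma frac_lin_mult:
  assumes "auto_factor B z \<noteq> 0" "auto_factor A (frac_lin B z) \<noteq> 0"
  shows "frac_lin (A ** B) z = frac_lin A (frac_lin B z)"
proof -
  define w where "w = frac_lin B z"
  have w: "w * auto_factor B z = of_int (B $ 1 $ 1) * z + of_int (B $ 1 $ 2)"
    using assms(1) by (simp add: w_def frac_lin_def)
  have "frac_lin (A ** B) z = (of_int (A $ 1 $ 1) * w + of_int (A $ 1 $ 2)) * auto_factor B z /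
      (auto_factor A w * auto_factor B z)"
    unfolding frac_lin_def[of "A ** B"] auto_factor_mult[OF assms(1)] w_def[symmetric]
    by (simp add: distrib_right mult.assoc w) (simp add: auto_factor_def algebra_simps)
  also have "\<dots> = frac_lin A w"
    using assms(1) by (simp add: frac_lin_def)
  finally show ?thesis by (simp add: w_def)
qed

lemma frac_lin_mult_det:
  assumes "det A > 0" "det B > 0" "Im z > 0"
  shows "frac_lin (A ** B) z = frac_lin A (frac_lin B z)"
    and "auto_factor (A ** B) z = auto_factor A (frac_lin B z) * auto_factor B z"
  using assms by (simp_all add: frac_lin_mult auto_factor_mult auto_factor_nonzero Im_frac_lin_pos)

text \<open>The cocycle relation for \<open>auto_factor\<close>. As \<open>slash\<close> carries no
  power of the determinant, it is an action of all integer matrices of positive determinant, so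
  Hecke matrices are covered by the same operator.\<close>

lemma slash_mult:
  assumes "det A > 0" "det B > 0" "Im z > 0"
  shows "slash f (A ** B) z = slash (slash f A) B z"
  using frac_lin_mult_det[OF assms] by (simp add: slash_altdef power_mult_distrib)

lemma frac_lin_scalar [simp]: "k \<noteq> 0 \<Longrightarrow> frac_lin (mat k) z = z"
  and auto_factor_scalar [simp]: "auto_factor (mat k) z = of_int k"
  by (simp_all add: frac_lin_def auto_factor_def)

lemma slash_one [simp]: "slash f (mat 1) = f"
  by (simp add: slash_altdef fun_eq_iff)

lemma frac_lin_adj2:
  assumes "det A > 0" "Im z > 0"
  shows "frac_lin A (frac_lin (adj2 A) z) = z" "frac_lin (adj2 A) (frac_lin A z) = z"
  using frac_lin_mult_det(1)[of A "adj2 A" z] frac_lin_mult_det(1)[of "adj2 A" A z] assms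
  by (simp_all add: mult_adj2)

lemma auto_factor_adj2:
  assumes "det A > 0" "Im z > 0"
  shows "auto_factor A (frac_lin (adj2 A) z) * auto_factor (adj2 A) z = of_int (det A)"
  using frac_lin_mult_det(2)[of A "adj2 A" z] assms
  by (simp add: mult_adj2)

lemma slash_cong:
  assumes "det A > 0" "Im z > 0" "\<And>w. Im w > 0 \<Longrightarrow> f w = g w"
  shows "slash f A z = slash g A z"
  using assms(3)[OF Im_frac_lin_pos[OF assms(1,2)]] by (simp add: slash_altdef)

lemma frac_lin_holomorphic:
  assumes "det A > 0"
  shows "frac_lin A holomorphic_on {z. Im z > 0}"
  unfolding frac_lin_def auto_factor_def
  by (intro holomorphic_intros) (use auto_factor_nonzero[OF assms] in \<open>auto simp: auto_factor_def\<close>)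

lemma slash_holomorphic:
  assumes "det A > 0" "f holomorphic_on upper_half_plane"
  shows "slash f A holomorphic_on upper_half_plane"
proof -
  have "(f \<circ> frac_lin A) holomorphic_on upper_half_plane"
    by (rule holomorphic_on_compose_gen[OF _ assms(2)])
       (use frac_lin_holomorphic[OF assms(1)] Im_frac_lin_pos[OF assms(1)] in \<open>auto simp: upper_half_plane_def\<close>)
  moreover have "(\<lambda>z. auto_factor A z ^ 2) holomorphic_on upper_half_plane"
    unfolding auto_factor_def by (intro holomorphic_intros)
  ultimately have "(\<lambda>z. (f \<circ> frac_lin A) z / auto_factor A z ^ 2) holomorphic_on upper_half_plane"
    by (rule holomorphic_on_divide) (use auto_factor_nonzero[OF assms(1)] in \<open>auto simp: upper_half_plane_def\<close>)
  thus ?thesis unfolding slash_altdef[abs_def] o_def .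
qed

lemma frac_lin_deriv:
  assumes "det A > 0" "Im z > 0"
  shows "(frac_lin A has_field_derivative of_int (det A) / auto_factor A z ^ 2) (at z)"
proof -
  have nz: "of_int (A $ 2 $ 1) * z + of_int (A $ 2 $ 2) \<noteq> (0 :: complex)"
    using auto_factor_nonzero[OF assms] by (simp add: auto_factor_def)
  show ?thesis
    unfolding frac_lin_def auto_factor_def
    by (rule derivative_eq_intros refl nz)+ (use nz in \<open>simp add: det_2 power2_eq_square algebra_simps\<close>)
qed

lemma frac_lin_inj:
  assumes "det A > 0"
  shows "inj_on (frac_lin A) {z. Im z > 0}"
  by (rule inj_on_inverseI[of _ "frac_lin (adj2 A)"]) (use frac_lin_adj2[OF assms] in auto)


section \<open>The fundamental domain\<close>

definition fund_interior :: "complex set" where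
  "fund_interior = {z. Im z > 0 \<and> \<bar>Re z\<bar> < 1 / 2 \<and> 1 < norm z}"

lemma finite_lattice_points_small:
  assumes "Im z > 0"
  shows "finite {(c :: int, d :: int). norm (of_int c * z + of_int d) \<le> r}"
proof -
  define K where "K = r / Im z"
  define L where "L = r + K * norm z"
  have "{(c, d). norm (of_int c * z + of_int d) \<le> r} \<subseteq> {-\<lceil>K\<rceil>..\<lceil>K\<rceil>} \<times> {-\<lceil>L\<rceil>..\<lceil>L\<rceil>}"
  proof safe
    fix c d :: int assume *: "norm (of_int c * z + of_int d) \<le> r"
    have "\<bar>of_int c * Im z\<bar> \<le> norm (of_int c * z + of_int d)"
      using abs_Im_le_cmod[of "of_int c * z + of_int d"] by simp
    hence c: "\<bar>of_int c\<bar> \<le> K" using * assms by (simp add: K_def field_simps abs_mult)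
    have "norm (of_int d :: complex) \<le> norm (of_int c * z + of_int d) + norm (of_int c * z)"
      by (metis add_diff_cancel_left' norm_triangle_ineq4)
    also have "norm (of_int c * z) \<le> K * norm z"
      using c by (simp add: norm_mult mult_right_mono)
    finally have d: "\<bar>of_int d\<bar> \<le> L" using * by (simp add: L_def)
    show "c \<in> {-\<lceil>K\<rceil>..\<lceil>K\<rceil>}" "d \<in> {-\<lceil>L\<rceil>..\<lceil>L\<rceil>}"
      using c d by (auto simp: abs_le_iff) linarith+
  qed
  thus ?thesis by (rule finite_subset) auto
qed

lemma frac_lin_translation: "frac_lin (mat2 1 b 0 1) z = z + of_int b"
  and auto_factor_translation: "auto_factor (mat2 1 b 0 1) z = 1"
  by (simp_all add: frac_lin_def auto_factor_def)

lemma det_mat2 [simp]: "det (mat2 a b c d) = a * d - b * c"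
  by (simp add: det_2)

text \<open>Among the images of z one of maximal height is chosen, that is, one with minimal
  \<open>norm (auto_factor A z)\<close>. A translation brings the real part into range without
  changing that value, and minimality against the inversion of the new point says that its norm is
  at least 1.\<close>

lemma fundamental_domain_covers:
  assumes "Im z > 0"
  obtains A where "A \<in> SL2Z" "frac_lin A z \<in> fundamental_domain"
proof -
  \<comment> \<open>The identity gives the value 1, so larger values cannot be minimal; up to 1 only
    finitely many lower rows occur.\<close>
  define X where "X = (\<lambda>A. norm (auto_factor A z)) ` {A \<in> SL2Z. norm (auto_factor A z) \<le> 1}"
  have "X \<subseteq> (\<lambda>(c, d). norm (of_int c * z + of_int d)) ` {(c :: int, d :: int). norm (of_int c * z + of_int d) \<le> 1}"
    unfolding X_def auto_factor_def by auto
  hence fin: "finite X" using finite_lattice_points_small[OF assms, of 1] finite_surj by blast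
  have "norm (auto_factor (mat 1) z) \<in> X" unfolding X_def by (intro imageI) simp
  hence "Min X \<in> X" using fin by (intro Min_in) auto
  then obtain A where A: "A \<in> SL2Z" "norm (auto_factor A z) \<le> 1" "norm (auto_factor A z) = Min X"
    unfolding X_def by auto
  have min: "norm (auto_factor A z) \<le> norm (auto_factor B z)" if "B \<in> SL2Z" for B
  proof (cases "norm (auto_factor B z) \<le> 1")
    case True
    hence "norm (auto_factor B z) \<in> X" using that by (auto simp: X_def)
    thus ?thesis using A(3) fin by simp
  next
    case False
    thus ?thesis using A(2) by linarith
  qed
  define n where "n = round (Re (frac_lin A z))"
  define T where "T = mat2 1 (-n) 0 1"
  define B where "B = T ** A"
  define w where "w = frac_lin B z"
  have dA: "det A > 0" using A(1) by (simp add: SL2Z_iff)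
  have T: "T \<in> SL2Z" by (simp add: T_def SL2Z_iff)
  hence B: "B \<in> SL2Z" using A(1) by (simp add: B_def SL2Z_mult)
  have w: "w = frac_lin A z - of_int n"
    using dA assms T by (simp add: w_def B_def frac_lin_mult_det SL2Z_iff) (simp add: T_def frac_lin_translation)
  have JB: "auto_factor B z = auto_factor A z"
    using dA assms T by (simp add: B_def frac_lin_mult_det SL2Z_iff) (simp add: T_def auto_factor_translation)
  have Imw: "Im w > 0" using Im_frac_lin_pos[OF dA assms] by (simp add: w)
  have Rew: "\<bar>Re w\<bar> \<le> 1 / 2" using of_int_round_abs_le[of "Re (frac_lin A z)"]
    by (simp add: w n_def abs_minus_commute)
  define S where "S = mat2 0 (-1) 1 0"
  have S: "S \<in> SL2Z" by (simp add: S_def SL2Z_iff)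
  have "norm (auto_factor A z) \<le> norm (auto_factor (S ** B) z)"
    using S B by (intro min SL2Z_mult)
  also have "auto_factor (S ** B) z = w * auto_factor B z"
    using B assms S by (simp add: frac_lin_mult_det SL2Z_iff flip: w_def) (simp add: S_def auto_factor_def)
  finally have "norm (auto_factor A z) \<le> norm w * norm (auto_factor A z)" by (simp add: JB norm_mult)
  hence "1 \<le> norm w" using auto_factor_nonzero[OF dA assms] by simp
  hence "w \<in> fundamental_domain" using Imw Rew by (simp add: fundamental_domain_def upper_half_plane_def)
  thus ?thesis using that B by (simp add: w_def)
qed

section \<open>Equivalent points of the fundamental domain\<close>

lemma fundamental_domainD:
  assumes "z \<in> fundamental_domain"
  shows "Im z > 0" "\<bar>Re z\<bar> \<le> 1 / 2" "1 \<le> norm z" "Im z > 1 / 2"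
proof -
  show *: "Im z > 0" "\<bar>Re z\<bar> \<le> 1 / 2" "1 \<le> norm z"
    using assms by (auto simp: fundamental_domain_def upper_half_plane_def)
  have "1 \<le> (Re z)\<^sup>2 + (Im z)\<^sup>2" using *(3) by (simp add: cmod_def)
  also have "(Re z)\<^sup>2 \<le> (1 / 2)\<^sup>2" using *(2) by (metis abs_le_square_iff abs_of_nonneg zero_le_divide_1_iff zero_le_numeral)
  finally have "(1 / 2)\<^sup>2 < (Im z)\<^sup>2" by (simp add: power2_eq_square)
  thus "Im z > 1 / 2" using power2_less_imp_less[of "1 / 2" "Im z"] *(1) by simp
qed

text \<open>This form is the minimum of |c z + d|^2 over the fundamental domain, attained at a
  corner; twice it is a sum of squares.\<close>

lemma int_form_ge_1:
  fixes c d :: int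
  assumes "c \<noteq> 0 \<or> d \<noteq> 0"
  shows "c\<^sup>2 - \<bar>c * d\<bar> + d\<^sup>2 \<ge> 1"
proof -
  have "2 * (c\<^sup>2 - \<bar>c * d\<bar> + d\<^sup>2) = c\<^sup>2 + d\<^sup>2 + (\<bar>c\<bar> - \<bar>d\<bar>)\<^sup>2"
    by (simp add: power2_eq_square algebra_simps abs_mult)
  moreover have "c\<^sup>2 + d\<^sup>2 > 0" using assms by (simp add: sum_power2_gt_zero_iff)
  ultimately show ?thesis
    by (smt (verit) zero_le_power2)
qed

lemma norm_linear_sq:
  "norm (of_int c * z + of_int d) ^ 2 = of_int (c\<^sup>2) * norm z ^ 2 + 2 * of_int (c * d) * Re z + of_int (d\<^sup>2)"
  unfolding cmod_power2 by (simp add: power2_eq_square algebra_simps)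

lemma norm_linear_ge_1:
  assumes "\<bar>Re z\<bar> \<le> 1 / 2" "1 \<le> norm z" "c \<noteq> 0 \<or> d \<noteq> 0"
  shows "norm (of_int c * z + of_int d) ^ 2 \<ge> 1"
    and "1 < norm z \<Longrightarrow> c \<noteq> 0 \<Longrightarrow> norm (of_int c * z + of_int d) ^ 2 > 1"
proof -
  have "\<bar>2 * of_int (c * d) * Re z\<bar> \<le> \<bar>real_of_int (c * d)\<bar> * 1"
    unfolding abs_mult using assms(1) mult_left_mono[of "2 * \<bar>Re z\<bar>" 1 "\<bar>real_of_int (c * d)\<bar>"] 
    by (simp add: mult_ac)
  hence 1: "2 * of_int (c * d) * Re z \<ge> - of_int \<bar>c * d\<bar>" by linarith
  have 2: "real_of_int (c\<^sup>2 - \<bar>c * d\<bar> + d\<^sup>2) \<ge> 1" using int_form_ge_1[OF assms(3)] by linarith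
  have 3: "1 \<le> (norm z)\<^sup>2" using assms(2) by simp
  have "of_int (c\<^sup>2) * (norm z)\<^sup>2 \<ge> of_int (c\<^sup>2) * 1" using 3 by (intro mult_left_mono) auto
  thus "norm (of_int c * z + of_int d) ^ 2 \<ge> 1"
    unfolding norm_linear_sq using 1 2 by simp
  assume *: "1 < norm z" "c \<noteq> 0"
  have "of_int (c\<^sup>2) * (norm z)\<^sup>2 > of_int (c\<^sup>2) * 1" using * by (intro mult_strict_left_mono) auto
  thus "norm (of_int c * z + of_int d) ^ 2 > 1"
    unfolding norm_linear_sq using 1 2 by simp
qed

text \<open>If the lower left entry were nonzero, A would strictly lower the height of an interior
  point, while its inverse cannot raise the height of a point of the closed domain. So A is a
  translation up to sign, of length less than 1.\<close>

lemma fund_interior_unique: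
  assumes "z \<in> fund_interior" "A \<in> SL2Z" "frac_lin A z \<in> fundamental_domain"
  shows "A = mat 1 \<or> A = mat (-1)"
proof -
  define w where "w = frac_lin A z"
  have z: "Im z > 0" "\<bar>Re z\<bar> < 1 / 2" "1 < norm z" using assms(1) by (auto simp: fund_interior_def)
  have w: "Im w > 0" "\<bar>Re w\<bar> \<le> 1 / 2" "1 \<le> norm w" 
    using fundamental_domainD[OF assms(3)] by (auto simp: w_def)
  have dA: "det A = 1" using assms by (simp add: SL2Z_iff)
  hence dA': "A $ 1 $ 1 * A $ 2 $ 2 - A $ 1 $ 2 * A $ 2 $ 1 = 1" by (simp add: det_2)
  have zw: "z = frac_lin (adj2 A) w" using dA z(1) by (simp add: w_def frac_lin_adj2)
  have Imw: "Im w = Im z / norm (auto_factor A z) ^ 2" 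
    using Im_frac_lin[of A z] dA z(1) by (simp add: w_def)
  have Imz: "Im z = Im w / norm (auto_factor (adj2 A) w) ^ 2" 
    using Im_frac_lin[of "adj2 A" w] dA w(1) by (simp flip: zw)
  have c: "A $ 2 $ 1 = 0"
  proof (rule ccontr)
    assume c: "A $ 2 $ 1 \<noteq> 0"
    have "norm (auto_factor A z) ^ 2 > 1"
      unfolding auto_factor_def using z c by (intro norm_linear_ge_1(2)) auto
    hence "Im w < Im z" using z(1) by (simp add: Imw divide_less_eq)
    moreover have "norm (auto_factor (adj2 A) w) ^ 2 \<ge> 1"
      unfolding auto_factor_def using w c by (intro norm_linear_ge_1(1)) auto
    hence "Im z \<le> Im w" unfolding Imz using w(1) by (smt (verit) divide_le_eq_1 divide_left_mono div_by_1 mult_pos_pos zero_less_one)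
    ultimately show False by simp
  qed
  hence ad: "A $ 1 $ 1 * A $ 2 $ 2 = 1" using dA' by simp
  hence ad': "A $ 1 $ 1 = 1 \<and> A $ 2 $ 2 = 1 \<or> A $ 1 $ 1 = -1 \<and> A $ 2 $ 2 = -1"
    using zmult_eq_1_iff by blast
  have "w = z + of_int (A $ 1 $ 2 * A $ 2 $ 2)"
    using ad' c by (auto simp: w_def frac_lin_def auto_factor_def)
  hence "Re w = Re z + of_int (A $ 1 $ 2 * A $ 2 $ 2)" by simp
  hence "\<bar>real_of_int (A $ 1 $ 2 * A $ 2 $ 2)\<bar> < 1" using z(2) w(2) by linarith
  hence "\<bar>A $ 1 $ 2 * A $ 2 $ 2\<bar> < 1" by linarith
  hence b: "A $ 1 $ 2 = 0" using ad' by auto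
  show ?thesis using ad' b c unfolding mat2_eq_iff mat_nth2 by blast
qed

text \<open>If c is nonzero, the heights above 1/2 of w and of its image bound the lower row, the
  adjugate applied to the image bounds the upper left entry, and the determinant bounds b. If c = 0,
  then a d = q and the real parts bound b. This makes the unfolded Hecke operator a finite
  sum.\<close>

lemma finite_meeting_fundamental_domain:
  assumes "q > 0"
  shows "finite {C. det C = q \<and> (\<exists>w\<in>fundamental_domain. frac_lin C w \<in> fundamental_domain)}" (is "finite ?X")
proof -
  have bound: "\<bar>C $ 2 $ 1\<bar> \<le> 4 * q \<and> (C $ 2 $ 1 \<noteq> 0 \<longrightarrow> \<bar>C $ 2 $ 2\<bar> \<le> 4 * q)"
    if "det C = q" "w \<in> fundamental_domain" "frac_lin C w \<in> fundamental_domain" for C w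
  proof -
    define c d where "c = C $ 2 $ 1" and "d = C $ 2 $ 2"
    define y where "y = Im w"
    note w = fundamental_domainD[OF that(2)] and v = fundamental_domainD[OF that(3)]
    have y: "y > 1 / 2" using w by (simp add: y_def)
    have J0: "norm (auto_factor C w) > 0" using auto_factor_nonzero[of C w] that assms w by simp
    have "1 / 2 < Im (frac_lin C w)" using v by simp
    also have "\<dots> = of_int q * y / norm (auto_factor C w) ^ 2"
      using Im_frac_lin[of C w] that assms w by (simp add: y_def)
    finally have J: "norm (auto_factor C w) ^ 2 < 2 * of_int q * y" using J0 by (simp add: field_simps)
    have re_im: "norm (auto_factor C w) ^ 2 = (of_int c * Re w + of_int d)\<^sup>2 + (of_int c * y)\<^sup>2"
      by (simp add: cmod_power2 auto_factor_def c_def d_def y_def)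
    have "(of_int c * y)\<^sup>2 < 2 * of_int q * y" using J re_im zero_le_power2[of "of_int c * Re w + of_int d"] by linarith
    hence cy: "of_int c ^ 2 * y < 2 * of_int q" using y by (simp add: power2_eq_square algebra_simps)
    moreover have "of_int c ^ 2 * y \<ge> of_int c ^ 2 * (1 / 2 :: real)" using y by (intro mult_left_mono) auto
    ultimately have "real_of_int (c ^ 2) < of_int (4 * q)" by simp
    hence c2: "c ^ 2 < 4 * q" by linarith
    have c: "\<bar>c\<bar> \<le> 4 * q"
    proof (cases "c = 0")
      case False
      hence "\<bar>c\<bar> * 1 \<le> \<bar>c\<bar> * \<bar>c\<bar>" by (intro mult_left_mono) auto
      also have "\<bar>c\<bar> * \<bar>c\<bar> = c ^ 2" by (simp add: power2_eq_square)
      finally show ?thesis using c2 by linarith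
    qed (use assms in auto)
    moreover have "\<bar>d\<bar> \<le> 4 * q" if "c \<noteq> 0"
    proof -
      have "c ^ 2 \<ge> 1" using that by (metis int_one_le_iff_zero_less zero_less_power2)
      hence "real_of_int c ^ 2 * y \<ge> 1 * y" using y by (intro mult_right_mono) (simp_all flip: of_int_power)
      hence "y < 2 * of_int q" using cy by linarith
      hence "2 * of_int q * y \<le> 2 * of_int q * (2 * of_int q)" using assms by (intro mult_left_mono) auto
      hence "(of_int c * Re w + of_int d)\<^sup>2 \<le> 2 * of_int q * (2 * of_int q)"
        using J re_im zero_le_power2[of "of_int c * y"] by linarith
      also have "\<dots> = (2 * of_int q)\<^sup>2" by (simp only: power2_eq_square)
      finally have "(of_int c * Re w + of_int d)\<^sup>2 \<le> (2 * real_of_int q)\<^sup>2" .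
      hence 1: "\<bar>of_int c * Re w + of_int d\<bar> \<le> 2 * of_int q"
        using assms abs_le_square_iff[of "of_int c * Re w + of_int d" "2 * real_of_int q"] by simp
      have "\<bar>of_int c * Re w\<bar> \<le> of_int (4 * q) * (1 / 2)"
        unfolding abs_mult using w(2) by (intro mult_mono) (use c assms in linarith)+
      hence "\<bar>of_int d\<bar> \<le> real_of_int (4 * q)" using 1 by simp
      thus ?thesis by linarith
    qed
    ultimately show ?thesis by (simp add: c_def d_def)
  qed
  \<comment> \<open>For c nonzero, |b| is at most |a d| + q, hence at most 16 q^2 + q; the other
    entries are at most 4 q.\<close>
  define K where "K = 16 * q * q + 4 * q + q"
  have q1: "q \<ge> 1" "q * q \<ge> 1 * 1" using assms by (simp, intro mult_mono) auto
  have "?X \<subseteq> (\<lambda>(a, b, c, d). mat2 a b c d) ` ({-K..K} \<times> {-K..K} \<times> {-K..K} \<times> {-K..K})"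
  proof safe
    fix C w assume C: "q = det C" and w: "w \<in> fundamental_domain" "frac_lin C w \<in> fundamental_domain"
    define a b c d where "a = C $ 1 $ 1" and "b = C $ 1 $ 2" and "c = C $ 2 $ 1" and "d = C $ 2 $ 2"
    have Ceq: "C = mat2 a b c d" by (simp add: mat2_eq_iff a_def b_def c_def d_def)
    have dt: "a * d - b * c = q" using C by (simp add: det_2 a_def b_def c_def d_def)
    have wv: "frac_lin (adj2 C) (frac_lin C w) = w"
      using C assms fundamental_domainD(1)[OF w(1)] by (simp add: frac_lin_adj2)
    note 1 = bound[OF C[symmetric] w] 
    have 2: "\<bar>c\<bar> \<le> 4 * q \<and> (c \<noteq> 0 \<longrightarrow> \<bar>a\<bar> \<le> 4 * q)"
      using bound[of "adj2 C" "frac_lin C w"] C w wv by (simp add: a_def c_def)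
    have "\<bar>a\<bar> \<le> K \<and> \<bar>b\<bar> \<le> K \<and> \<bar>c\<bar> \<le> K \<and> \<bar>d\<bar> \<le> K"
    proof (cases "c = 0")
      case False
      have ad: "\<bar>a\<bar> \<le> 4 * q" "\<bar>d\<bar> \<le> 4 * q" "\<bar>c\<bar> \<le> 4 * q"
        using 1 2 False by (auto simp: c_def d_def)
      have "\<bar>b\<bar> * 1 \<le> \<bar>b\<bar> * \<bar>c\<bar>" using False by (intro mult_left_mono) auto
      also have "\<bar>b\<bar> * \<bar>c\<bar> = \<bar>a * d - q\<bar>" using dt using dt unfolding abs_mult[symmetric] by (metis add_diff_cancel_left' diff_add_cancel)
      also have "\<dots> \<le> \<bar>a\<bar> * \<bar>d\<bar> + q" using assms abs_triangle_ineq4[of "a * d" q] by (simp add: abs_mult)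
      also have "\<bar>a\<bar> * \<bar>d\<bar> \<le> (4 * q) * (4 * q)" using ad assms by (intro mult_mono) auto
      finally show ?thesis using ad q1 unfolding K_def by auto
    next
      case True
      have ad: "a * d = q" using dt True by simp
      have "a \<noteq> 0" "d \<noteq> 0" using ad assms by auto
      hence ad': "\<bar>a\<bar> \<le> q" "\<bar>d\<bar> \<le> q" 
        using assms dvd_imp_le_int[of q a] dvd_imp_le_int[of q d] by (auto simp flip: ad)
      have d0: "d \<noteq> 0" using ad assms by auto
      have "frac_lin C w = (of_int a * w + of_int b) / of_int d"
        using True by (simp add: frac_lin_def auto_factor_def a_def b_def c_def d_def)
      hence "of_int d * frac_lin C w = of_int a * w + of_int b" using d0 by simp
      hence "Re (of_int d * frac_lin C w) = Re (of_int a * w + of_int b)" by (rule arg_cong)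
      hence "of_int b = of_int d * Re (frac_lin C w) - of_int a * Re w" by simp
      hence "\<bar>of_int b\<bar> \<le> \<bar>of_int d * Re (frac_lin C w)\<bar> + \<bar>of_int a * Re w\<bar>" by linarith
      also have "\<dots> \<le> of_int q * (1 / 2) + of_int q * (1 / 2)"
        unfolding abs_mult using ad' fundamental_domainD(2)[OF w(1)] fundamental_domainD(2)[OF w(2)] assms
        by (intro add_mono mult_mono) linarith+
      finally have "\<bar>real_of_int b\<bar> \<le> of_int q" by simp
      hence "\<bar>b\<bar> \<le> q" by linarith
      thus ?thesis using ad' True q1 unfolding K_def by auto
    qed
    thus "C \<in> (\<lambda>(a, b, c, d). mat2 a b c d) ` ({-K..K} \<times> {-K..K} \<times> {-K..K} \<times> {-K..K})"
      by (intro image_eqI[of _ _ "(a, b, c, d)"]) (auto simp: Ceq abs_le_iff)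
  qed
  thus ?thesis by (rule finite_subset) auto
qed


section \<open>Change of variables and null sets\<close>

text \<open>The change of variables formula is stated for \<open>real ^ 2\<close>; this map and its
  inverse carry Lebesgue measure and integrals over to \<open>complex\<close>.\<close>

definition complex_of_vec :: "real ^ 2 \<Rightarrow> complex" where
  "complex_of_vec v = Complex (v $ 1) (v $ 2)"

definition vec_of_complex :: "complex \<Rightarrow> real ^ 2" where
  "vec_of_complex z = vector [Re z, Im z]"

lemma vec_of_complex_nth [simp]: "vec_of_complex z $ 1 = Re z" "vec_of_complex z $ 2 = Im z"
  by (simp_all add: vec_of_complex_def)

lemma complex_of_vec_inverse [simp]: "vec_of_complex (complex_of_vec v) = v"
  by (simp add: vec_eq_iff forall_2 complex_of_vec_def)

lemma vec_of_complex_inverse [simp]: "complex_of_vec (vec_of_complex z) = z"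
  by (simp add: complex_of_vec_def)

lemma bounded_linear_complex_of_vec: "bounded_linear complex_of_vec"
  by (rule linear_conv_bounded_linear[THEN iffD1])
     (auto intro!: linearI simp: complex_of_vec_def complex_eq_iff)

lemma bounded_linear_vec_of_complex: "bounded_linear vec_of_complex"
  by (rule linear_conv_bounded_linear[THEN iffD1])
     (auto intro!: linearI simp: vec_eq_iff forall_2)

lemma borel_measurable_complex_of_vec [measurable]: "complex_of_vec \<in> borel_measurable borel"
  by (intro borel_measurable_continuous_onI bounded_linear.continuous_on[OF bounded_linear_complex_of_vec] continuous_on_id)

lemma borel_measurable_vec_of_complex [measurable]: "vec_of_complex \<in> borel_measurable borel"
  by (intro borel_measurable_continuous_onI bounded_linear.continuous_on[OF bounded_linear_vec_of_complex] continuous_on_id)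

lemma Basis_real2: "(Basis :: (real ^ 2) set) = {axis 1 1, axis 2 1}"
  unfolding Basis_vec_def by (auto simp: UNIV_2)

lemma lborel_complex_eq: "(lborel :: complex measure) = distr lborel borel complex_of_vec"
proof (rule lborel_eqI)
  fix l u :: complex
  assume le: "\<And>b. b \<in> Basis \<Longrightarrow> l \<bullet> b \<le> u \<bullet> b"
  have le': "Re l \<le> Re u" "Im l \<le> Im u" using le[of 1] le[of \<i>] by (auto simp: Basis_complex_def)
  have ax: "axis 1 (1::real) \<noteq> (axis 2 1 :: real ^ 2)" by (simp add: axis_eq_axis)
  have "emeasure (distr lborel borel complex_of_vec) (box l u) =
      emeasure lborel (complex_of_vec -` box l u)"
    by (subst emeasure_distr) (auto simp: measurable_lborel1)
  also have "complex_of_vec -` box l u = box (vec_of_complex l) (vec_of_complex u)"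
    by (auto simp: box_def Basis_complex_def Basis_real2 complex_of_vec_def inner_axis)
  also have "emeasure lborel \<dots> = ennreal (\<Prod>b\<in>Basis. (vec_of_complex u - vec_of_complex l) \<bullet> b)"
    using le' by (intro emeasure_lborel_box) (auto simp: Basis_real2 inner_axis)
  also have "(\<Prod>b\<in>Basis. (vec_of_complex u - vec_of_complex l) \<bullet> b) = (\<Prod>b\<in>Basis. (u - l) \<bullet> b)"
    using ax by (simp add: Basis_real2 Basis_complex_def inner_axis)
  finally show "emeasure (distr lborel borel complex_of_vec) (box l u) = ennreal (\<Prod>b\<in>Basis. (u - l) \<bullet> b)" .
qed simp

lemma det_complex_multiplication:
  "det (matrix (\<lambda>v. vec_of_complex (c * complex_of_vec v))) = norm c ^ 2"
proof -
  have "complex_of_vec (axis 1 1) = 1" "complex_of_vec (axis 2 1) = \<i>"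
    by (simp_all add: complex_of_vec_def axis_def complex_eq_iff)
  thus ?thesis by (simp add: det_2 matrix_def cmod_power2) (simp add: power2_eq_square)
qed

text \<open>By the Cauchy-Riemann equations the Jacobian determinant of g is
  \<open>norm (g' z) ^ 2\<close>. Measurability of the pulled-back integrand is assumed because the
  formula holds for the completed measure and the result is brought back to
  \<open>lborel\<close>.\<close>

lemma complex_change_of_variables:
  fixes F g g' :: "complex \<Rightarrow> complex" and S :: "complex set"
  assumes S: "S \<in> sets borel"
    and deriv: "\<And>z. z \<in> S \<Longrightarrow> (g has_field_derivative g' z) (at z)"
    and inj: "inj_on g S"
    and meas: "(\<lambda>z. indicator S z *\<^sub>R (norm (g' z) ^ 2 *\<^sub>R F (g z))) \<in> borel_measurable borel"
    and int: "set_integrable lborel (g ` S) F"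
  shows "(LINT z:g ` S|lborel. F z) = (LINT z:S|lborel. norm (g' z) ^ 2 *\<^sub>R F (g z))"
proof -
  interpret C: bounded_linear complex_of_vec by (rule bounded_linear_complex_of_vec)
  interpret V: bounded_linear vec_of_complex by (rule bounded_linear_vec_of_complex)
  have transport: "integrable lborel (\<lambda>v. vec_of_complex (G (complex_of_vec v)))"
    "vec_of_complex (LINT z|lborel. G z) = (LINT v|lborel. vec_of_complex (G (complex_of_vec v)))"
    if "integrable lborel G" for G :: "complex \<Rightarrow> complex"
  proof -
    have m [measurable]: "G \<in> borel_measurable borel" using that by (auto dest: borel_measurable_integrable)
    have "integrable (distr lborel borel complex_of_vec) G"
      using that by (simp flip: lborel_complex_eq)
    hence i: "integrable lborel (\<lambda>v. G (complex_of_vec v))" 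
      by (subst (asm) integrable_distr_eq) auto
    show "integrable lborel (\<lambda>v. vec_of_complex (G (complex_of_vec v)))"
      by (rule integrable_bounded_linear[OF bounded_linear_vec_of_complex i])
    have "(LINT z|lborel. G z) = (LINT v|lborel. G (complex_of_vec v))"
      by (subst lborel_complex_eq, subst integral_distr) auto
    thus "vec_of_complex (LINT z|lborel. G z) = (LINT v|lborel. vec_of_complex (G (complex_of_vec v)))"
      using integral_bounded_linear[OF bounded_linear_vec_of_complex i] by simp
  qed
  define f where "f = (\<lambda>v. vec_of_complex (F (complex_of_vec v)))"
  define h where "h = (\<lambda>v. vec_of_complex (g (complex_of_vec v)))"
  define h' where "h' = (\<lambda>x v. vec_of_complex (g' (complex_of_vec x) * complex_of_vec v))"
  define S' where "S' = vec_of_complex ` S"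
  have S'_iff: "v \<in> S' \<longleftrightarrow> complex_of_vec v \<in> S" for v
    unfolding S'_def by (metis complex_of_vec_inverse vec_of_complex_inverse image_iff)
  have hS'_iff: "v \<in> h ` S' \<longleftrightarrow> complex_of_vec v \<in> g ` S" for v
    unfolding S'_def h_def image_image by (metis (no_types, lifting) complex_of_vec_inverse vec_of_complex_inverse image_iff)
  have "S' = complex_of_vec -` S \<inter> space borel" using S'_iff by auto
  also have "\<dots> \<in> sets borel" using S by (rule measurable_sets[OF borel_measurable_complex_of_vec])
  finally have S'm: "S' \<in> sets lebesgue" by (metis sets_completionI_sets sets_lborel)
  have der: "(h has_derivative h' x) (at x within S')" if "x \<in> S'" for x
  proof -
    have "(g has_derivative (*) (g' (complex_of_vec x))) (at (complex_of_vec x))"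
      using deriv that S'_iff by (auto simp: has_field_derivative_def)
    from has_derivative_compose[OF C.has_derivative[OF has_derivative_ident] this]
    have "((\<lambda>x. g (complex_of_vec x)) has_derivative (\<lambda>v. g' (complex_of_vec x) * complex_of_vec v)) (at x)"
      by (simp add: id_def)
    from V.has_derivative[OF this] show ?thesis
      unfolding h_def h'_def by (rule has_derivative_at_withinI)
  qed
  have injh: "inj_on h S'"
  proof (rule inj_onI)
    fix x y assume "x \<in> S'" "y \<in> S'" "h x = h y"
    hence "g (complex_of_vec x) = g (complex_of_vec y)" unfolding h_def by (metis vec_of_complex_inverse)
    hence "complex_of_vec x = complex_of_vec y" using inj \<open>x \<in> S'\<close> \<open>y \<in> S'\<close> by (auto simp: S'_iff inj_on_def)
    thus "x = y" by (metis complex_of_vec_inverse)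
  qed
  define G1 where "G1 = (\<lambda>z. indicator (g ` S) z *\<^sub>R F z)"
  have G1: "integrable lborel G1" using int by (simp add: set_integrable_def G1_def)
  have G1_eq: "vec_of_complex (G1 (complex_of_vec v)) = indicator (h ` S') v *\<^sub>R f v" for v
    using hS'_iff[of v] by (simp add: G1_def f_def indicator_def V.zero)
  have f_abs: "f absolutely_integrable_on (h ` S')"
    unfolding set_integrable_def using transport(1)[OF G1] by (simp add: G1_eq integrable_completion borel_measurable_integrable)
  have L: "vec_of_complex (LINT z:g ` S|lborel. F z) = integral (h ` S') f"
  proof -
    have "vec_of_complex (LINT z:g ` S|lborel. F z) = (LINT v|lborel. indicator (h ` S') v *\<^sub>R f v)"
      using transport(2)[OF G1] by (simp add: G1_eq set_lebesgue_integral_def flip: G1_def)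
    also have "\<dots> = (LINT v:h ` S'|lebesgue. f v)"
      unfolding set_lebesgue_integral_def using transport(1)[OF G1]
      by (intro integral_completion[symmetric] borel_measurable_integrable) (simp add: G1_eq)
    also have "\<dots> = integral (h ` S') f" by (rule set_lebesgue_integral_eq_integral(2)[OF f_abs])
    finally show ?thesis .
  qed
  define k where "k = (\<lambda>x. \<bar>det (matrix (h' x))\<bar> *\<^sub>R f (h x))"
  have cov: "k absolutely_integrable_on S'" "integral S' k = integral (h ` S') f"
    using has_absolute_integral_change_of_variables[OF S'm der injh, of f "integral (h ` S') f"] f_abs
    unfolding k_def by auto
  define G2 where "G2 = (\<lambda>z. indicator S z *\<^sub>R (norm (g' z) ^ 2 *\<^sub>R F (g z)))"
  have k_eq: "k x = vec_of_complex (norm (g' (complex_of_vec x)) ^ 2 *\<^sub>R F (g (complex_of_vec x)))" for x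
    unfolding k_def h'_def f_def h_def by (simp add: det_complex_multiplication V.scaleR)
  have G2_eq: "vec_of_complex (G2 (complex_of_vec v)) = indicator S' v *\<^sub>R k v" for v
    using S'_iff[of v] by (simp add: G2_def k_eq indicator_def V.zero V.scaleR)
  have G2m [measurable]: "G2 \<in> borel_measurable borel" using meas by (simp add: G2_def)
  have "integrable lebesgue (\<lambda>v. vec_of_complex (G2 (complex_of_vec v)))"
    using cov(1) by (simp add: set_integrable_def G2_eq)
  hence kint: "integrable lborel (\<lambda>v. vec_of_complex (G2 (complex_of_vec v)))"
    by (subst (asm) integrable_completion) auto
  from integrable_bounded_linear[OF bounded_linear_complex_of_vec this] have "integrable (distr lborel borel complex_of_vec) G2"
    by (subst integrable_distr_eq) auto
  hence G2: "integrable lborel G2" by (simp flip: lborel_complex_eq)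
  have "vec_of_complex (LINT z:S|lborel. norm (g' z) ^ 2 *\<^sub>R F (g z)) = (LINT v|lborel. indicator S' v *\<^sub>R k v)"
    using transport(2)[OF G2] unfolding G2_eq unfolding G2_def set_lebesgue_integral_def .
  also have "\<dots> = (LINT v:S'|lebesgue. k v)"
    unfolding set_lebesgue_integral_def using kint
    by (intro integral_completion[symmetric] borel_measurable_integrable) (simp add: G2_eq)
  also have "\<dots> = integral S' k" by (rule set_lebesgue_integral_eq_integral(2)[OF cov(1)])
  finally have "vec_of_complex (LINT z:S|lborel. norm (g' z) ^ 2 *\<^sub>R F (g z)) = vec_of_complex (LINT z:g ` S|lborel. F z)"
    using cov(2) L by simp
  thus ?thesis by (metis vec_of_complex_inverse)
qed

section \<open>The boundary of the fundamental domain as a null set\<close>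

lemma fundamental_domain_closed: "closed fundamental_domain"
proof -
  have "fundamental_domain = {z. Im z \<ge> 1 / 2} \<inter> {z. \<bar>Re z\<bar> \<le> 1 / 2} \<inter> {z. 1 \<le> norm z}"
  proof safe
    fix z :: complex assume "Im z \<ge> 1 / 2" "\<bar>Re z\<bar> \<le> 1 / 2" "1 \<le> norm z"
    thus "z \<in> fundamental_domain" by (simp add: fundamental_domain_def upper_half_plane_def)
  qed (use fundamental_domainD in force)+
  moreover have "closed \<dots>" by (intro closed_Int closed_Collect_le continuous_intros)
  ultimately show ?thesis by simp
qed

lemma fundamental_domain_borel [measurable]: "fundamental_domain \<in> sets borel"
  using fundamental_domain_closed by (rule borel_closed)

lemma fund_interior_subset: "fund_interior \<subseteq> fundamental_domain"
  by (auto simp: fund_interior_def fundamental_domain_def upper_half_plane_def)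

lemma negligible_fundamental_boundary: "negligible (fundamental_domain - fund_interior)"
proof (rule negligible_subset)
  have "negligible {x :: complex. 1 \<bullet> x = 1 / 2}" "negligible {x :: complex. 1 \<bullet> x = - 1 / 2}"
    by (rule negligible_hyperplane, simp)+
  moreover have "negligible (sphere (0 :: complex) 1)" by (rule negligible_sphere)
  ultimately show "negligible ({x :: complex. 1 \<bullet> x = 1 / 2} \<union> {x :: complex. 1 \<bullet> x = - 1 / 2} \<union> sphere 0 1)"
    by (intro negligible_Un)
  show "fundamental_domain - fund_interior \<subseteq> {x :: complex. 1 \<bullet> x = 1 / 2} \<union> {x :: complex. 1 \<bullet> x = - 1 / 2} \<union> sphere 0 1"
    by (auto simp: fund_interior_def fundamental_domain_def upper_half_plane_def)
qed

text \<open>For each of the countably many A the exceptional points lie in the image of the null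
  boundary under the inverse map, which is differentiable. All positive determinants are included,
  since the orbits of Hecke translates are counted as well.\<close>

lemma AE_frac_lin_interior:
  "AE z in lborel. Im z > 0 \<longrightarrow> (\<forall>A. det A > 0 \<longrightarrow> frac_lin A z \<in> fundamental_domain \<longrightarrow> frac_lin A z \<in> fund_interior)"
proof -
  have "AE z in lebesgue. Im z > 0 \<longrightarrow> frac_lin A z \<in> fundamental_domain \<longrightarrow> frac_lin A z \<in> fund_interior"
    if A: "det A > 0" for A
  proof -
    let ?B = "fundamental_domain - fund_interior"
    have "frac_lin (adj2 A) differentiable_on ?B"
      unfolding differentiable_on_def
    proof
      fix z assume "z \<in> ?B"
      hence "Im z > 0" using fundamental_domainD(1) by blast
      hence "(frac_lin (adj2 A) has_derivative (*) (of_int (det (adj2 A)) / auto_factor (adj2 A) z ^ 2)) (at z)"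
        using frac_lin_deriv[of "adj2 A" z] A by (simp add: has_field_derivative_def)
      thus "frac_lin (adj2 A) differentiable at z within ?B"
        by (meson differentiable_at_withinI differentiable_def)
    qed
    hence "negligible (frac_lin (adj2 A) ` ?B)"
      by (intro negligible_differentiable_image_negligible negligible_fundamental_boundary) auto
    hence "frac_lin (adj2 A) ` ?B \<in> null_sets lebesgue" by (simp add: negligible_iff_null_sets)
    moreover have "{z. \<not> (Im z > 0 \<longrightarrow> frac_lin A z \<in> fundamental_domain \<longrightarrow> frac_lin A z \<in> fund_interior)} \<subseteq> frac_lin (adj2 A) ` ?B"
    proof
      fix z assume "z \<in> {z. \<not> (Im z > 0 \<longrightarrow> frac_lin A z \<in> fundamental_domain \<longrightarrow> frac_lin A z \<in> fund_interior)}"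
      thus "z \<in> frac_lin (adj2 A) ` ?B"
        using A frac_lin_adj2(2)[of A z] by (intro image_eqI[of _ _ "frac_lin A z"]) auto
    qed
    ultimately show ?thesis by (intro AE_I') auto
  qed
  hence "\<forall>A. AE z in lebesgue. det A > 0 \<longrightarrow> Im z > 0 \<longrightarrow> frac_lin A z \<in> fundamental_domain \<longrightarrow> frac_lin A z \<in> fund_interior"
    by (metis (mono_tags, lifting) AE_I2 AE_mp)
  hence "AE z in lebesgue. \<forall>A. det A > 0 \<longrightarrow> Im z > 0 \<longrightarrow> frac_lin A z \<in> fundamental_domain \<longrightarrow> frac_lin A z \<in> fund_interior"
    by (subst AE_all_countable)
  hence "AE z in lborel. \<forall>A. det A > 0 \<longrightarrow> Im z > 0 \<longrightarrow> frac_lin A z \<in> fundamental_domain \<longrightarrow> frac_lin A z \<in> fund_interior"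
    by (simp add: AE_completion_iff)
  thus ?thesis by eventually_elim blast
qed

text \<open>Two, and not one, because A and -A act alike. The hypothesis moves every image that lies
  in the domain into its interior, where \<open>fund_interior_unique\<close> applies.\<close>

lemma card_SL2Z_orbit:
  assumes "Im z > 0" "\<And>A. det A > 0 \<Longrightarrow> frac_lin A z \<in> fundamental_domain \<Longrightarrow> frac_lin A z \<in> fund_interior"
  shows "finite {A \<in> SL2Z. frac_lin A z \<in> fundamental_domain}" "card {A \<in> SL2Z. frac_lin A z \<in> fundamental_domain} = 2"
proof -
  obtain A where A: "A \<in> SL2Z" "frac_lin A z \<in> fundamental_domain"
    using fundamental_domain_covers[OF assms(1)] by blast
  have dA: "det A = 1" using A(1) by (simp add: SL2Z_iff)
  have int: "frac_lin A z \<in> fund_interior" using assms(2)[of A] A dA by simp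
  have m1: "det (mat (-1) :: int ^ 2 ^ 2) = 1" by (simp add: det_2)
  have "{A \<in> SL2Z. frac_lin A z \<in> fundamental_domain} = {A, mat (-1) ** A}"
  proof (intro subset_antisym subsetI)
    fix B assume "B \<in> {A \<in> SL2Z. frac_lin A z \<in> fundamental_domain}"
    hence B: "B \<in> SL2Z" "frac_lin B z \<in> fundamental_domain" by auto
    have dB: "det B = 1" using B by (simp add: SL2Z_iff)
    have "B ** adj2 A \<in> SL2Z" using A B by (simp add: SL2Z_mult SL2Z_adj2)
    moreover have "frac_lin (B ** adj2 A) (frac_lin A z) = frac_lin B z"
      using dA dB assms(1) Im_frac_lin_pos[of A z] by (simp add: frac_lin_mult_det frac_lin_adj2)
    ultimately have *: "B ** adj2 A = mat 1 \<or> B ** adj2 A = mat (-1)"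
      using fund_interior_unique[OF int] B by simp
    have "(B ** adj2 A) ** A = B" using SL2Z_adj2_mult(2)[OF A(1)] by (simp add: mat2_mult_assoc)
    thus "B \<in> {A, mat (-1) ** A}" using * by auto
  next
    fix B assume "B \<in> {A, mat (-1) ** A}"
    moreover have "mat (-1) ** A \<in> SL2Z" using A m1 by (simp add: SL2Z_iff det_mult2)
    moreover have "frac_lin (mat (-1) ** A) z = frac_lin A z"
      using dA m1 assms(1) by (subst frac_lin_mult_det(1)) auto
    ultimately show "B \<in> {A \<in> SL2Z. frac_lin A z \<in> fundamental_domain}" using A by auto
  qed
  moreover have "A \<noteq> mat (-1) ** A"
  proof
    assume "A = mat (-1) ** A"
    hence "A $ i $ j = (mat (-1) ** A) $ i $ j" for i j by simp
    from this[of 1 1] this[of 1 2] have "A $ 1 $ 1 = 0" "A $ 1 $ 2 = 0" by auto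
    thus False using dA by (simp add: det_2)
  qed
  ultimately show "finite {A \<in> SL2Z. frac_lin A z \<in> fundamental_domain}"
    "card {A \<in> SL2Z. frac_lin A z \<in> fundamental_domain} = 2" by simp_all
qed


section \<open>Periodic functions and q-expansions\<close>

text \<open>The local parameter at a cusp of width h; for h = 1 it is the usual q.\<close>

definition nome :: "real \<Rightarrow> complex \<Rightarrow> complex" where
  "nome h z = exp (2 * of_real pi * \<i> * z / of_real h)"

lemma norm_nome: "norm (nome h z) = exp (- 2 * pi * Im z / h)"
  by (simp add: nome_def norm_exp_eq_Re flip: of_real_mult of_real_divide)

lemma nome_nonzero [simp]: "nome h z \<noteq> 0"
  by (simp add: nome_def)

lemma norm_nome_less_1: "h > 0 \<Longrightarrow> Im z > 0 \<Longrightarrow> norm (nome h z) < 1"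
  by (simp add: norm_nome)

lemma nome_in_ball: "h > 0 \<Longrightarrow> Im z > 0 \<Longrightarrow> nome h z \<in> ball 0 1 - {0}"
  by (simp add: norm_nome)

lemma nome_eqD:
  assumes "h > 0" "nome h z = nome h w"
  obtains n :: int where "z = w + of_int n * of_real h"
proof -
  obtain n :: int where n: "2 * of_real pi * \<i> * z / of_real h = 2 * of_real pi * \<i> * w / of_real h + (of_int (2 * n) * pi) * \<i>"
    using assms(2) unfolding nome_def exp_eq by blast
  have "2 * of_real pi * \<i> * z = 2 * of_real pi * \<i> * (w + of_int n * of_real h)"
    using n assms(1) by (simp add: field_simps)
  hence "z = w + of_int n * of_real h" by simp
  thus ?thesis using that by blast
qed

lemma nome_surj:
  assumes "h > 0" "w \<noteq> 0" "w = exp u" 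
  shows "nome h (of_real h / (2 * of_real pi * \<i>) * u) = w"
  using assms by (simp add: nome_def)

lemma periodic_int:
  fixes F :: "complex \<Rightarrow> complex" and h :: real
  assumes "\<And>z. Im z > 0 \<Longrightarrow> F (z + of_real h) = F z" "Im z > 0"
  shows "F (z + of_int n * of_real h) = F z"
proof (induction n rule: int_induct[of _ 0])
  case (step1 n)
  have "F (z + of_int n * of_real h + of_real h) = F (z + of_int n * of_real h)"
    by (rule assms(1)) (use assms(2) in simp)
  thus ?case using step1 by (simp add: algebra_simps)
next
  case (step2 n)
  have "F (z + of_int (n - 1) * of_real h + of_real h) = F (z + of_int (n - 1) * of_real h)"
    by (rule assms(1)) (use assms(2) in simp)
  thus ?case using step2 by (simp add: algebra_simps)
qed auto

text \<open>Descent to the punctured disc through two branches of the logarithm, which give the same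
  value by periodicity; boundedness at large height makes 0 a removable singularity.\<close>

lemma periodic_holomorphic_nome:
  fixes F :: "complex \<Rightarrow> complex" and h :: real
  assumes h: "h > 0" and holo: "F holomorphic_on upper_half_plane"
    and per: "\<And>z. Im z > 0 \<Longrightarrow> F (z + of_real h) = F z"
    and bdd: "\<And>z. Im z \<ge> y0 \<Longrightarrow> norm (F z) \<le> K"
  obtains k where "k holomorphic_on ball 0 1" "\<And>z. Im z > 0 \<Longrightarrow> F z = k (nome h z)"
proof -
  define c where "c = of_real h / (2 * of_real pi * \<i>)"
  define L where "L = (\<lambda>w. c * Ln w)"
  \<comment> \<open>This branch is cut along the positive reals, so that the two domains together
    cover the punctured disc.\<close>
  define L2 where "L2 = (\<lambda>w. c * (Ln (- w) + of_real pi * \<i>))"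
  define k0 where "k0 = (\<lambda>w. F (L w))"
  have nL: "nome h (L w) = w" if "w \<noteq> 0" for w
    unfolding L_def c_def using that by (intro nome_surj h) auto
  have nL2: "nome h (L2 w) = w" if "w \<noteq> 0" for w
    unfolding L2_def c_def using that by (intro nome_surj h) (auto simp: exp_add)
  have Im_pos: "Im z > 0" if "norm (nome h z) < 1" for z
    using that h by (simp add: norm_nome zero_less_divide_iff zero_less_mult_iff)
  have F_eq: "F z = F w" if "nome h z = nome h w" "Im w > 0" for z w
  proof -
    from nome_eqD[OF h that(1)] obtain n :: int where "z = w + of_int n * of_real h" .
    thus ?thesis using periodic_int[of F h w n] per that(2) by simp
  qed
  have ImL: "Im (L w) > 0" "Im (L2 w) > 0" if "w \<in> ball 0 1 - {0}" for w
    using that by (auto intro!: Im_pos simp: nL nL2)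
  have k0_nome: "F z = k0 (nome h z)" if "Im z > 0" for z
    unfolding k0_def using that ImL(1)[OF nome_in_ball[OF h that]] by (intro F_eq) (auto simp: nL)
  have k0_alt: "k0 w = F (L2 w)" if "w \<in> ball 0 1 - {0}" for w
    unfolding k0_def using that ImL[OF that] by (intro F_eq) (auto simp: nL nL2)
  let ?A = "ball 0 1 - {0 :: complex} - \<real>\<^sub>\<le>\<^sub>0" and ?B = "ball 0 1 - {0 :: complex} - \<real>\<^sub>\<ge>\<^sub>0"
  have "(F \<circ> L) holomorphic_on ?A"
    unfolding L_def
    by (rule holomorphic_on_compose_gen[OF _ holo], intro holomorphic_intros)
       (use ImL in \<open>auto simp: L_def upper_half_plane_def\<close>)
  hence A: "k0 holomorphic_on ?A" by (simp add: k0_def o_def)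
  have "(F \<circ> L2) holomorphic_on ?B"
    unfolding L2_def
    by (rule holomorphic_on_compose_gen[OF _ holo], intro holomorphic_intros)
       (use ImL in \<open>auto simp: L2_def upper_half_plane_def complex_nonpos_Reals_iff complex_nonneg_Reals_iff\<close>)
  hence B: "k0 holomorphic_on ?B"
    by (rule holomorphic_transform) (auto simp: k0_alt)
  have "k0 holomorphic_on (?A \<union> ?B)"
    using A B by (intro holomorphic_on_Un) (auto intro!: open_Diff closed_nonpos_Reals_complex closed_nonneg_Reals_complex)
  moreover have "x = 0" if "x \<in> \<real>\<^sub>\<le>\<^sub>0" "x \<in> \<real>\<^sub>\<ge>\<^sub>0" for x :: complex
    using that by (simp add: complex_nonpos_Reals_iff complex_nonneg_Reals_iff complex_eq_iff)
  hence "\<real>\<^sub>\<le>\<^sub>0 \<inter> \<real>\<^sub>\<ge>\<^sub>0 \<subseteq> {0 :: complex}" by blast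
  hence "?A \<union> ?B = ball 0 1 - {0}" by blast
  ultimately have holk0: "k0 holomorphic_on (ball 0 1 - {0})" by simp
  define r where "r = min 1 (exp (- 2 * pi * y0 / h))"
  have r: "r > 0" by (simp add: r_def)
  have "norm (k0 w) \<le> K" if "w \<in> ball 0 r - {0}" for w
  proof -
    have "norm (nome h (L w)) < exp (- 2 * pi * y0 / h)" using that by (simp add: nL r_def)
    hence "- 2 * pi * Im (L w) / h < - 2 * pi * y0 / h" by (simp only: norm_nome exp_less_cancel_iff)
    hence "Im (L w) \<ge> y0" using h by (simp add: divide_less_cancel)
    thus ?thesis unfolding k0_def by (rule bdd)
  qed
  hence "eventually (\<lambda>w. norm (k0 w) \<le> K * norm (1 :: complex)) (at 0)"
    unfolding eventually_at using r by (intro exI[of _ r]) (auto simp: dist_norm)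
  hence "k0 \<in> O[at 0](\<lambda>_. 1)" by (rule bigoI)
  hence "\<exists>g. g holomorphic_on ball 0 1 \<and> (\<forall>z\<in>ball 0 1 - {0}. g z = k0 z)"
    using holk0 by (intro removable_singularities) auto
  then obtain g where g: "g holomorphic_on ball 0 1" "\<And>w. w \<in> ball 0 1 - {0} \<Longrightarrow> g w = k0 w" by blast
  show ?thesis
    by (rule that[of g]) (use g k0_nome nome_in_ball[OF h] in \<open>auto simp del: norm_nome\<close>)
qed

lemma nome_tendsto_0:
  assumes "h > 0"
  shows "filterlim (nome h) (at 0) (filtercomap Im at_top)"
proof -
  have "filterlim (\<lambda>y. exp (- 2 * pi * y / h)) (nhds 0) at_top"
    using assms by real_asymp
  hence "filterlim (\<lambda>z. exp (- 2 * pi * Im z / h)) (nhds 0) (filtercomap Im at_top)"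
    by (rule filterlim_filtercomapI)
  hence "((\<lambda>z. norm (nome h z)) \<longlongrightarrow> 0) (filtercomap Im at_top)" by (simp add: norm_nome)
  thus ?thesis by (auto simp: filterlim_at tendsto_norm_zero_iff)
qed

lemma filtercomap_Im_not_bot: "filtercomap Im at_top \<noteq> bot"
  by (rule filtercomap_neq_bot_surj) (auto intro!: surjI[of _ "\<lambda>y. Complex 0 y"])

lemma nome_limit:
  assumes "h > 0" "k holomorphic_on ball 0 1" "\<And>z. Im z > 0 \<Longrightarrow> F z = k (nome h z)"
  shows "(F \<longlongrightarrow> k 0) (filtercomap Im at_top)"
proof -
  have "k \<midarrow>0\<rightarrow> k 0"
    using holomorphic_on_imp_continuous_on[OF assms(2)]
    by (metis centre_in_ball continuous_on_eq_continuous_at isContD open_ball zero_less_one)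
  hence "((\<lambda>z. k (nome h z)) \<longlongrightarrow> k 0) (filtercomap Im at_top)"
    using nome_tendsto_0[OF assms(1)] by (rule filterlim_compose)
  moreover have "eventually (\<lambda>z. k (nome h z) = F z) (filtercomap Im at_top)"
    unfolding eventually_filtercomap_at_top_linorder using assms(3) by (intro exI[of _ 1]) auto
  ultimately show ?thesis by (rule Lim_transform_eventually)
qed

text \<open>As a function of the nome, F vanishes at 0, so it is the nome times a function that is
  bounded on a smaller closed disc. One constant therefore serves for the whole half plane
  \<open>Im z \<ge> y1\<close>.\<close>

lemma periodic_decay:
  fixes F :: "complex \<Rightarrow> complex" and h :: real
  assumes h: "h > 0" and holo: "F holomorphic_on upper_half_plane"
    and per: "\<And>z. Im z > 0 \<Longrightarrow> F (z + of_real h) = F z"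
    and lim: "(F \<longlongrightarrow> 0) (filtercomap Im at_top)" and y1: "y1 > 0"
  obtains C where "C \<ge> 0" "\<And>z. Im z \<ge> y1 \<Longrightarrow> norm (F z) \<le> C * exp (- 2 * pi * Im z / h)"
proof -
  have "eventually (\<lambda>z. norm (F z) < 1) (filtercomap Im at_top)"
    using tendstoD[OF lim, of 1] by (simp add: dist_norm)
  then obtain y0 where y0: "\<And>z. Im z \<ge> y0 \<Longrightarrow> norm (F z) < 1"
    unfolding eventually_filtercomap_at_top_linorder by blast
  obtain k where k: "k holomorphic_on ball 0 1" "\<And>z. Im z > 0 \<Longrightarrow> F z = k (nome h z)"
    using periodic_holomorphic_nome[OF h holo per, of y0 1] y0 less_imp_le by (smt (verit, best))
  have k0: "k 0 = 0"
    using tendsto_unique[OF filtercomap_Im_not_bot nome_limit[OF h k] lim] .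
  define k1 where "k1 = (\<lambda>z. if z = 0 then deriv k 0 else (k z - k 0) / (z - 0))"
  have k1: "k1 holomorphic_on ball 0 1"
    unfolding k1_def using k(1) by (rule pole_lemma) auto
  define r where "r = exp (- 2 * pi * y1 / h)"
  have r: "r < 1" "r > 0" using y1 h by (auto simp: r_def)
  have "compact (k1 ` cball 0 r)"
    using r by (intro compact_continuous_image continuous_on_subset[OF holomorphic_on_imp_continuous_on[OF k1]]) auto
  then obtain C where C: "\<And>w. w \<in> cball 0 r \<Longrightarrow> norm (k1 w) \<le> C"
    using compact_imp_bounded bounded_iff by (metis imageI)
  have C0: "C \<ge> 0" using C[of 0] r norm_ge_zero order_trans by (metis centre_in_cball less_imp_le)
  show ?thesis
  proof (rule that[OF C0])
    fix z assume z: "Im z \<ge> y1"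
    have nz: "nome h z \<in> cball 0 r"
      using z h by (simp add: norm_nome r_def divide_right_mono)
    have "F z = nome h z * k1 (nome h z)" using k(2)[of z] z y1 by (simp add: k1_def k0)
    also have "norm \<dots> \<le> exp (- 2 * pi * Im z / h) * C"
      unfolding norm_mult norm_nome using C[OF nz] by (intro mult_left_mono) auto
    finally show "norm (F z) \<le> C * exp (- 2 * pi * Im z / h)" by (simp add: mult.commute)
  qed
qed

text \<open>The point 0 is left out of the hypothesis because no nome equals 0. After removal of the
  earlier terms and division by w^n the series has the value \<open>c n\<close> at 0 and 0
  elsewhere, so continuity gives the claim.\<close>

lemma powser_coeffs_eq_0:
  fixes c :: "nat \<Rightarrow> complex"
  assumes "\<And>w. w \<noteq> 0 \<Longrightarrow> norm w < 1 \<Longrightarrow> (\<lambda>n. c n * w ^ n) sums 0"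
  shows "c n = 0"
proof (induction n rule: less_induct)
  case (less n)
  have sums: "(\<lambda>m. c (m + n) * w ^ m) sums (if w = 0 then c n else 0)" if "norm w < 1" for w
  proof (cases "w = 0")
    case True
    thus ?thesis using powser_sums_zero[of "\<lambda>m. c (m + n)"] by simp
  next
    case False
    have "(\<lambda>m. c (m + n) * w ^ (m + n)) sums (0 - (\<Sum>i<n. c i * w ^ i))"
      using assms[OF False that] by (rule sums_split_initial_segment)
    hence "(\<lambda>m. c (m + n) * w ^ (m + n)) sums 0" using less by simp
    from sums_mult[OF this, of "inverse (w ^ n)"] show ?thesis using False
      by (simp add: power_add field_simps)
  qed
  define f :: "complex \<Rightarrow> complex" where "f = (\<lambda>w. if w = 0 then c n else 0)"
  have "f holomorphic_on ball 0 1"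
    by (rule power_series_holomorphic[of 0 1 "\<lambda>m. c (m + n)"]) (use sums in \<open>simp add: f_def\<close>)
  hence "continuous_on (ball 0 1) f" by (rule holomorphic_on_imp_continuous_on)
  hence "f \<midarrow>0\<rightarrow> f 0" by (metis centre_in_ball continuous_on_eq_continuous_at isContD open_ball zero_less_one)
  moreover have "f \<midarrow>0\<rightarrow> 0"
    by (rule Lim_transform_eventually[OF tendsto_const]) (simp add: f_def eventually_at_filter)
  ultimately show ?case using LIM_unique by (fastforce simp: f_def)
qed

lemma q_expansion_iff:
  "q_expansion f a \<longleftrightarrow> (\<forall>z. Im z > 0 \<longrightarrow> (\<lambda>n. a n * nome 1 z ^ n) sums f z)"
  by (simp add: q_expansion_def upper_half_plane_def nome_def)

lemma nome_1_surj:
  assumes "w \<noteq> 0" "norm w < 1"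
  obtains z where "Im z > 0" "nome 1 z = w"
proof -
  define z where "z = of_real 1 / (2 * of_real pi * \<i>) * Ln w"
  have *: "nome 1 z = w" unfolding z_def using assms(1) by (intro nome_surj) auto
  hence "exp (- 2 * pi * Im z / 1) < 1" using assms(2) norm_nome[of 1 z] by simp
  hence "Im z > 0" by (simp add: zero_less_mult_iff)
  thus ?thesis using * that by blast
qed

lemma q_expansion_unique:
  assumes "q_expansion f a" "q_expansion f b"
  shows "a = b"
proof
  fix n
  have "a n - b n = 0"
  proof (rule powser_coeffs_eq_0)
    fix w :: complex assume "w \<noteq> 0" "norm w < 1"
    then obtain z where z: "Im z > 0" "nome 1 z = w" by (rule nome_1_surj)
    have "(\<lambda>n. a n * w ^ n) sums f z" "(\<lambda>n. b n * w ^ n) sums f z"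
      using assms z by (auto simp: q_expansion_iff)
    from sums_diff[OF this] show "(\<lambda>n. (a n - b n) * w ^ n) sums 0"
      by (simp add: algebra_simps)
  qed
  thus "a n = b n" by simp
qed

lemma q_expansion_nome:
  assumes "q_expansion f a"
  obtains k where "k holomorphic_on ball 0 1" "\<And>w. norm w < 1 \<Longrightarrow> (\<lambda>n. a n * w ^ n) sums k w"
    "\<And>z. Im z > 0 \<Longrightarrow> f z = k (nome 1 z)"
proof -
  define k where "k = (\<lambda>w. \<Sum>n. a n * w ^ n)"
  have sums: "(\<lambda>n. a n * w ^ n) sums k w" if "norm w < 1" for w
  proof (cases "w = 0")
    case True
    thus ?thesis using powser_sums_zero[of a] by (metis k_def sums_iff)
  next
    case False
    with that obtain z where "Im z > 0" "nome 1 z = w" using nome_1_surj by blast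
    thus ?thesis using assms unfolding k_def q_expansion_iff by (metis sums_iff)
  qed
  show ?thesis
  proof (rule that[OF _ sums])
    show "k holomorphic_on ball 0 1"
      by (rule power_series_holomorphic[of 0 1 a]) (use sums in simp)
    show "f z = k (nome 1 z)" if "Im z > 0" for z
      using assms that sums[OF norm_nome_less_1[of 1 z]] sums_unique2 by (auto simp: q_expansion_iff)
  qed auto
qed

lemma q_expansion_0_eq_limit:
  assumes "q_expansion f a" "(f \<longlongrightarrow> l) (filtercomap Im at_top)"
  shows "a 0 = l"
proof -
  obtain k where k: "k holomorphic_on ball 0 1" "\<And>w. norm w < 1 \<Longrightarrow> (\<lambda>n. a n * w ^ n) sums k w"
    "\<And>z. Im z > 0 \<Longrightarrow> f z = k (nome 1 z)" using q_expansion_nome[OF assms(1)] by blast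
  have "(f \<longlongrightarrow> k 0) (filtercomap Im at_top)" using nome_limit[OF _ k(1,3)] by simp
  hence "k 0 = l" using assms(2) tendsto_unique filtercomap_Im_not_bot by blast
  moreover have "k 0 = a 0" using k(2)[of 0] powser_sums_zero[of a] sums_unique2 by auto
  ultimately show ?thesis by simp
qed


section \<open>Cosets and cusp forms\<close>

definition gamma_coset :: "nat \<Rightarrow> int ^ 2 ^ 2 \<Rightarrow> (int ^ 2 ^ 2) set" where
  "gamma_coset N A = (\<lambda>B. B ** A) ` Gamma0 N"

text \<open>The representatives that the choice operator selects inside \<open>petersson\<close>,
  which makes \<open>petersson_altdef\<close> a mere reindexing.\<close>

definition coset_reps :: "nat \<Rightarrow> (int ^ 2 ^ 2) set" where
  "coset_reps N = (\<lambda>C. SOME A. A \<in> C) ` gamma_coset N ` SL2Z"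

lemma gamma_coset_mult:
  assumes "G \<in> Gamma0 N"
  shows "gamma_coset N (G ** A) = gamma_coset N A"
proof (intro subset_antisym subsetI)
  fix X assume "X \<in> gamma_coset N (G ** A)"
  then obtain B where "B \<in> Gamma0 N" "X = (B ** G) ** A" by (auto simp: gamma_coset_def mat2_mult_assoc)
  thus "X \<in> gamma_coset N A" using assms unfolding gamma_coset_def by (blast intro: Gamma0_mult)
next
  fix X assume "X \<in> gamma_coset N A"
  then obtain B where B: "B \<in> Gamma0 N" "X = B ** A" by (auto simp: gamma_coset_def)
  have "X = (B ** adj2 G) ** (G ** A)"
    using SL2Z_adj2_mult(4)[OF Gamma0_subset[OF assms], of A] B(2) by (simp add: mat2_mult_assoc)
  thus "X \<in> gamma_coset N (G ** A)" 
    using assms B unfolding gamma_coset_def by (blast intro: Gamma0_mult Gamma0_adj2)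
qed

lemma gamma_coset_self: "A \<in> gamma_coset N A"
  unfolding gamma_coset_def by (rule image_eqI[of _ _ "mat 1"]) auto

lemma gamma_coset_eq_iff:
  assumes "A \<in> SL2Z" "B \<in> SL2Z"
  shows "gamma_coset N A = gamma_coset N B \<longleftrightarrow> A ** adj2 B \<in> Gamma0 N"
proof
  assume "gamma_coset N A = gamma_coset N B"
  hence "A \<in> gamma_coset N B" using gamma_coset_self by blast
  then obtain G where G: "G \<in> Gamma0 N" "A = G ** B" by (auto simp: gamma_coset_def)
  thus "A ** adj2 B \<in> Gamma0 N" using SL2Z_adj2_mult(1)[OF assms(2)] by (simp add: mat2_mult_assoc)
next
  assume "A ** adj2 B \<in> Gamma0 N"
  from gamma_coset_mult[OF this, of B] show "gamma_coset N A = gamma_coset N B"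
    using SL2Z_adj2_mult(2)[OF assms(2)] by (simp add: mat2_mult_assoc)
qed

lemma some_in_gamma_coset: "(SOME X. X \<in> gamma_coset N A) \<in> gamma_coset N A"
  using gamma_coset_self by (rule someI)

lemma gamma_coset_memD: "X \<in> gamma_coset N A \<Longrightarrow> \<exists>G\<in>Gamma0 N. X = G ** A"
  by (auto simp: gamma_coset_def)

lemma gamma_coset_some:
  "gamma_coset N (SOME X. X \<in> gamma_coset N A) = gamma_coset N A"
  using gamma_coset_memD[OF some_in_gamma_coset[of N A]] gamma_coset_mult by metis

lemma coset_reps_SL2Z:
  assumes "R \<in> coset_reps N"
  shows "R \<in> SL2Z"
proof -
  obtain A where "A \<in> SL2Z" "R = (SOME X. X \<in> gamma_coset N A)"
    using assms by (auto simp: coset_reps_def)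
  thus ?thesis using gamma_coset_memD[OF some_in_gamma_coset[of N A]] Gamma0_subset SL2Z_mult by metis
qed

lemma coset_reps_det: "R \<in> coset_reps N \<Longrightarrow> det R = 1"
  using coset_reps_SL2Z by (simp add: SL2Z_iff)

lemma coset_reps_cover:
  assumes "A \<in> SL2Z"
  obtains G R where "G \<in> Gamma0 N" "R \<in> coset_reps N" "A = G ** R"
proof -
  define R where "R = (SOME X. X \<in> gamma_coset N A)"
  have R: "R \<in> coset_reps N" using assms by (auto simp: R_def coset_reps_def)
  have "gamma_coset N A = gamma_coset N R" by (simp add: R_def gamma_coset_some)
  hence "A ** adj2 R \<in> Gamma0 N" using gamma_coset_eq_iff[OF assms coset_reps_SL2Z[OF R]] by simp
  moreover have "A = (A ** adj2 R) ** R"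
    using SL2Z_adj2_mult(2)[OF coset_reps_SL2Z[OF R]] by (simp add: mat2_mult_assoc)
  ultimately show ?thesis using R that by blast
qed

lemma coset_reps_unique:
  assumes "R \<in> coset_reps N" "R' \<in> coset_reps N" "R ** adj2 R' \<in> Gamma0 N"
  shows "R = R'"
proof -
  have "gamma_coset N R = gamma_coset N R'"
    using assms coset_reps_SL2Z gamma_coset_eq_iff by blast
  moreover obtain A A' where "R = (SOME X. X \<in> gamma_coset N A)" "R' = (SOME X. X \<in> gamma_coset N A')"
    using assms by (auto simp: coset_reps_def)
  ultimately show ?thesis using gamma_coset_some by metis
qed

text \<open>The coset of A depends only on its lower row modulo N: the lower left entry of
  \<open>A ** adj2 B\<close> is the determinant formed from the two lower rows.\<close>

lemma finite_coset_reps: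
  assumes "N > 0"
  shows "finite (coset_reps N)"
proof -
  define P where "P = (\<lambda>A u v. A \<in> SL2Z \<and> A $ 2 $ 1 mod int N = u \<and> A $ 2 $ 2 mod int N = v)"
  define F where "F = (\<lambda>(u, v). gamma_coset N (SOME A. P A u v))"
  have "gamma_coset N ` SL2Z \<subseteq> F ` ({0..<int N} \<times> {0..<int N})"
  proof safe
    fix A :: "int ^ 2 ^ 2" assume A: "A \<in> SL2Z"
    define u v where "u = A $ 2 $ 1 mod int N" and "v = A $ 2 $ 2 mod int N"
    define B where "B = (SOME A. P A u v)"
    have "P A u v" using A by (simp add: P_def u_def v_def)
    hence "P B u v" unfolding B_def by (rule someI)
    hence B: "B \<in> SL2Z" "B $ 2 $ 1 mod int N = A $ 2 $ 1 mod int N" "B $ 2 $ 2 mod int N = A $ 2 $ 2 mod int N"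
      by (auto simp: P_def u_def v_def)
    have "int N dvd (A ** adj2 B) $ 2 $ 1"
    proof -
      have "[A $ 2 $ 1 * B $ 2 $ 2 = B $ 2 $ 1 * A $ 2 $ 2] (mod int N)"
        using B by (intro cong_mult) (auto simp: cong_def)
      hence "int N dvd A $ 2 $ 1 * B $ 2 $ 2 - B $ 2 $ 1 * A $ 2 $ 2" by (simp add: cong_iff_dvd_diff)
      thus ?thesis by (simp add: algebra_simps)
    qed
    hence "A ** adj2 B \<in> Gamma0 N" using A B by (simp add: Gamma0_def SL2Z_mult SL2Z_adj2)
    hence "gamma_coset N A = F (u, v)" using gamma_coset_eq_iff[OF A B(1)] by (simp add: F_def B_def)
    moreover have "u \<in> {0..<int N}" "v \<in> {0..<int N}" using assms by (auto simp: u_def v_def)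
    ultimately show "gamma_coset N A \<in> F ` ({0..<int N} \<times> {0..<int N})" by blast
  qed
  hence "finite (gamma_coset N ` SL2Z)" by (rule finite_subset) auto
  thus ?thesis by (simp add: coset_reps_def)
qed

lemma petersson_altdef:
  "petersson N f g = (\<Sum>R\<in>coset_reps N. LINT z:fundamental_domain|lborel. slash f R z * cnj (slash g R z))"
proof -
  have "inj_on (\<lambda>C. SOME A. A \<in> C) (gamma_coset N ` SL2Z)"
    by (rule inj_on_inverseI[of _ "gamma_coset N"]) (use gamma_coset_some in blast)
  moreover have "(\<lambda>A. (\<lambda>B. B ** A) ` Gamma0 N) ` SL2Z = gamma_coset N ` SL2Z"
    by (simp add: gamma_coset_def)
  ultimately show ?thesis
    unfolding petersson_def coset_reps_def by (simp add: sum.reindex)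
qed

section \<open>Slashed cusp forms: periodicity, decay, boundedness\<close>

lemma cusp_forms_holomorphic: "f \<in> cusp_forms N \<Longrightarrow> f holomorphic_on upper_half_plane"
  by (simp add: cusp_forms_def)

lemma cusp_forms_slash_lim: "f \<in> cusp_forms N \<Longrightarrow> A \<in> SL2Z \<Longrightarrow> (slash f A \<longlongrightarrow> 0) (filtercomap Im at_top)"
  by (simp add: cusp_forms_def)

lemma cusp_forms_slash_Gamma0:
  "f \<in> cusp_forms N \<Longrightarrow> G \<in> Gamma0 N \<Longrightarrow> Im z > 0 \<Longrightarrow> slash f G z = f z"
  by (simp add: cusp_forms_def upper_half_plane_def)

lemma cusp_forms_slash_mult:
  assumes "f \<in> cusp_forms N" "G \<in> Gamma0 N" "det A > 0" "Im z > 0"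
  shows "slash f (G ** A) z = slash f A z"
proof -
  have "det G > 0" using assms(2) Gamma0_subset by (fastforce simp: SL2Z_iff)
  hence "slash f (G ** A) z = slash (slash f G) A z" using assms by (intro slash_mult)
  also have "\<dots> = slash f A z" using assms by (intro slash_cong) (auto simp: cusp_forms_slash_Gamma0)
  finally show ?thesis .
qed

lemma slash_translation: "slash f (mat2 1 b 0 1) z = f (z + of_int b)"
  by (simp add: slash_altdef frac_lin_translation auto_factor_translation)

text \<open>The conjugate of the translation by N under A has lower left entry -N c^2, so it lies in
  \<open>Gamma0 N\<close>. The width N thus serves at all cusps at once.\<close>

lemma cusp_forms_slash_periodic:
  assumes "f \<in> cusp_forms N" "A \<in> SL2Z" "Im z > 0"
  shows "slash f A (z + of_nat N) = slash f A z"
proof -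
  define T where "T = mat2 1 (int N) 0 1"
  define G where "G = A ** T ** adj2 A"
  have dA: "det A = 1" using assms(2) by (simp add: SL2Z_iff)
  have T: "T \<in> SL2Z" by (simp add: T_def SL2Z_iff)
  have "G \<in> SL2Z" unfolding G_def using assms(2) T by (intro SL2Z_mult SL2Z_adj2)
  moreover have "G $ 2 $ 1 = - int N * (A $ 2 $ 1)\<^sup>2"
    by (simp add: G_def T_def power2_eq_square algebra_simps)
  ultimately have G: "G \<in> Gamma0 N" by (simp add: Gamma0_def)
  have "A ** T = G ** A"
    unfolding G_def using SL2Z_adj2_mult(2)[OF assms(2)] by (simp add: mat2_mult_assoc)
  hence "slash f (A ** T) z = slash f A z" using cusp_forms_slash_mult[OF assms(1) G _ assms(3), of A] dA by simp
  moreover have "slash f (A ** T) z = slash (slash f A) T z"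
    using dA assms(3) by (intro slash_mult) (auto simp: T_def)
  ultimately show ?thesis by (simp add: T_def slash_translation)
qed

lemma cusp_forms_slash_holomorphic:
  "f \<in> cusp_forms N \<Longrightarrow> A \<in> SL2Z \<Longrightarrow> slash f A holomorphic_on upper_half_plane"
  by (intro slash_holomorphic cusp_forms_holomorphic) (auto simp: SL2Z_iff)

lemma cusp_forms_slash_decay:
  assumes "f \<in> cusp_forms N" "A \<in> SL2Z" "N > 0" "y > 0"
  obtains C where "C \<ge> 0" "\<And>z. Im z \<ge> y \<Longrightarrow> norm (slash f A z) \<le> C * exp (- (2 * pi / N) * Im z)"
proof -
  have "slash f A (z + of_real (real N)) = slash f A z" if "Im z > 0" for z
    using cusp_forms_slash_periodic[OF assms(1,2) that] by simp
  then obtain C where "C \<ge> 0" "\<And>z. Im z \<ge> y \<Longrightarrow> norm (slash f A z) \<le> C * exp (- 2 * pi * Im z / N)"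
    using periodic_decay[of "real N" "slash f A" y] cusp_forms_slash_holomorphic[OF assms(1,2)]
      cusp_forms_slash_lim[OF assms(1,2)] assms(3,4) by auto
  thus ?thesis using that by (simp add: mult_ac)
qed

text \<open>In weight 2 the quantity |f(z)| Im z is the natural invariant; a matrix of determinant q
  rescales it by 1/q.\<close>

lemma norm_slash_Im:
  assumes "det A > 0" "Im z > 0"
  shows "norm (slash f A z) * Im z = norm (f (frac_lin A z)) * Im (frac_lin A z) / of_int (det A)"
  using assms auto_factor_nonzero[OF assms]
  by (simp add: slash_altdef Im_frac_lin norm_divide norm_power)

lemma y_exp_bounded:
  fixes k :: real
  assumes "k > 0"
  shows "y * exp (- k * y) \<le> 1 / k"
proof -
  have "k * y \<le> exp (k * y)" using exp_ge_add_one_self[of "k * y"] by linarith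
  hence "k * y * exp (- (k * y)) \<le> exp (k * y) * exp (- (k * y))" by (intro mult_right_mono) auto
  also have "\<dots> = 1" by (simp flip: exp_add)
  finally show ?thesis using assms by (simp add: field_simps)
qed

text \<open>Moving z into the fundamental domain changes A only to one of finitely many
  representatives, and there exponential decay beats the factor \<open>Im z\<close>. The bound is
  uniform in A and in z, also near the real axis.\<close>

lemma cusp_forms_slash_Im_bounded:
  assumes "f \<in> cusp_forms N" "N > 0"
  obtains K where "K > 0" "\<And>A z. A \<in> SL2Z \<Longrightarrow> Im z > 0 \<Longrightarrow> norm (slash f A z) * Im z \<le> K"
proof -
  have "\<exists>C\<ge>0. \<forall>z. Im z \<ge> 1 / 2 \<longrightarrow> norm (slash f R z) \<le> C * exp (- (2 * pi / N) * Im z)" if "R \<in> coset_reps N" for R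
    using cusp_forms_slash_decay[OF assms(1) coset_reps_SL2Z[OF that] assms(2), of "1 / 2"] by (metis half_gt_zero_iff zero_less_one)
  then obtain C where C: "\<And>R. R \<in> coset_reps N \<Longrightarrow> C R \<ge> 0"
    "\<And>R z. R \<in> coset_reps N \<Longrightarrow> Im z \<ge> 1 / 2 \<Longrightarrow> norm (slash f R z) \<le> C R * exp (- (2 * pi / N) * Im z)"
    by metis
  define K where "K = (\<Sum>R\<in>coset_reps N. C R) * (N / (2 * pi)) + 1"
  have "K > 0" unfolding K_def using C(1) assms(2) by (intro add_nonneg_pos mult_nonneg_nonneg sum_nonneg) auto
  moreover have "norm (slash f A z) * Im z \<le> K" if A: "A \<in> SL2Z" and z: "Im z > 0" for A z
  proof -
    obtain B where B: "B \<in> SL2Z" "frac_lin B z \<in> fundamental_domain"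
      using fundamental_domain_covers[OF z] .
    define w where "w = frac_lin B z"
    note w = fundamental_domainD[OF B(2), folded w_def]
    have dets: "det A = 1" "det B = 1" using A B by (auto simp: SL2Z_iff)
    have "A ** adj2 B \<in> SL2Z" using A B by (simp add: SL2Z_mult SL2Z_adj2)
    then obtain G R where GR: "G \<in> Gamma0 N" "R \<in> coset_reps N" "A ** adj2 B = G ** R"
      using coset_reps_cover by blast
    have dR: "det R = 1" using GR coset_reps_det by blast
    have "A = (G ** R) ** B" using SL2Z_adj2_mult(2)[OF B(1)] by (simp add: mat2_mult_assoc flip: GR(3))
    hence "A = G ** (R ** B)" by (simp add: mat2_mult_assoc)
    hence "slash f A z = slash f (R ** B) z"
      using cusp_forms_slash_mult[OF assms(1) GR(1), of "R ** B" z] z dR dets by (simp add: det_mult2)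
    also have "\<dots> = slash (slash f R) B z" using z dR dets by (intro slash_mult) auto
    finally have "norm (slash f A z) * Im z = norm (slash f R w) * Im w"
      using norm_slash_Im[of B z "slash f R"] dets z by (simp add: w_def)
    also have "\<dots> \<le> C R * exp (- (2 * pi / N) * Im w) * Im w"
      using C(2)[OF GR(2), of w] w by (intro mult_right_mono) auto
    also have "\<dots> = C R * (Im w * exp (- (2 * pi / N) * Im w))" by simp
    also have "\<dots> \<le> C R * (1 / (2 * pi / N))"
      using C(1)[OF GR(2)] assms(2) by (intro mult_left_mono y_exp_bounded) auto
    also have "\<dots> = C R * (N / (2 * pi))" by simp
    also have "\<dots> \<le> (\<Sum>R\<in>coset_reps N. C R) * (N / (2 * pi))"
      using C(1) GR(2) finite_coset_reps[OF assms(2)] by (intro mult_right_mono member_le_sum) auto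
    finally show ?thesis by (simp add: K_def)
  qed
  ultimately show ?thesis using that by blast
qed

text \<open>Unit squares stacked upwards cover the domain, so the integral is dominated by a
  geometric series in \<open>exp (- k)\<close>.\<close>

lemma set_integrable_exp_fundamental_domain:
  fixes k :: real
  assumes "k > 0"
  shows "set_integrable lborel fundamental_domain (\<lambda>z. exp (- k * Im z))"
  unfolding set_integrable_def
proof (rule integrableI_bounded)
  define box where "box = (\<lambda>n :: nat. cbox (Complex (-1/2) (real n)) (Complex (1/2) (real n + 1)))"
  show "(\<lambda>z. indicat_real fundamental_domain z *\<^sub>R exp (- k * Im z)) \<in> borel_measurable lborel"
    by measurable
  have box: "emeasure lborel (box n) = 1" for n
    unfolding box_def by (subst emeasure_lborel_cbox) (auto simp: Basis_complex_def)
  have "(\<integral>\<^sup>+ z. ennreal (norm (indicat_real fundamental_domain z *\<^sub>R exp (- k * Im z))) \<partial>lborel) \<le>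
      (\<integral>\<^sup>+ z. (\<Sum>n. ennreal (exp (- k) ^ n) * indicator (box n) z) \<partial>lborel)"
  proof (rule nn_integral_mono)
    fix z :: complex
    show "ennreal (norm (indicat_real fundamental_domain z *\<^sub>R exp (- k * Im z))) \<le> (\<Sum>n. ennreal (exp (- k) ^ n) * indicator (box n) z)"
    proof (cases "z \<in> fundamental_domain")
      case True
      note z = fundamental_domainD[OF this]
      define n where "n = nat \<lfloor>Im z\<rfloor>"
      have n: "real n \<le> Im z" "Im z \<le> real n + 1" using z unfolding n_def by linarith+
      have zb: "z \<in> box n" using n z by (auto simp: box_def in_cbox_complex_iff)
      have "exp (- k * Im z) \<le> exp (- k * n)" using n assms by simp
      also have "exp (- k * n) = exp (- k) ^ n" by (simp add: exp_of_nat_mult[symmetric] mult.commute)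
      finally have "ennreal (exp (- k * Im z)) \<le> ennreal (exp (- k) ^ n) * indicator (box n) z"
        using zb by (simp add: ennreal_leI)
      also have "\<dots> \<le> (\<Sum>n. ennreal (exp (- k) ^ n) * indicator (box n) z)"
        using sum_le_suminf[of "\<lambda>n. ennreal (exp (- k) ^ n) * indicator (box n) z" "{n}"]
        by (simp del: sum_mult_indicator)
      finally show ?thesis using True by simp
    qed auto
  qed
  also have "\<dots> = (\<Sum>n. \<integral>\<^sup>+ z. ennreal (exp (- k) ^ n) * indicator (box n) z \<partial>lborel)"
    by (rule nn_integral_suminf) (simp add: box_def)
  also have "\<dots> = (\<Sum>n. ennreal (exp (- k) ^ n))"
    by (subst nn_integral_cmult_indicator) (auto simp: box, simp add: box_def)
  also have "\<dots> = ennreal (\<Sum>n. exp (- k) ^ n)"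
    using assms by (intro suminf_ennreal2) (auto intro!: summable_geometric)
  also have "\<dots> < \<infinity>" by simp
  finally show "(\<integral>\<^sup>+ z. ennreal (norm (indicat_real fundamental_domain z *\<^sub>R exp (- k * Im z))) \<partial>lborel) < \<infinity>" .
qed

lemma fundamental_domain_subset: "fundamental_domain \<subseteq> upper_half_plane"
  by (auto simp: fundamental_domain_def)


section \<open>The Petersson product\<close>

lemma set_integrable_exp_bound:
  fixes H :: "complex \<Rightarrow> complex" and k :: real
  assumes "k > 0" "S \<in> sets borel" "S \<subseteq> fundamental_domain" "H holomorphic_on upper_half_plane \<or> continuous_on upper_half_plane H"
    and bound: "\<And>z. z \<in> S \<Longrightarrow> norm (H z) \<le> C * exp (- k * Im z)"
  shows "set_integrable lborel S H"
proof -
  have "set_integrable lborel fundamental_domain (\<lambda>z. C * exp (- k * Im z))"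
    using set_integrable_exp_fundamental_domain[OF assms(1)] by (intro set_integrable_mult_right) auto
  hence 1: "set_integrable lborel S (\<lambda>z. C * exp (- k * Im z))"
    by (rule set_integrable_subset) (use assms in auto)
  have "continuous_on S H" using assms(3,4) fundamental_domain_subset
    by (meson continuous_on_subset holomorphic_on_imp_continuous_on subset_trans)
  hence "set_borel_measurable lborel S H"
    unfolding set_borel_measurable_def using assms(2) by (simp add: borel_measurable_continuous_on_indicator)
  from set_integrable_bound[OF 1 this] show ?thesis
    using bound by (fastforce intro!: AE_I2)
qed

lemma continuous_on_slash_product:
  assumes "f holomorphic_on upper_half_plane" "g holomorphic_on upper_half_plane"
  shows "continuous_on upper_half_plane (\<lambda>z. f z * cnj (g z))"
  using assms by (intro continuous_intros holomorphic_on_imp_continuous_on)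

lemma petersson_integrable:
  assumes "f \<in> cusp_forms N" "g \<in> cusp_forms N" "N > 0" "A \<in> SL2Z" "B \<in> SL2Z"
  shows "set_integrable lborel fundamental_domain (\<lambda>z. slash f A z * cnj (slash g B z))"
proof -
  obtain C where C: "C \<ge> 0" "\<And>z. Im z \<ge> 1 / 2 \<Longrightarrow> norm (slash f A z) \<le> C * exp (- (2 * pi / N) * Im z)"
    using cusp_forms_slash_decay[OF assms(1,4,3), of "1 / 2"] by auto
  obtain C' where C': "C' \<ge> 0" "\<And>z. Im z \<ge> 1 / 2 \<Longrightarrow> norm (slash g B z) \<le> C' * exp (- (2 * pi / N) * Im z)"
    using cusp_forms_slash_decay[OF assms(2,5,3), of "1 / 2"] by auto
  show ?thesis
  proof (rule set_integrable_exp_bound[of "2 * pi / N" _ _ "C * C'"])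
    show "(\<lambda>z. slash f A z * cnj (slash g B z)) holomorphic_on upper_half_plane \<or>
        continuous_on upper_half_plane (\<lambda>z. slash f A z * cnj (slash g B z))"
      using assms by (intro disjI2 continuous_on_slash_product cusp_forms_slash_holomorphic)
    fix z assume "z \<in> fundamental_domain"
    note z = fundamental_domainD[OF this]
    have "norm (slash g B z) \<le> C' * exp (- (2 * pi / N) * Im z)" using C'(2)[of z] z by simp
    also have "\<dots> \<le> C' * 1" using C' z by (intro mult_left_mono) auto
    finally have g: "norm (slash g B z) \<le> C'" by simp
    have "norm (slash f A z) * norm (slash g B z) \<le> (C * exp (- (2 * pi / N) * Im z)) * C'"
      using C(2)[of z] g z C(1) by (intro mult_mono) auto
    thus "norm (slash f A z * cnj (slash g B z)) \<le> C * C' * exp (- (2 * pi / N) * Im z)"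
      by (simp add: norm_mult mult_ac)
  qed (use assms in auto)
qed

lemma petersson_cong:
  assumes "\<And>z. Im z > 0 \<Longrightarrow> f z = f' z" "\<And>z. Im z > 0 \<Longrightarrow> g z = g' z"
  shows "petersson N f g = petersson N f' g'"
  unfolding petersson_altdef set_lebesgue_integral_def
proof (intro sum.cong refl Bochner_Integration.integral_cong)
  fix R z assume R: "R \<in> coset_reps N"
  show "indicator fundamental_domain z *\<^sub>R (slash f R z * cnj (slash g R z)) =
        indicator fundamental_domain z *\<^sub>R (slash f' R z * cnj (slash g' R z))"
    using slash_cong[of R z f f'] slash_cong[of R z g g'] assms fundamental_domainD(1)[of z] coset_reps_det[OF R]
    by (cases "z \<in> fundamental_domain") auto
qed

lemma slash_sum: "slash (\<lambda>z. \<Sum>i\<in>I. c i * g i z) A z = (\<Sum>i\<in>I. c i * slash (g i) A z)"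
  by (simp add: slash_altdef sum_divide_distrib)

lemma petersson_sum_right:
  assumes "f \<in> cusp_forms N" "\<And>i. i \<in> I \<Longrightarrow> g i \<in> cusp_forms N" "N > 0" "finite I"
  shows "petersson N f (\<lambda>z. \<Sum>i\<in>I. c i * g i z) = (\<Sum>i\<in>I. cnj (c i) * petersson N f (g i))"
proof -
  have "(LINT z:fundamental_domain|lborel. slash f R z * cnj (slash (\<lambda>z. \<Sum>i\<in>I. c i * g i z) R z)) =
     (\<Sum>i\<in>I. cnj (c i) * (LINT z:fundamental_domain|lborel. slash f R z * cnj (slash (g i) R z)))"
    if "R \<in> coset_reps N" for R
  proof -
    have "(LINT z:fundamental_domain|lborel. slash f R z * cnj (slash (\<lambda>z. \<Sum>i\<in>I. c i * g i z) R z)) =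
       (LINT z:fundamental_domain|lborel. \<Sum>i\<in>I. cnj (c i) * (slash f R z * cnj (slash (g i) R z)))"
      by (simp add: slash_sum sum_distrib_left mult_ac)
    also have "\<dots> = (\<Sum>i\<in>I. LINT z:fundamental_domain|lborel. cnj (c i) * (slash f R z * cnj (slash (g i) R z)))"
      unfolding set_lebesgue_integral_def scaleR_sum_right
    proof (rule Bochner_Integration.integral_sum)
      fix i assume "i \<in> I"
      hence "set_integrable lborel fundamental_domain (\<lambda>z. cnj (c i) * (slash f R z * cnj (slash (g i) R z)))"
        using assms that coset_reps_SL2Z by (intro set_integrable_mult_right petersson_integrable) auto
      thus "complex_integrable lborel (\<lambda>z. indicat_real fundamental_domain z *\<^sub>R (cnj (c i) * (slash f R z * cnj (slash (g i) R z))))"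
        by (simp add: set_integrable_def)
    qed
    finally show ?thesis by simp
  qed
  thus ?thesis unfolding petersson_altdef by (simp add: sum_distrib_left) (rule sum.swap)
qed

lemma petersson_cnj: "petersson N g f = cnj (petersson N f g)"
proof -
  have "(LINT z:fundamental_domain|lborel. slash g R z * cnj (slash f R z)) =
      cnj (LINT z:fundamental_domain|lborel. slash f R z * cnj (slash g R z))" for R
  proof -
    define F where "F = (\<lambda>z. indicat_real fundamental_domain z *\<^sub>R (slash f R z * cnj (slash g R z)))"
    have "(\<lambda>z. indicat_real fundamental_domain z *\<^sub>R (slash g R z * cnj (slash f R z))) = (\<lambda>z. cnj (F z))"
      by (simp add: F_def fun_eq_iff)
    thus ?thesis unfolding set_lebesgue_integral_def F_def[symmetric]
      using Bochner_Integration.integral_cnj[of lborel F] by (simp only:)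
  qed
  thus ?thesis unfolding petersson_altdef cnj_sum by (intro sum.cong refl)
qed

section \<open>Definiteness of the Petersson product\<close>

lemma open_upper_half_plane: "open upper_half_plane"
  unfolding upper_half_plane_def by (rule open_halfspace_Im_gt)

lemma connected_upper_half_plane: "connected upper_half_plane"
  unfolding upper_half_plane_def by (intro convex_connected convex_halfspace_Im_gt)

lemma open_fund_interior: "open fund_interior"
proof -
  have "fund_interior = {z. Im z > 0} \<inter> {z. \<bar>Re z\<bar> < 1 / 2} \<inter> {z. 1 < norm z}"
    by (auto simp: fund_interior_def)
  also have "open \<dots>" by (intro open_Int open_Collect_less continuous_intros)
  finally show ?thesis .
qed

text \<open>All summands are nonnegative, so the one for the representative R of the trivial coset
  vanishes, and slashing f by this R gives f back. The integrand is then 0 on the open interior, and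
  the identity theorem spreads this to the half plane.\<close>

lemma petersson_definite:
  assumes "f \<in> cusp_forms N" "N > 0" "petersson N f f = 0" "Im z > 0"
  shows "f z = 0"
proof -
  obtain G R where GR: "G \<in> Gamma0 N" "R \<in> coset_reps N" "mat 1 = G ** R"
    using coset_reps_cover[OF SL2Z_one] by blast
  note RS = coset_reps_SL2Z[OF GR(2)]
  define h where "h = slash f R"
  have holh: "h holomorphic_on upper_half_plane" unfolding h_def by (rule cusp_forms_slash_holomorphic[OF assms(1) RS])
  define J where "J = (\<lambda>R. LINT z:fundamental_domain|lborel. (norm (slash f R z))\<^sup>2)"
  have J: "(LINT z:fundamental_domain|lborel. slash f R z * cnj (slash f R z)) = of_real (J R)" for R
    unfolding J_def set_lebesgue_integral_def
    by (subst integral_complex_of_real[symmetric], intro Bochner_Integration.integral_cong refl)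
       (simp add: complex_norm_square scaleR_conv_of_real del: of_real_power)
  have Jnn: "J R \<ge> 0" for R unfolding J_def set_lebesgue_integral_def
    by (intro integral_nonneg_AE) auto
  have "of_real (\<Sum>R\<in>coset_reps N. J R) = (0 :: complex)"
    using assms(3) by (simp add: petersson_altdef J)
  hence "(\<Sum>R\<in>coset_reps N. J R) = 0" by (simp only: of_real_eq_0_iff)
  hence "J R = 0" using finite_coset_reps[OF assms(2)] Jnn GR(2) by (simp add: sum_nonneg_eq_0_iff)
  hence int0: "(LINT z|lborel. indicator fundamental_domain z *\<^sub>R (norm (h z))\<^sup>2) = 0"
    by (simp add: J_def h_def set_lebesgue_integral_def)
  have "integrable lborel (\<lambda>z. norm (indicator fundamental_domain z *\<^sub>R (h z * cnj (h z))))"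
    using petersson_integrable[OF assms(1,1,2) RS RS] unfolding set_integrable_def h_def by (rule integrable_norm)
  also have "(\<lambda>z. norm (indicator fundamental_domain z *\<^sub>R (h z * cnj (h z)))) = (\<lambda>z. indicator fundamental_domain z *\<^sub>R (norm (h z))\<^sup>2)"
    by (auto simp: norm_mult power2_eq_square indicator_def)
  finally have ae: "AE z in lborel. indicator fundamental_domain z *\<^sub>R (norm (h z))\<^sup>2 = 0"
    using int0 by (subst (asm) integral_nonneg_eq_0_iff_AE) auto
  define U where "U = {z \<in> fund_interior. h z \<in> - {0}}"
  have fi: "fund_interior \<subseteq> upper_half_plane" by (auto simp: fund_interior_def upper_half_plane_def)
  have "continuous_on fund_interior h"
    using holomorphic_on_imp_continuous_on[OF holh] fi continuous_on_subset by blast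
  hence "open (fund_interior \<inter> h -` (- {0}))"
    by (intro continuous_open_preimage open_fund_interior) auto
  also have "fund_interior \<inter> h -` (- {0}) = U" by (auto simp: U_def)
  finally have "open U" .
  have "AE z in lborel. z \<notin> U"
    using ae by eventually_elim (use fund_interior_subset in \<open>auto simp: U_def\<close>)
  hence "U \<in> null_sets lborel"
    using \<open>open U\<close> by (subst AE_iff_null_sets) auto
  hence "negligible U" by (simp add: negligible_iff_null_sets null_sets_completionI)
  with \<open>open U\<close> have "U = {}" using open_not_negligible by blast
  hence h0: "h z = 0" if "z \<in> fund_interior" for z using that by (auto simp: U_def)
  have "2 * \<i> \<in> fund_interior" by (simp add: fund_interior_def norm_mult)
  hence "h z = 0"
    using analytic_continuation_open[OF open_fund_interior open_upper_half_plane _ connected_upper_half_plane fi holh, of "\<lambda>_. 0" z]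
      h0 assms(4) by (auto simp: upper_half_plane_def)
  moreover have "slash f (G ** R) z = slash f R z"
    using cusp_forms_slash_mult[OF assms(1) GR(1) _ assms(4)] coset_reps_det[OF GR(2)] by simp
  moreover have "f z = slash f (G ** R) z" unfolding GR(3)[symmetric] slash_one ..
  ultimately show ?thesis by (simp add: h_def)
qed


section \<open>Hecke matrices\<close>

text \<open>For a prime q not dividing N this is the double coset of T_q. Its stability under
  \<open>adj2\<close> is the source of self-adjointness.\<close>

definition hecke_mats :: "nat \<Rightarrow> nat \<Rightarrow> (int ^ 2 ^ 2) set" where
  "hecke_mats N q = {B. det B = int q \<and> int N dvd B $ 2 $ 1}"

text \<open>For a prime q not dividing N, the standard upper triangular representatives of
  \<open>hecke_mats N q\<close> under left multiplication by \<open>Gamma0 N\<close>.\<close>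

definition hecke_reps :: "nat \<Rightarrow> (int ^ 2 ^ 2) set" where
  "hecke_reps q = insert (mat2 (int q) 0 0 1) ((\<lambda>b. mat2 1 (int b) 0 (int q)) ` {..<q})"

lemma hecke_divisors:
  fixes q N :: nat
  assumes "prime q"
  shows "{e. e dvd q \<and> coprime (q div e) N} = (if q dvd N then {q} else {1, q})"
proof -
  have "q > 0" using assms by (simp add: prime_gt_0_nat)
  have "coprime q N \<longleftrightarrow> \<not> q dvd N" using assms
    by (metis coprime_absorb_left not_prime_unit prime_imp_coprime)
  thus ?thesis using assms \<open>q > 0\<close> by (auto simp: prime_nat_iff)
qed

lemma hecke_eq_slash_sum:
  assumes "prime q" "\<not> q dvd N"
  shows "hecke N q f z = of_nat q * (\<Sum>A\<in>hecke_reps q. slash f A z)"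
proof -
  have q: "q > 1" using assms(1) by (rule prime_gt_1_nat)
  have inj: "inj_on (\<lambda>b. mat2 1 (int b) 0 (int q)) {..<q}"
    by (rule inj_onI) (metis mat2_nth(2) of_nat_eq_iff)
  have nin: "mat2 (int q) 0 0 1 \<notin> (\<lambda>b. mat2 1 (int b) 0 (int q)) ` {..<q}"
  proof
    assume "mat2 (int q) 0 0 1 \<in> (\<lambda>b. mat2 1 (int b) 0 (int q)) ` {..<q}"
    then obtain b where "mat2 (int q) 0 0 1 = mat2 1 (int b) 0 (int q)" by blast
    from arg_cong[OF this, of "\<lambda>A. A $ 1 $ 1"] show False using q by simp
  qed
  have "hecke N q f z = of_nat q * f (of_nat q * z) + (\<Sum>b<q. of_nat q / of_nat q ^ 2 * f ((z + of_nat b) / of_nat q))"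
    unfolding hecke_def hecke_divisors[OF assms(1)] using assms(2) q by simp
  also have "\<dots> = of_nat q * (slash f (mat2 (int q) 0 0 1) z + (\<Sum>b<q. slash f (mat2 1 (int b) 0 (int q)) z))"
    by (simp add: slash_altdef frac_lin_def auto_factor_def distrib_left sum_distrib_left)
  also have "slash f (mat2 (int q) 0 0 1) z + (\<Sum>b<q. slash f (mat2 1 (int b) 0 (int q)) z) = (\<Sum>A\<in>hecke_reps q. slash f A z)"
    unfolding hecke_reps_def using nin by (simp add: sum.reindex[OF inj])
  finally show ?thesis .
qed

lemma hecke_repsD:
  assumes "A \<in> hecke_reps q" "q > 0"
  shows "A $ 2 $ 1 = 0" "A $ 1 $ 1 > 0" "A $ 2 $ 2 > 0" "A $ 1 $ 1 * A $ 2 $ 2 = int q"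
    "0 \<le> A $ 1 $ 2" "A $ 1 $ 2 < A $ 2 $ 2" "det A = int q"
  using assms by (auto simp: hecke_reps_def)

text \<open>A Bezout relation for the first column supplies the upper row of a unimodular matrix
  that clears the lower left entry.\<close>

lemma SL2Z_triangular:
  assumes "det B > 0"
  obtains G g t e where "G \<in> SL2Z" "g > 0" "e > 0" "B = G ** mat2 g t 0 e"
proof -
  define a b c d where "a = B $ 1 $ 1" and "b = B $ 1 $ 2" and "c = B $ 2 $ 1" and "d = B $ 2 $ 2"
  have dt: "a * d - b * c > 0" using assms by (simp add: det_2 a_def b_def c_def d_def)
  define g where "g = gcd a c"
  have "g \<noteq> 0" using dt by (auto simp: g_def)
  hence g0: "g > 0" by (simp add: g_def order_less_le)
  obtain a' c' where ac: "a = g * a'" "c = g * c'" unfolding g_def by (meson dvdE gcd_dvd1 gcd_dvd2)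
  obtain x y where bz: "x * a + y * c = g" using bezout_int[of a c] by (auto simp: g_def)
  hence "g * (x * a' + y * c') = g * 1" using ac by (simp add: algebra_simps)
  hence xy: "x * a' + y * c' = 1" using \<open>g \<noteq> 0\<close> by simp
  define e where "e = a' * d - b * c'"
  have "g * e > 0" using dt ac by (simp add: e_def algebra_simps)
  hence e0: "e > 0" using g0 by (simp add: zero_less_mult_iff)
  define X where "X = mat2 x y (- c') a'"
  have X: "X \<in> SL2Z" using xy by (simp add: X_def SL2Z_iff)
  have B: "B = mat2 a b c d" by (simp add: mat2_eq_iff a_def b_def c_def d_def)
  have "- c' * a + a' * c = 0" by (simp add: ac)
  hence XB: "X ** B = mat2 g (x * b + y * d) 0 e"
    unfolding B X_def mat2_eq_iff mat2_mult_nth mat2_nth using bz by (simp add: e_def)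
  have "B = adj2 X ** (X ** B)" using SL2Z_adj2_mult(4)[OF X] by simp
  thus ?thesis using that[of "adj2 X" g e] X g0 e0 unfolding XB by (simp add: SL2Z_adj2)
qed

text \<open>The upper left entry of the triangular factor is 1 or q, hence prime to N, so N divides
  the lower left entry of G. A translation, which lies in \<open>Gamma0 N\<close>, reduces the upper
  right entry.\<close>

lemma hecke_mats_decompose:
  assumes "prime q" "\<not> q dvd N" "B \<in> hecke_mats N q"
  obtains G A where "G \<in> Gamma0 N" "A \<in> hecke_reps q" "B = G ** A"
proof -
  have q: "q > 1" using assms(1) by (rule prime_gt_1_nat)
  have B: "det B = int q" "int N dvd B $ 2 $ 1" using assms(3) by (auto simp: hecke_mats_def)
  have "det B > 0" using B(1) q by simp
  then obtain G g t e where G: "G \<in> SL2Z" "g > 0" "e > 0" "B = G ** mat2 g t 0 e"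
    by (rule SL2Z_triangular)
  have ge: "g * e = int q" using B(1) G(1) unfolding G(4) by (simp add: det_mult2 SL2Z_iff)
  have "g dvd int q" using ge by (metis dvd_triv_left)
  hence "nat g dvd q" using G(2) by (metis int_dvd_int_iff int_nat_eq order_less_imp_le)
  hence "nat g = 1 \<or> nat g = q" using assms(1) by (simp add: prime_nat_iff)
  hence gcase: "g = 1 \<or> g = int q" using G(2) by auto
  have "coprime (int N) g"
    using gcase prime_imp_coprime[OF assms(1,2)] by (auto simp: coprime_commute)
  moreover have "int N dvd G $ 2 $ 1 * g" using B(2) unfolding G(4) by simp
  ultimately have "int N dvd G $ 2 $ 1" by (simp add: coprime_dvd_mult_left_iff)
  hence G0: "G \<in> Gamma0 N" using G(1) by (simp add: Gamma0_def)
  define T where "T = mat2 1 (t div e) 0 1"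
  define A where "A = mat2 g (t mod e) 0 e"
  have T: "T \<in> Gamma0 N" by (simp add: T_def Gamma0_def SL2Z_iff)
  have "mat2 g t 0 e = T ** A" unfolding mat2_eq_iff by (simp add: T_def A_def)
  hence "B = (G ** T) ** A" by (simp add: G(4) mat2_mult_assoc)
  moreover have "A \<in> hecke_reps q"
  proof (cases "g = 1")
    case True
    hence "e = int q" using ge by simp
    hence "A = mat2 1 (int (nat (t mod e))) 0 (int q)" "nat (t mod e) < q"
      using True q by (auto simp: A_def nat_less_iff)
    thus ?thesis unfolding hecke_reps_def by (intro insertI2 image_eqI[of _ _ "nat (t mod e)"]) auto
  next
    case False
    hence "g = int q" using gcase by simp
    moreover from this have "e = 1" using ge q by simp
    ultimately show ?thesis by (simp add: A_def hecke_reps_def)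
  qed
  moreover have "G ** T \<in> Gamma0 N" using G0 T by (rule Gamma0_mult)
  ultimately show ?thesis using that by blast
qed

text \<open>The quotient of G' and G is upper triangular with positive diagonal, hence unipotent,
  and the range of the upper right entry leaves no room for a translation.\<close>

lemma hecke_mats_decompose_unique:
  assumes "A \<in> hecke_reps q" "A' \<in> hecke_reps q" "q > 0" "G \<in> SL2Z" "G' \<in> SL2Z" "G ** A = G' ** A'"
  shows "A = A' \<and> G = G'"
proof -
  define H where "H = adj2 G' ** G"
  have "H ** A = adj2 G' ** (G' ** A')" by (simp add: H_def mat2_mult_assoc assms(6))
  hence HA: "H ** A = A'" using SL2Z_adj2_mult(4)[OF assms(5)] by simp
  have dH: "det H = 1" using assms by (simp add: H_def det_mult2 SL2Z_iff)
  note A = hecke_repsD[OF assms(1,3)] and A' = hecke_repsD[OF assms(2,3)]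
  have e: "H $ 1 $ 1 * A $ 1 $ 1 = A' $ 1 $ 1" "H $ 2 $ 1 * A $ 1 $ 1 = 0"
    "H $ 1 $ 1 * A $ 1 $ 2 + H $ 1 $ 2 * A $ 2 $ 2 = A' $ 1 $ 2" "H $ 2 $ 1 * A $ 1 $ 2 + H $ 2 $ 2 * A $ 2 $ 2 = A' $ 2 $ 2"
    using arg_cong[OF HA, of "\<lambda>X. X $ 1 $ 1"] arg_cong[OF HA, of "\<lambda>X. X $ 2 $ 1"]
      arg_cong[OF HA, of "\<lambda>X. X $ 1 $ 2"] arg_cong[OF HA, of "\<lambda>X. X $ 2 $ 2"] A(1) A'(1) by simp_all
  have H21: "H $ 2 $ 1 = 0" using e(2) A(2) by simp
  hence "H $ 1 $ 1 * H $ 2 $ 2 = 1" using dH by (simp add: det_2)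
  moreover have "H $ 1 $ 1 > 0" using e(1) A(2) A'(2) by (metis zero_less_mult_pos2)
  ultimately have H: "H $ 1 $ 1 = 1" "H $ 2 $ 2 = 1" using zmult_eq_1_iff by fastforce+
  have "A' $ 2 $ 2 = A $ 2 $ 2" using e(4) H H21 by simp
  have *: "A' $ 1 $ 2 = A $ 1 $ 2 + H $ 1 $ 2 * A $ 2 $ 2" using e(3) H by simp
  hence "\<bar>H $ 1 $ 2 * A $ 2 $ 2\<bar> < A $ 2 $ 2" using A(5,6) A'(5,6) \<open>A' $ 2 $ 2 = A $ 2 $ 2\<close> by linarith
  hence "\<bar>H $ 1 $ 2\<bar> * A $ 2 $ 2 < 1 * A $ 2 $ 2" using A(3) by (simp add: abs_mult)
  hence "\<bar>H $ 1 $ 2\<bar> < 1" using A(3) by (simp only: mult_less_cancel_right_pos)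
  hence "H = mat 1" using H H21 unfolding mat2_eq_iff mat_nth2 by simp
  moreover from this have "A = A'" using HA by simp
  moreover have "G = G' ** H" unfolding H_def using SL2Z_adj2_mult(3)[OF assms(5)] by simp
  ultimately show ?thesis by simp
qed

section \<open>Unfolding the Hecke operator over the fundamental domain\<close>

definition return_set :: "int ^ 2 ^ 2 \<Rightarrow> complex set" where
  "return_set C = {w \<in> fundamental_domain. frac_lin C w \<in> fundamental_domain}"

text \<open>These index the pieces into which the product of T_q f with g falls at the coset S: R is
  the coset reached, and C carries a part of the fundamental domain back into it. Requiring
  \<open>return_set C\<close> to be nonempty keeps the set finite, and all conditions survive the
  exchange of R with S and of C with \<open>adj2 C\<close>.\<close>

definition hecke_pairs :: "nat \<Rightarrow> nat \<Rightarrow> int ^ 2 ^ 2 \<Rightarrow> ((int ^ 2 ^ 2) \<times> (int ^ 2 ^ 2)) set" where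
  "hecke_pairs N q S = {(R, C). R \<in> coset_reps N \<and> det C = int q \<and> return_set C \<noteq> {} \<and> R ** C ** adj2 S \<in> hecke_mats N q}"

lemma finite_hecke_pairs:
  assumes "N > 0" "q > 0"
  shows "finite (hecke_pairs N q S)"
proof (rule finite_subset)
  let ?F = "{C. det C = int q \<and> (\<exists>w\<in>fundamental_domain. frac_lin C w \<in> fundamental_domain)}"
  show "finite (coset_reps N \<times> ?F)"
    using assms by (intro finite_cartesian_product finite_coset_reps finite_meeting_fundamental_domain) auto
  show "hecke_pairs N q S \<subseteq> coset_reps N \<times> ?F"
    by (auto simp: hecke_pairs_def return_set_def)
qed

lemma return_set_borel:
  assumes "det C > 0"
  shows "return_set C \<in> sets borel"
proof -
  have "continuous_on fundamental_domain (frac_lin C)"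
    using holomorphic_on_imp_continuous_on[OF frac_lin_holomorphic[OF assms]]
    by (rule continuous_on_subset) (auto dest: fundamental_domainD(1))
  hence "closed (fundamental_domain \<inter> frac_lin C -` fundamental_domain)"
    using fundamental_domain_closed by (intro continuous_closed_preimage)
  also have "fundamental_domain \<inter> frac_lin C -` fundamental_domain = return_set C"
    by (auto simp: return_set_def)
  finally show ?thesis by (rule borel_closed)
qed

text \<open>As \<open>Im w > 1/2\<close>, the uniform bound of
  \<open>cusp_forms_slash_Im_bounded\<close> makes the first factor bounded; the exponential decay
  comes from the slash of g.\<close>

lemma hecke_term_integrable:
  assumes "f \<in> cusp_forms N" "g \<in> cusp_forms N" "N > 0" "R \<in> SL2Z" "S \<in> SL2Z" "det C > 0"
  shows "set_integrable lborel (return_set C) (\<lambda>w. slash f (R ** C) w * cnj (slash g S w))"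
proof -
  obtain K where K: "K > 0" "\<And>A z. A \<in> SL2Z \<Longrightarrow> Im z > 0 \<Longrightarrow> norm (slash f A z) * Im z \<le> K"
    using cusp_forms_slash_Im_bounded[OF assms(1,3)] by blast
  obtain L where L: "L \<ge> 0" "\<And>z. Im z \<ge> 1 / 2 \<Longrightarrow> norm (slash g S z) \<le> L * exp (- (2 * pi / N) * Im z)"
    using cusp_forms_slash_decay[OF assms(2,5,3), of "1 / 2"] by auto
  have dR: "det R = 1" using assms(4) by (simp add: SL2Z_iff)
  show ?thesis
  proof (rule set_integrable_exp_bound[of "2 * pi / N" _ _ "2 * K * L"])
    show "return_set C \<in> sets borel" using assms(6) by (rule return_set_borel)
    have "slash f (R ** C) holomorphic_on upper_half_plane"
      using assms(6) dR by (intro slash_holomorphic cusp_forms_holomorphic[OF assms(1)]) (simp add: det_mult2)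
    thus "(\<lambda>z. slash f (R ** C) z * cnj (slash g S z)) holomorphic_on upper_half_plane \<or>
        continuous_on upper_half_plane (\<lambda>z. slash f (R ** C) z * cnj (slash g S z))"
      using cusp_forms_slash_holomorphic[OF assms(2,5)] by (intro disjI2 continuous_on_slash_product)
    fix z assume "z \<in> return_set C"
    hence "z \<in> fundamental_domain" by (simp add: return_set_def)
    note z = fundamental_domainD[OF this]
    have "norm (slash f (R ** C) z) * (1 / 2) \<le> norm (slash f (R ** C) z) * Im z"
      using z by (intro mult_left_mono) auto
    also have "slash f (R ** C) z = slash (slash f R) C z"
      using dR assms(6) z by (intro slash_mult) auto
    also have "norm (slash (slash f R) C z) * Im z = norm (slash f R (frac_lin C z)) * Im (frac_lin C z) / of_int (det C)"
      using assms(6) z by (intro norm_slash_Im) auto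
    also have "\<dots> \<le> K / of_int (det C)"
      using K(2)[OF assms(4), of "frac_lin C z"] Im_frac_lin_pos[OF assms(6), of z] z assms(6) by (intro divide_right_mono) auto
    also have "\<dots> \<le> K" using K(1) assms(6) by (simp add: divide_le_eq)
    finally have f: "norm (slash f (R ** C) z) \<le> 2 * K"
      using dR assms(6) z slash_mult[of R C z f] by simp
    have "norm (slash f (R ** C) z) * norm (slash g S z) \<le> (2 * K) * (L * exp (- (2 * pi / N) * Im z))"
      using L(2)[of z] f z K(1) by (intro mult_mono) auto
    thus "norm (slash f (R ** C) z * cnj (slash g S z)) \<le> 2 * K * L * exp (- (2 * pi / N) * Im z)"
      by (simp add: norm_mult mult_ac)
  qed (use assms in \<open>auto simp: return_set_def\<close>)
qed

definition hecke_term :: "(complex \<Rightarrow> complex) \<Rightarrow> (complex \<Rightarrow> complex) \<Rightarrow> int ^ 2 ^ 2 \<Rightarrow> int ^ 2 ^ 2 \<Rightarrow> int ^ 2 ^ 2 \<Rightarrow> complex" where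
  "hecke_term f g R S C = (LINT w:return_set C|lborel. slash f (R ** C) w * cnj (slash g S w))"

text \<open>Each representative \<open>A\<close> is followed by the two elements of \<open>SL2Z\<close> that bring the
  (generic) point \<open>A (S w)\<close> back into the fundamental domain.\<close>

lemma hecke_orbit_sum:
  assumes q: "prime q" "\<not> q dvd N" and f: "f \<in> cusp_forms N" and S: "S \<in> SL2Z" and w: "w \<in> fundamental_domain"
    and generic: "\<And>A. det A > 0 \<Longrightarrow> frac_lin A w \<in> fundamental_domain \<Longrightarrow> frac_lin A w \<in> fund_interior"
    and N: "N > 0"
  shows "2 * (\<Sum>A\<in>hecke_reps q. slash f (A ** S) w) =
    (\<Sum>(R, C)\<in>hecke_pairs N q S. indicator (return_set C) w *\<^sub>R slash f (R ** C) w)"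
proof -
  have q0: "q > 0" using q(1) by (simp add: prime_gt_0_nat)
  have w0: "Im w > 0" using fundamental_domainD(1)[OF w] .
  have dS: "det S = 1" using S by (simp add: SL2Z_iff)
  define P where "P = (\<lambda>A. {E \<in> SL2Z. frac_lin E (frac_lin (A ** S) w) \<in> fundamental_domain})"
  have dA: "det (A ** S) > 0" if "A \<in> hecke_reps q" for A
    using hecke_repsD(7)[OF that q0] q0 dS by (simp add: det_mult2)
  have P: "finite (P A)" "card (P A) = 2" if "A \<in> hecke_reps q" for A
  proof -
    have gen: "frac_lin E (frac_lin (A ** S) w) \<in> fund_interior"
      if "det E > 0" "frac_lin E (frac_lin (A ** S) w) \<in> fundamental_domain" for E
      using generic[of "E ** (A ** S)"] that dA[OF \<open>A \<in> hecke_reps q\<close>] w0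
      by (simp add: frac_lin_mult_det(1) det_mult2[of E])
    show "finite (P A)" "card (P A) = 2"
      unfolding P_def using card_SL2Z_orbit[of "frac_lin (A ** S) w"] gen Im_frac_lin_pos[OF dA[OF that] w0] by auto
  qed
  have finX: "finite (hecke_reps q)" by (simp add: hecke_reps_def)
  define K where "K = {x \<in> hecke_pairs N q S. w \<in> return_set (snd x)}"
  \<comment> \<open>For E in \<open>SL2Z\<close> this is the representative of the coset of the
    inverse of E.\<close>
  define rep where "rep = (\<lambda>E. SOME R. R \<in> coset_reps N \<and> R ** E \<in> Gamma0 N)"
  have rep: "rep E \<in> coset_reps N" "rep E ** E \<in> Gamma0 N" if E: "E \<in> SL2Z" for E
  proof -
    obtain G R where GR: "G \<in> Gamma0 N" "R \<in> coset_reps N" "adj2 E = G ** R"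
      using coset_reps_cover[OF SL2Z_adj2[OF E]] by blast
    have "adj2 G = adj2 G ** (adj2 E ** E)" using SL2Z_adj2_mult(2)[OF E] by simp
    also have "\<dots> = R ** E"
      using SL2Z_adj2_mult(4)[OF Gamma0_subset[OF GR(1)], of "R ** E"] by (simp add: GR(3) mat2_mult_assoc)
    finally have "R ** E \<in> Gamma0 N" using GR(1) Gamma0_adj2 by metis
    hence "\<exists>R. R \<in> coset_reps N \<and> R ** E \<in> Gamma0 N" using GR(2) by blast
    thus "rep E \<in> coset_reps N" "rep E ** E \<in> Gamma0 N" unfolding rep_def by (metis (mono_tags, lifting) someI_ex)+
  qed
  \<comment> \<open>With R = \<open>rep E\<close> and C = \<open>E ** (A ** S)\<close> one has
    \<open>R ** C ** adj2 S = (R ** E) ** A\<close>, an element of \<open>Gamma0 N\<close> times a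
    Hecke representative. Uniqueness of such a decomposition gives injectivity, its existence
    surjectivity.\<close>
  define \<phi> where "\<phi> = (\<lambda>(A, E). (rep E, E ** (A ** S)))"
  have cancel: "R ** (E ** (A ** S)) ** adj2 S = (R ** E) ** A" for R E A :: "int ^ 2 ^ 2"
    using SL2Z_adj2_mult(1)[OF S] by (simp add: mat2_mult_assoc)
  have bij: "bij_betw \<phi> (Sigma (hecke_reps q) P) K"
  proof (rule bij_betwI')
    fix x y assume "x \<in> Sigma (hecke_reps q) P" "y \<in> Sigma (hecke_reps q) P"
    then obtain A E A' E' where xy: "x = (A, E)" "y = (A', E')" "A \<in> hecke_reps q" "A' \<in> hecke_reps q" "E \<in> SL2Z" "E' \<in> SL2Z"
      by (auto simp: P_def)
    show "(\<phi> x = \<phi> y) = (x = y)"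
    proof
      assume "\<phi> x = \<phi> y"
      hence eq: "rep E = rep E'" "E ** (A ** S) = E' ** (A' ** S)" by (auto simp: \<phi>_def xy)
      have "(rep E ** E) ** A = (rep E' ** E') ** A'" using eq by (metis cancel)
      hence *: "A = A' \<and> rep E ** E = rep E' ** E'"
        using xy(3-6) q0 rep by (intro hecke_mats_decompose_unique) (auto intro: Gamma0_subset)
      have "adj2 (rep E) ** (rep E ** E) = adj2 (rep E) ** (rep E ** E')" using * eq by simp
      hence "E = E'" using SL2Z_adj2_mult(4)[OF coset_reps_SL2Z[OF rep(1)[OF xy(5)]]] by simp
      thus "x = y" using * xy by simp
    qed simp
  next
    fix x assume "x \<in> Sigma (hecke_reps q) P"
    then obtain A E where x: "x = (A, E)" "A \<in> hecke_reps q" "E \<in> SL2Z" "frac_lin E (frac_lin (A ** S) w) \<in> fundamental_domain"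
      by (auto simp: P_def)
    define C where "C = E ** (A ** S)"
    have dE: "det E = 1" using x by (simp add: SL2Z_iff)
    have dC: "det C = int q" using dE dS hecke_repsD(7)[OF x(2) q0] by (simp add: C_def det_mult2)
    have wC: "w \<in> return_set C"
      using x(4) w w0 dE dA[OF x(2)] by (simp add: return_set_def C_def frac_lin_mult_det(1))
    have "rep E ** C ** adj2 S = (rep E ** E) ** A" unfolding C_def by (rule cancel)
    also have "\<dots> \<in> hecke_mats N q"
      using rep(2)[OF x(3)] hecke_repsD[OF x(2) q0] by (auto simp: hecke_mats_def det_mult2 Gamma0_def SL2Z_iff)
    finally show "\<phi> x \<in> K"
      using rep(1)[OF x(3)] dC wC unfolding K_def hecke_pairs_def \<phi>_def x(1) C_def[symmetric] by (auto simp: C_def)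
  next
    fix y assume "y \<in> K"
    then obtain R C where y: "y = (R, C)" "R \<in> coset_reps N" "det C = int q" "R ** C ** adj2 S \<in> hecke_mats N q" "w \<in> return_set C"
      by (auto simp: K_def hecke_pairs_def)
    obtain G A where GA: "G \<in> Gamma0 N" "A \<in> hecke_reps q" "R ** C ** adj2 S = G ** A"
      using hecke_mats_decompose[OF q y(4)] by blast
    note RS = coset_reps_SL2Z[OF y(2)]
    define E where "E = adj2 R ** G"
    have E: "E \<in> SL2Z" using RS Gamma0_subset[OF GA(1)] by (simp add: E_def SL2Z_mult SL2Z_adj2)
    have RE: "R ** E = G" using SL2Z_adj2_mult(3)[OF RS] by (simp add: E_def)
    have "E ** (A ** S) = adj2 R ** ((G ** A) ** S)" by (simp add: E_def mat2_mult_assoc)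
    also have "\<dots> = C"
      unfolding GA(3)[symmetric] using SL2Z_adj2_mult(4)[OF RS] SL2Z_adj2_mult(2)[OF S] by (simp add: mat2_mult_assoc)
    finally have C: "E ** (A ** S) = C" .
    have "rep E ** adj2 R = (rep E ** E) ** adj2 G"
      unfolding RE[symmetric] adj2_mult using SL2Z_adj2_mult(3)[OF E] by (simp add: mat2_mult_assoc)
    hence "rep E ** adj2 R \<in> Gamma0 N" using rep(2)[OF E] GA(1) by (simp add: Gamma0_mult Gamma0_adj2)
    hence "rep E = R" using rep(1)[OF E] y(2) by (intro coset_reps_unique)
    hence "y = \<phi> (A, E)" by (simp add: \<phi>_def y C)
    moreover have "frac_lin E (frac_lin (A ** S) w) = frac_lin C w"
      unfolding C[symmetric] using E dA[OF GA(2)] w0 by (subst frac_lin_mult_det(1)) (auto simp: SL2Z_iff)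
    hence "(A, E) \<in> Sigma (hecke_reps q) P" using GA(2) E y(5) by (simp add: P_def return_set_def)
    ultimately show "\<exists>x\<in>Sigma (hecke_reps q) P. y = \<phi> x" by blast
  qed
  have val: "slash f (fst (\<phi> x) ** snd (\<phi> x)) w = slash f (fst x ** S) w" if "x \<in> Sigma (hecke_reps q) P" for x
  proof -
    from \<open>x \<in> Sigma (hecke_reps q) P\<close> obtain A E where x: "x = (A, E)" "A \<in> hecke_reps q" "E \<in> SL2Z"
      by (auto simp: P_def)
    have "rep E ** (E ** (A ** S)) = (rep E ** E) ** (A ** S)" by (simp add: mat2_mult_assoc)
    thus ?thesis using cusp_forms_slash_mult[OF f rep(2)[OF x(3)] dA[OF x(2)] w0] by (simp add: \<phi>_def x(1))
  qed
  have "2 * (\<Sum>A\<in>hecke_reps q. slash f (A ** S) w) = (\<Sum>A\<in>hecke_reps q. \<Sum>E\<in>P A. slash f (A ** S) w)"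
    using P(2) by (simp add: sum_distrib_left)
  also have "\<dots> = (\<Sum>x\<in>Sigma (hecke_reps q) P. slash f (fst x ** S) w)"
    using finX P(1) by (subst sum.Sigma) (auto simp: split_def)
  also have "\<dots> = (\<Sum>x\<in>Sigma (hecke_reps q) P. slash f (fst (\<phi> x) ** snd (\<phi> x)) w)"
    by (intro sum.cong refl) (simp add: val)
  also have "\<dots> = (\<Sum>x\<in>K. slash f (fst x ** snd x) w)"
    by (rule sum.reindex_bij_betw[OF bij])
  also have "\<dots> = (\<Sum>x\<in>K. indicator (return_set (snd x)) w *\<^sub>R slash f (fst x ** snd x) w)"
    by (intro sum.cong refl) (simp add: K_def)
  also have "\<dots> = (\<Sum>x\<in>hecke_pairs N q S. indicator (return_set (snd x)) w *\<^sub>R slash f (fst x ** snd x) w)"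
    by (intro sum.mono_neutral_left finite_hecke_pairs N q0) (auto simp: K_def)
  finally show ?thesis by (simp add: split_def)
qed


section \<open>Self-adjointness of Hecke operators\<close>

text \<open>For a prime q not dividing N this is, up to the factor q / 2, the product of
  \<open>hecke N q f\<close> with g, brought into a shape in which f and g play the same
  role.\<close>

definition hecke_form :: "nat \<Rightarrow> nat \<Rightarrow> (complex \<Rightarrow> complex) \<Rightarrow> (complex \<Rightarrow> complex) \<Rightarrow> complex" where
  "hecke_form N q f g = (\<Sum>S\<in>coset_reps N. \<Sum>(R, C)\<in>hecke_pairs N q S. hecke_term f g R S C)"

text \<open>The factor 2 counts A and -A, and the factor q is there because \<open>slash\<close> is
  not normalised by the determinant. The orbit count holds at generic points, so the integrands
  agree almost everywhere.\<close>

lemma hecke_petersson_eq_form: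
  assumes q: "prime q" "\<not> q dvd N" and f: "f \<in> cusp_forms N" and g: "g \<in> cusp_forms N" and N: "N > 0"
  shows "2 * petersson N (hecke N q f) g = of_nat q * hecke_form N q f g"
proof -
  have q0: "q > 0" using q(1) by (simp add: prime_gt_0_nat)
  have "2 * (LINT z:fundamental_domain|lborel. slash (hecke N q f) S z * cnj (slash g S z)) =
      of_nat q * (\<Sum>(R, C)\<in>hecke_pairs N q S. hecke_term f g R S C)" if S: "S \<in> coset_reps N" for S
  proof -
    note SS = coset_reps_SL2Z[OF S]
    have dS: "det S = 1" using coset_reps_det[OF S] .
    define P where "P = hecke_pairs N q S"
    have P: "R \<in> SL2Z" "det C = int q" if "(R, C) \<in> P" for R C
      using that coset_reps_SL2Z by (auto simp: P_def hecke_pairs_def)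
    define t where "t = (\<lambda>x w. indicator (return_set (snd x)) w *\<^sub>R (slash f (fst x ** snd x) w * cnj (slash g S w)))"
    have t: "integrable lborel (t x)" "(LINT w|lborel. t x w) = hecke_term f g (fst x) S (snd x)" if "x \<in> P" for x
    proof -
      obtain R C where x: "x = (R, C)" by (cases x)
      show "integrable lborel (t x)"
        using hecke_term_integrable[OF f g N P(1) SS, of R C C] P(2)[of R C] q0 that
        by (simp add: t_def x set_integrable_def)
      show "(LINT w|lborel. t x w) = hecke_term f g (fst x) S (snd x)"
        by (simp add: t_def x hecke_term_def set_lebesgue_integral_def)
    qed
    have slash_hecke: "slash (hecke N q f) S w = of_nat q * (\<Sum>A\<in>hecke_reps q. slash f (A ** S) w)" if "Im w > 0" for w
    proof -
      have "slash (hecke N q f) S w = of_nat q * (\<Sum>A\<in>hecke_reps q. slash (slash f A) S w)"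
        by (simp add: slash_altdef[of _ S] hecke_eq_slash_sum[OF q] sum_divide_distrib
            del: times_divide_eq_right flip: times_divide_eq_right)
      also have "(\<Sum>A\<in>hecke_reps q. slash (slash f A) S w) = (\<Sum>A\<in>hecke_reps q. slash f (A ** S) w)"
        using that dS q0 hecke_repsD(7) by (intro sum.cong refl slash_mult[symmetric]) auto
      finally show ?thesis .
    qed
    define L where "L = (\<lambda>w. indicator fundamental_domain w *\<^sub>R (slash (hecke N q f) S w * cnj (slash g S w)))"
    have L_meas: "L \<in> borel_measurable lborel"
    proof -
      have "(\<lambda>w. slash f (A ** S) w) holomorphic_on upper_half_plane" if "A \<in> hecke_reps q" for A
        using dS q0 hecke_repsD(7)[OF that q0] by (intro slash_holomorphic cusp_forms_holomorphic[OF f]) (simp add: det_mult2)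
      hence "continuous_on upper_half_plane (\<lambda>w. (of_nat q * (\<Sum>A\<in>hecke_reps q. slash f (A ** S) w)) * cnj (slash g S w))"
        using cusp_forms_slash_holomorphic[OF g SS]
        by (intro continuous_on_slash_product holomorphic_intros) auto
      hence "continuous_on fundamental_domain (\<lambda>w. (of_nat q * (\<Sum>A\<in>hecke_reps q. slash f (A ** S) w)) * cnj (slash g S w))"
        using fundamental_domain_subset continuous_on_subset by blast
      hence "continuous_on fundamental_domain (\<lambda>w. slash (hecke N q f) S w * cnj (slash g S w))"
        by (rule continuous_on_cong[THEN iffD1, rotated 2]) (auto simp: slash_hecke fundamental_domainD(1))
      thus ?thesis unfolding L_def by (simp add: borel_measurable_continuous_on_indicator)
    qed
    have "AE w in lborel. 2 * L w = of_nat q * (\<Sum>x\<in>P. t x w)"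
      using AE_frac_lin_interior
    proof eventually_elim
      case (elim w)
      show ?case
      proof (cases "w \<in> fundamental_domain")
        case True
        note w = fundamental_domainD[OF True]
        have "2 * L w = of_nat q * (2 * (\<Sum>A\<in>hecke_reps q. slash f (A ** S) w)) * cnj (slash g S w)"
          using True w by (simp add: L_def slash_hecke)
        also have "2 * (\<Sum>A\<in>hecke_reps q. slash f (A ** S) w) =
            (\<Sum>x\<in>P. indicator (return_set (snd x)) w *\<^sub>R slash f (fst x ** snd x) w)"
          using hecke_orbit_sum[OF q f SS True _ N] elim w by (simp add: P_def split_def)
        finally show ?thesis by (simp add: t_def sum_distrib_right sum_distrib_left mult_ac scaleR_conv_of_real)
      next
        case False
        thus ?thesis by (auto simp: L_def t_def return_set_def)
      qed
    qed
    hence "(LINT w|lborel. 2 * L w) = (LINT w|lborel. of_nat q * (\<Sum>x\<in>P. t x w))"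
      using L_meas t(1) by (intro integral_cong_AE) (auto intro!: borel_measurable_times borel_measurable_sum dest: borel_measurable_integrable)
    also have "\<dots> = of_nat q * (\<Sum>x\<in>P. LINT w|lborel. t x w)"
      using t(1) by (simp add: Bochner_Integration.integral_sum)
    also have "(\<Sum>x\<in>P. LINT w|lborel. t x w) = (\<Sum>(R, C)\<in>P. hecke_term f g R S C)"
      by (intro sum.cong refl) (simp add: t(2) split_def)
    finally have "2 * (LINT w|lborel. L w) = of_nat q * (\<Sum>(R, C)\<in>P. hecke_term f g R S C)" by simp
    thus ?thesis unfolding L_def set_lebesgue_integral_def P_def .
  qed
  thus ?thesis by (simp add: petersson_altdef hecke_form_def sum_distrib_left)
qed

lemma hecke_mats_adj2: "B \<in> hecke_mats N q \<Longrightarrow> adj2 B \<in> hecke_mats N q"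
  by (simp add: hecke_mats_def)

lemma return_set_image:
  assumes "det C > 0"
  shows "frac_lin (adj2 C) ` return_set (adj2 C) = return_set C"
proof (intro subset_antisym subsetI)
  fix w assume "w \<in> frac_lin (adj2 C) ` return_set (adj2 C)"
  thus "w \<in> return_set C" using assms by (auto simp: return_set_def frac_lin_adj2 fundamental_domainD(1))
next
  fix w assume w: "w \<in> return_set C"
  hence "frac_lin C w \<in> return_set (adj2 C)" "w = frac_lin (adj2 C) (frac_lin C w)"
    using assms by (auto simp: return_set_def frac_lin_adj2 fundamental_domainD(1))
  thus "w \<in> frac_lin (adj2 C) ` return_set (adj2 C)" by blast
qed

text \<open>The substitution \<open>w = adj2 C v\<close> exchanges the roles of \<open>f\<close> and \<open>g\<close>; the Jacobian
  cancels against the weight.\<close>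

lemma hecke_term_swap:
  assumes f: "f \<in> cusp_forms N" and g: "g \<in> cusp_forms N" and N: "N > 0"
    and RS: "R \<in> SL2Z" "S \<in> SL2Z" and C: "det C > 0"
  shows "hecke_term f g R S C = cnj (hecke_term g f S R (adj2 C))"
proof -
  define E where "E = return_set (adj2 C)"
  define F where "F = (\<lambda>w. slash f (R ** C) w * cnj (slash g S w))"
  define G where "G = (\<lambda>v. slash f R v * cnj (slash g (S ** adj2 C) v))"
  define D' where "D' = (\<lambda>v. of_int (det C) / auto_factor (adj2 C) v ^ 2 :: complex)"
  have dR: "det R = 1" "det S = 1" using RS by (auto simp: SL2Z_iff)
  have key: "norm (D' v) ^ 2 *\<^sub>R F (frac_lin (adj2 C) v) = G v" if "v \<in> E" for v
  proof -
    have v: "Im v > 0" using that by (auto simp: E_def return_set_def dest: fundamental_domainD(1))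
    define w where "w = frac_lin (adj2 C) v"
    have w: "Im w > 0" unfolding w_def using C v by (intro Im_frac_lin_pos) auto
    have Cw: "frac_lin C w = v" using C v by (simp add: w_def frac_lin_adj2)
    define j where "j = auto_factor (adj2 C) v"
    have j0: "j \<noteq> 0" unfolding j_def using C v by (intro auto_factor_nonzero) auto
    have "auto_factor C w * j = of_int (det C)"
      unfolding w_def j_def using C v by (intro auto_factor_adj2)
    hence JC: "auto_factor C w = of_int (det C) / j" using j0 by (simp add: field_simps)
    have "slash f (R ** C) w = slash (slash f R) C w" using dR C w by (intro slash_mult) auto
    also have "\<dots> = slash f R v * j ^ 2 / of_int (det C) ^ 2"
      by (simp add: slash_altdef[of "slash f R"] Cw JC power_divide)
    finally have 1: "slash f (R ** C) w = slash f R v * j ^ 2 / of_int (det C) ^ 2" .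
    have "slash g (S ** adj2 C) v = slash (slash g S) (adj2 C) v" using dR C v by (intro slash_mult) auto
    also have "\<dots> = slash g S w / j ^ 2" by (simp add: slash_altdef[of "slash g S"] w_def j_def)
    finally have 2: "slash g S w = slash g (S ** adj2 C) v * j ^ 2" using j0 by simp
    have "norm (D' v) ^ 2 *\<^sub>R F w = of_real (norm (D' v) ^ 2) * F w" by (simp add: scaleR_conv_of_real)
    also have "of_real (norm (D' v) ^ 2) = D' v * cnj (D' v)" by (rule complex_norm_square)
    also have "\<dots> = of_int (det C) ^ 2 / (j ^ 2 * cnj j ^ 2)"
      by (simp add: D'_def j_def power2_eq_square)
    also have "\<dots> * F w = G v"
      unfolding F_def G_def 1 2 using j0 C by (simp add: field_simps)
    finally show ?thesis by (simp add: w_def)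
  qed
  \<comment> \<open>This integrand is the conjugate of the pulled-back one, whose measurability it
    provides.\<close>
  have G_int: "set_integrable lborel E (\<lambda>v. slash g (S ** adj2 C) v * cnj (slash f R v))"
    unfolding E_def using C by (intro hecke_term_integrable[OF g f N RS(2,1)]) auto
  have "hecke_term f g R S C = (LINT w:frac_lin (adj2 C) ` E|lborel. F w)"
    unfolding hecke_term_def E_def return_set_image[OF C] F_def ..
  also have "\<dots> = (LINT v:E|lborel. norm (D' v) ^ 2 *\<^sub>R F (frac_lin (adj2 C) v))"
  proof (rule complex_change_of_variables)
    show "E \<in> sets borel" unfolding E_def using C by (intro return_set_borel) auto
    show "(frac_lin (adj2 C) has_field_derivative D' v) (at v)" if "v \<in> E" for v
      using frac_lin_deriv[of "adj2 C" v] that C by (auto simp: D'_def E_def return_set_def dest: fundamental_domainD(1))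
    show "inj_on (frac_lin (adj2 C)) E"
      by (rule inj_on_subset[OF frac_lin_inj]) (use C in \<open>auto simp: E_def return_set_def dest: fundamental_domainD(1)\<close>)
    have "(\<lambda>v. indicat_real E v *\<^sub>R (norm (D' v) ^ 2 *\<^sub>R F (frac_lin (adj2 C) v))) =
        (\<lambda>v. cnj (indicat_real E v *\<^sub>R (slash g (S ** adj2 C) v * cnj (slash f R v))))"
      by (rule ext) (auto simp: key G_def indicator_def)
    also have "\<dots> \<in> borel_measurable borel"
    proof (rule measurable_compose[where g = cnj and N = borel])
      show "(\<lambda>v. indicat_real E v *\<^sub>R (slash g (S ** adj2 C) v * cnj (slash f R v))) \<in> borel_measurable borel"
        using borel_measurable_integrable[OF G_int[unfolded set_integrable_def]] by simp
      show "cnj \<in> borel_measurable borel"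
        by (intro borel_measurable_continuous_onI continuous_intros)
    qed
    finally show "(\<lambda>v. indicat_real E v *\<^sub>R (norm (D' v) ^ 2 *\<^sub>R F (frac_lin (adj2 C) v))) \<in> borel_measurable borel" .
    show "set_integrable lborel (frac_lin (adj2 C) ` E) F"
      unfolding E_def return_set_image[OF C] F_def by (rule hecke_term_integrable[OF f g N RS C])
  qed
  also have "\<dots> = (LINT v|lborel. cnj (indicat_real E v *\<^sub>R (slash g (S ** adj2 C) v * cnj (slash f R v))))"
    unfolding set_lebesgue_integral_def
    by (intro Bochner_Integration.integral_cong refl) (auto simp: key G_def indicator_def)
  also have "\<dots> = cnj (hecke_term g f S R (adj2 C))"
    unfolding hecke_term_def set_lebesgue_integral_def E_def[symmetric] by (rule Bochner_Integration.integral_cnj)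
  finally show ?thesis .
qed

text \<open>The involution exchanging S with R and C with \<open>adj2 C\<close> preserves the index
  set, and \<open>hecke_term_swap\<close> matches the summands.\<close>

lemma hecke_form_cnj:
  assumes q: "q > 0" and f: "f \<in> cusp_forms N" and g: "g \<in> cusp_forms N" and N: "N > 0"
  shows "hecke_form N q g f = cnj (hecke_form N q f g)"
proof -
  let ?X = "Sigma (coset_reps N) (hecke_pairs N q)"
  have form: "hecke_form N q f g = (\<Sum>(S, R, C)\<in>?X. hecke_term f g R S C)" for f g
    unfolding hecke_form_def using finite_coset_reps[OF N] finite_hecke_pairs[OF N q]
    by (subst sum.Sigma) (auto simp: split_def)
  have adj: "(R, S, adj2 C) \<in> ?X" if "(S, R, C) \<in> ?X" for S R C
  proof -
    have *: "S \<in> coset_reps N" "R \<in> coset_reps N" "det C = int q" "return_set C \<noteq> {}" "R ** C ** adj2 S \<in> hecke_mats N q"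
      using that by (auto simp: hecke_pairs_def)
    have "return_set (adj2 C) \<noteq> {}" using return_set_image[of C] * q by auto
    moreover have "S ** adj2 C ** adj2 R = adj2 (R ** C ** adj2 S)"
      by (simp add: adj2_mult mat2_mult_assoc)
    hence "S ** adj2 C ** adj2 R \<in> hecke_mats N q" using *(5) hecke_mats_adj2 by metis
    ultimately show ?thesis using * by (auto simp: hecke_pairs_def)
  qed
  have "hecke_form N q g f = (\<Sum>x\<in>?X. cnj (case x of (S, R, C) \<Rightarrow> hecke_term f g R S C))"
    unfolding form
  proof (rule sum.reindex_bij_witness[of _ "\<lambda>(S, R, C). (R, S, adj2 C)" "\<lambda>(S, R, C). (R, S, adj2 C)"])
    fix x assume x: "x \<in> ?X"
    obtain S R C where [simp]: "x = (S, R, C)" by (metis prod_cases3)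
    have "S \<in> SL2Z" "R \<in> SL2Z" "det C > 0" using x q by (auto simp: hecke_pairs_def intro: coset_reps_SL2Z)
    thus "cnj (case case x of (S, R, C) \<Rightarrow> (R, S, adj2 C) of (S, R, C) \<Rightarrow> hecke_term f g R S C) =
        (case x of (S, R, C) \<Rightarrow> hecke_term g f R S C)"
      using hecke_term_swap[OF f g N, of S R "adj2 C"] by simp
  qed (use adj in auto)
  thus ?thesis unfolding form by simp
qed

text \<open>Moving T_q across the product gives
  \<open>c * petersson N f g = cnj c' * petersson N f g\<close>; the conjugate appears because the
  product is conjugate-linear in its second argument.\<close>

lemma hecke_eigenforms_orthogonal:
  assumes q: "prime q" "\<not> q dvd N" and f: "f \<in> cusp_forms N" and g: "g \<in> cusp_forms N" and N: "N > 0"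
    and ef: "\<And>z. Im z > 0 \<Longrightarrow> hecke N q f z = c * f z" and eg: "\<And>z. Im z > 0 \<Longrightarrow> hecke N q g z = c' * g z"
    and ne: "c \<noteq> cnj c'"
  shows "petersson N f g = 0"
proof -
  have scale: "petersson N (\<lambda>z. a * f z) h = a * petersson N f h" for a f h
  proof -
    have "slash (\<lambda>z. a * f z) A z = a * slash f A z" for A z by (simp add: slash_altdef)
    thus ?thesis by (simp add: petersson_altdef sum_distrib_left mult.assoc)
  qed
  have "2 * (c * petersson N f g) = of_nat q * hecke_form N q f g"
    using hecke_petersson_eq_form[OF q f g N] petersson_cong[OF ef, where g = g and g' = g and N = N] by (simp add: scale)
  moreover have "2 * (c' * petersson N g f) = of_nat q * hecke_form N q g f"
    using hecke_petersson_eq_form[OF q g f N] petersson_cong[OF eg, where g = f and g' = f and N = N] by (simp add: scale)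
  hence "cnj (2 * (c' * petersson N g f)) = of_nat q * cnj (hecke_form N q g f)" by simp
  hence "2 * (cnj c' * petersson N f g) = of_nat q * hecke_form N q f g"
    using hecke_form_cnj[OF _ f g N, of q] prime_gt_0_nat[OF q(1)] petersson_cnj[where N = N and g = f and f = g] by simp
  ultimately have "2 * (c * petersson N f g) = 2 * (cnj c' * petersson N f g)" by (simp only:)
  hence "c * petersson N f g = cnj c' * petersson N f g" by (simp only: mult_cancel_left) simp
  thus ?thesis using ne by simp
qed


section \<open>A Sturm bound\<close>

lemma holomorphic_mult_eq_0:
  assumes "open S" "connected S" "f holomorphic_on S" "g holomorphic_on S" "\<And>z. z \<in> S \<Longrightarrow> f z * g z = 0"
  shows "(\<forall>z\<in>S. f z = 0) \<or> (\<forall>z\<in>S. g z = 0)"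
proof (rule disjCI)
  assume "\<not> (\<forall>z\<in>S. g z = 0)"
  then obtain z0 where z0: "z0 \<in> S" "g z0 \<noteq> 0" by blast
  define U where "U = S \<inter> g -` (- {0})"
  have "open U" unfolding U_def
    using assms by (intro continuous_open_preimage holomorphic_on_imp_continuous_on) auto
  moreover have "f z = 0" if "z \<in> U" for z using that assms(5)[of z] by (auto simp: U_def)
  moreover have "U \<noteq> {}" using z0 by (auto simp: U_def)
  ultimately show "\<forall>z\<in>S. f z = 0"
    using analytic_continuation_open[of U S f "\<lambda>_. 0"] assms by (auto simp: U_def)
qed

lemma holomorphic_prod_eq_0:
  assumes "finite I" "open S" "connected S" "S \<noteq> {}" "\<And>i. i \<in> I \<Longrightarrow> f i holomorphic_on S" "\<And>z. z \<in> S \<Longrightarrow> (\<Prod>i\<in>I. f i z) = 0"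
  shows "\<exists>i\<in>I. \<forall>z\<in>S. f i z = 0"
  using assms(1,5,6)
proof (induction I rule: finite_induct)
  case empty
  thus ?case using assms(4) by auto
next
  case (insert i I)
  have "(\<forall>z\<in>S. f i z = 0) \<or> (\<forall>z\<in>S. (\<Prod>i\<in>I. f i z) = 0)"
    using insert.prems insert.hyps assms(2,3) by (intro holomorphic_mult_eq_0 holomorphic_intros) auto
  thus ?case using insert.IH insert.prems by auto
qed

text \<open>The norm of f down to level 1, whose weight is twice the index. With it the Sturm bound
  can be proved on the fundamental domain of \<open>SL2Z\<close>; the resulting bound is the index,
  where the classical one is a sixth of it.\<close>

definition norm_form :: "nat \<Rightarrow> (complex \<Rightarrow> complex) \<Rightarrow> complex \<Rightarrow> complex" where
  "norm_form N f z = (\<Prod>R\<in>coset_reps N. slash f R z)"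

text \<open>Right multiplication by A permutes the cosets, and each factor contributes the square of
  the automorphy factor.\<close>

lemma norm_form_modular:
  assumes f: "f \<in> cusp_forms N" and N: "N > 0" and A: "A \<in> SL2Z" and z: "Im z > 0"
  shows "norm_form N f (frac_lin A z) = auto_factor A z ^ (2 * card (coset_reps N)) * norm_form N f z"
proof -
  have dA: "det A = 1" using A by (simp add: SL2Z_iff)
  have J0: "auto_factor A z \<noteq> 0" using dA z by (intro auto_factor_nonzero) auto
  have "\<exists>R'. R' \<in> coset_reps N \<and> (R ** A) ** adj2 R' \<in> Gamma0 N" if R: "R \<in> coset_reps N" for R
  proof -
    obtain G R' where GR: "G \<in> Gamma0 N" "R' \<in> coset_reps N" "R ** A = G ** R'"
      using coset_reps_cover[OF SL2Z_mult[OF coset_reps_SL2Z[OF R] A]] by blast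
    have "(R ** A) ** adj2 R' = G"
      unfolding GR(3) using SL2Z_adj2_mult(1)[OF coset_reps_SL2Z[OF GR(2)]] by (simp add: mat2_mult_assoc)
    thus ?thesis using GR by auto
  qed
  then obtain p where p: "\<And>R. R \<in> coset_reps N \<Longrightarrow> p R \<in> coset_reps N"
    "\<And>R. R \<in> coset_reps N \<Longrightarrow> (R ** A) ** adj2 (p R) \<in> Gamma0 N" by metis
  have RA: "((R ** A) ** adj2 (p R)) ** p R = R ** A" if "R \<in> coset_reps N" for R
    using SL2Z_adj2_mult(2)[OF coset_reps_SL2Z[OF p(1)[OF that]]] by (simp add: mat2_mult_assoc)
  have "inj_on p (coset_reps N)"
  proof (rule inj_onI)
    fix R R' assume RR: "R \<in> coset_reps N" "R' \<in> coset_reps N" "p R = p R'"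
    define X where "X = (R ** A) ** adj2 (p R)"
    define Y where "Y = (R' ** A) ** adj2 (p R)"
    have XY: "X \<in> Gamma0 N" "Y \<in> Gamma0 N" using p(2)[OF RR(1)] p(2)[OF RR(2)] RR(3) by (simp_all add: X_def Y_def)
    have "adj2 Y = p R ** (adj2 A ** adj2 R')" by (simp add: Y_def adj2_mult)
    hence "X ** adj2 Y = (X ** p R) ** (adj2 A ** adj2 R')" by (simp add: mat2_mult_assoc)
    also have "\<dots> = R ** (A ** (adj2 A ** adj2 R'))" using RA[OF RR(1)] by (simp add: X_def mat2_mult_assoc)
    also have "\<dots> = R ** adj2 R'" using SL2Z_adj2_mult(3)[OF A] by simp
    finally have "R ** adj2 R' \<in> Gamma0 N" using XY Gamma0_mult Gamma0_adj2 by metis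
    thus "R = R'" using RR by (intro coset_reps_unique)
  qed
  moreover have "p ` coset_reps N \<subseteq> coset_reps N" using p(1) by blast
  ultimately have bij: "bij_betw p (coset_reps N) (coset_reps N)"
    using finite_coset_reps[OF N] by (simp add: bij_betw_def endo_inj_surj)
  have "slash f R (frac_lin A z) = auto_factor A z ^ 2 * slash f (p R) z" if R: "R \<in> coset_reps N" for R
  proof -
    have dR: "det R = 1" "det (p R) = 1" using R p(1) coset_reps_det by auto
    have "slash f (p R) z = slash f (R ** A) z"
      using cusp_forms_slash_mult[OF f p(2)[OF R] _ z, of "p R"] dR RA[OF R] by simp
    also have "\<dots> = slash (slash f R) A z" using dR dA z by (intro slash_mult) auto
    finally show ?thesis using J0 by (simp add: slash_altdef[of "slash f R"])
  qed
  hence "norm_form N f (frac_lin A z) = (\<Prod>R\<in>coset_reps N. auto_factor A z ^ 2 * slash f (p R) z)"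
    by (simp add: norm_form_def)
  also have "\<dots> = auto_factor A z ^ (2 * card (coset_reps N)) * (\<Prod>R\<in>coset_reps N. slash f (p R) z)"
    by (simp add: prod.distrib power_mult)
  also have "(\<Prod>R\<in>coset_reps N. slash f (p R) z) = norm_form N f z"
    unfolding norm_form_def by (rule prod.reindex_bij_betw[OF bij])
  finally show ?thesis .
qed

text \<open>The numerical input for halving the bound: the radius r = exp(-pi y) used below has y >
  1/2, hence 2 r \<le> 1/2.\<close>

lemma exp_neg_pi_half: "2 * exp (- pi / 2) \<le> (1 / 2 :: real)"
proof -
  have "2 \<le> exp (3 / 4 :: real)" using exp_lower_Taylor_quadratic[of "3 / 4 :: real"] by (simp add: power2_eq_square)
  hence "2 * 2 \<le> exp (3 / 4 :: real) * exp (3 / 4)" by (intro mult_mono) auto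
  also have "\<dots> = exp (3 / 2)" by (simp flip: exp_add)
  also have "\<dots> \<le> exp (pi / 2)" using pi_gt3 by simp
  finally have "2 * 2 * exp (- pi / 2) \<le> exp (pi / 2) * exp (- pi / 2)" by (intro mult_right_mono) auto
  thus ?thesis by (simp flip: exp_add)
qed

text \<open>The invariant function \<open>|P| y\<^sup>\<mu>\<close>, where \<open>P\<close> is the product of all
  conjugates of \<open>f\<close>, is bounded; as \<open>P\<close> vanishes to order \<open>\<mu>\<close> at the cusp, the maximum principle in
  the nome halves any bound.\<close>

theorem sturm_bound:
  assumes f: "f \<in> cusp_forms N" and N: "N > 0" and fb: "q_expansion f b"
    and b0: "\<And>n. n < card (coset_reps N) \<Longrightarrow> b n = 0" and z: "Im z > 0"
  shows "f z = 0"
proof -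
  define \<mu> where "\<mu> = card (coset_reps N)"
  note fin = finite_coset_reps[OF N]
  obtain G0 R0 where R0: "G0 \<in> Gamma0 N" "R0 \<in> coset_reps N" "mat 1 = G0 ** R0"
    using coset_reps_cover[OF SL2Z_one] by blast
  have \<mu>: "\<mu> \<ge> 1" using R0(2) fin by (metis \<mu>_def One_nat_def Suc_leI card_gt_0_iff empty_iff)
  define P where "P = norm_form N f"
  define u where "u = (\<lambda>z. norm (P z) * Im z ^ \<mu>)"
  have holP: "P holomorphic_on upper_half_plane"
    unfolding P_def norm_form_def[abs_def] using cusp_forms_slash_holomorphic[OF f] coset_reps_SL2Z
    by (intro holomorphic_intros) auto
  have u_inv: "u (frac_lin A z) = u z" if "A \<in> SL2Z" "Im z > 0" for A z
  proof -
    have dA: "det A = 1" using that by (simp add: SL2Z_iff)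
    have J0: "auto_factor A z \<noteq> 0" using dA that by (intro auto_factor_nonzero) auto
    show ?thesis
      unfolding u_def P_def norm_form_modular[OF f N that] using Im_frac_lin[of A z] dA that(2) J0
      by (simp add: norm_mult norm_power power_divide \<mu>_def[symmetric] power_mult)
  qed
  have per: "P (z + of_real 1) = P z" if "Im z > 0" for z
    using norm_form_modular[OF f N _ that, of "mat2 1 1 0 1"]
    by (simp add: P_def frac_lin_translation auto_factor_translation SL2Z_iff)
  obtain K where K: "K > 0" "\<And>A z. A \<in> SL2Z \<Longrightarrow> Im z > 0 \<Longrightarrow> norm (slash f A z) * Im z \<le> K"
    using cusp_forms_slash_Im_bounded[OF f N] by blast
  have u_bdd: "u z \<le> K ^ \<mu>" if "Im z > 0" for z
  proof -
    have "u z = (\<Prod>R\<in>coset_reps N. norm (slash f R z) * Im z)"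
      by (simp add: u_def P_def norm_form_def prod_norm prod.distrib \<mu>_def)
    also have "\<dots> \<le> (\<Prod>R\<in>coset_reps N. K)"
      using K(2) that coset_reps_SL2Z by (intro prod_mono) auto
    finally show ?thesis by (simp add: \<mu>_def)
  qed
  \<comment> \<open>The zero of order \<mu> comes from the factor of the trivial coset; the other
    factors are bounded at large height. Those have a period N in general, so the passage to the
    nome of width 1 is made for the whole product.\<close>
  define G where "G = (\<lambda>z. P z / nome 1 z ^ \<mu>)"
  have holG: "G holomorphic_on upper_half_plane"
    unfolding G_def nome_def using holP by (intro holomorphic_intros) auto
  have perG: "G (z + of_real 1) = G z" if "Im z > 0" for z
  proof -
    have "nome 1 (z + 1) = nome 1 z" by (simp add: nome_def exp_add distrib_left)
    thus ?thesis using per[OF that] by (simp add: G_def)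
  qed
  obtain k where k: "k holomorphic_on ball 0 1" "\<And>z. Im z > 0 \<Longrightarrow> G z = k (nome 1 z)"
  proof -
    obtain h where h: "h holomorphic_on ball 0 1" "\<And>w. norm w < 1 \<Longrightarrow> (\<lambda>n. b n * w ^ n) sums h w"
      "\<And>z. Im z > 0 \<Longrightarrow> f z = h (nome 1 z)" using q_expansion_nome[OF fb] by blast
    define h1 where "h1 = (\<lambda>w. \<Sum>n. b (n + \<mu>) * w ^ n)"
    have h1: "(\<lambda>n. b (n + \<mu>) * w ^ n) sums h1 w" "w \<noteq> 0 \<Longrightarrow> h w = w ^ \<mu> * h1 w" if "norm w < 1" for w
    proof -
      show *: "(\<lambda>n. b (n + \<mu>) * w ^ n) sums h1 w"
      proof (cases "w = 0")
        case True
        thus ?thesis using powser_sums_zero[of "\<lambda>n. b (n + \<mu>)"] by (metis h1_def sums_iff)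
      next
        case False
        have "summable (\<lambda>n. b (n + \<mu>) * w ^ (n + \<mu>))"
          using h(2)[OF that] summable_ignore_initial_segment sums_summable by blast
        hence "summable (\<lambda>n. b (n + \<mu>) * w ^ (n + \<mu>) * inverse (w ^ \<mu>))" by (rule summable_mult2)
        also have "(\<lambda>n. b (n + \<mu>) * w ^ (n + \<mu>) * inverse (w ^ \<mu>)) = (\<lambda>n. b (n + \<mu>) * w ^ n)"
          using False by (simp add: power_add field_simps)
        finally show ?thesis unfolding h1_def by (rule summable_sums)
      qed
      have "(\<lambda>n. b (n + \<mu>) * w ^ (n + \<mu>)) sums (h w - (\<Sum>i<\<mu>. b i * w ^ i))"
        using h(2)[OF that] by (rule sums_split_initial_segment)
      moreover have "(\<Sum>i<\<mu>. b i * w ^ i) = 0" using b0 by (simp add: \<mu>_def)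
      ultimately have "(\<lambda>n. b (n + \<mu>) * w ^ (n + \<mu>)) sums h w" by simp
      moreover have "(\<lambda>n. b (n + \<mu>) * w ^ (n + \<mu>)) sums (w ^ \<mu> * h1 w)"
        using sums_mult[OF *, of "w ^ \<mu>"] by (simp add: power_add mult_ac)
      ultimately show "h w = w ^ \<mu> * h1 w" using sums_unique2 by blast
    qed
    have "h1 holomorphic_on ball 0 1"
      by (rule power_series_holomorphic[of 0 1 "\<lambda>n. b (n + \<mu>)"]) (use h1(1) in simp)
    moreover have "cball 0 (exp (- 2 * pi)) \<subseteq> ball (0 :: complex) 1" by (simp add: cball_subset_ball_iff)
    ultimately have "continuous_on (cball 0 (exp (- 2 * pi))) h1"
      by (metis continuous_on_subset holomorphic_on_imp_continuous_on)
    hence "bounded (h1 ` cball 0 (exp (- 2 * pi)))"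
      by (intro compact_imp_bounded compact_continuous_image) auto
    then obtain C0 where C0: "\<And>w. w \<in> cball 0 (exp (- 2 * pi)) \<Longrightarrow> norm (h1 w) \<le> C0"
      by (meson bounded_iff imageI)
    have G_eq: "G z = h1 (nome 1 z) * (\<Prod>R\<in>coset_reps N - {R0}. slash f R z)" if "Im z > 0" for z
    proof -
      have "slash f R0 z = slash f (G0 ** R0) z"
        using cusp_forms_slash_mult[OF f R0(1) _ that, of R0] coset_reps_det[OF R0(2)] by simp
      also have "\<dots> = f z" unfolding R0(3)[symmetric] by simp
      also have "\<dots> = nome 1 z ^ \<mu> * h1 (nome 1 z)"
        using h(3)[OF that] h1(2)[of "nome 1 z"] norm_nome_less_1[of 1 z] that by simp
      finally have "slash f R0 z = nome 1 z ^ \<mu> * h1 (nome 1 z)" .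
      moreover have "P z = slash f R0 z * (\<Prod>R\<in>coset_reps N - {R0}. slash f R z)"
        unfolding P_def norm_form_def using fin R0(2) by (rule prod.remove)
      ultimately show ?thesis by (simp add: G_def)
    qed
    have "norm (G z) \<le> C0 * (\<Prod>R\<in>coset_reps N - {R0}. K)" if z: "Im z \<ge> 1" for z
    proof -
      have "norm (h1 (nome 1 z)) \<le> C0" using z by (intro C0) (simp add: norm_nome)
      moreover have "norm (slash f R z) \<le> K" if "R \<in> coset_reps N" for R
      proof -
        have "norm (slash f R z) * 1 \<le> norm (slash f R z) * Im z" using z by (intro mult_left_mono) auto
        also have "\<dots> \<le> K" using K(2) coset_reps_SL2Z[OF that] z by auto
        finally show ?thesis by simp
      qed
      ultimately have "norm (h1 (nome 1 z)) * (\<Prod>R\<in>coset_reps N - {R0}. norm (slash f R z)) \<le> C0 * (\<Prod>R\<in>coset_reps N - {R0}. K)"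
        by (intro mult_mono prod_mono prod_nonneg) (auto intro: order_trans[OF norm_ge_zero])
      thus ?thesis using G_eq[of z] z by (simp add: norm_mult prod_norm)
    qed
    from periodic_holomorphic_nome[OF _ holG perG this] show ?thesis using that by auto
  qed
  have halve: "u z \<le> S / 2" if S: "\<And>z. Im z > 0 \<Longrightarrow> u z \<le> S" and z: "Im z > 0" for S z
  proof -
    obtain A where A: "A \<in> SL2Z" "frac_lin A z \<in> fundamental_domain" using fundamental_domain_covers[OF z] .
    define w where "w = frac_lin A z"
    define y where "y = Im w"
    have y: "y > 1 / 2" using fundamental_domainD(4)[OF A(2)] by (simp add: y_def w_def)
    have "u z \<ge> 0" using z by (simp add: u_def)
    hence S0: "S \<ge> 0" using S[OF z] by linarith
    \<comment> \<open>This radius belongs to height y / 2. Passing from there to height y costs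
      2^\<mu> through the power of the height and gains r^\<mu> through the zero, in total (2
      r)^\<mu>.\<close>
    define r where "r = exp (- pi * y)"
    have r: "0 < r" "r < 1" using y by (auto simp: r_def)
    define B where "B = S / ((y / 2) ^ \<mu> * r ^ \<mu>)"
    have "norm (k (nome 1 w)) \<le> B"
    proof (rule maximum_modulus_frontier[of k "cball 0 r"])
      show "k holomorphic_on interior (cball 0 r)"
        using r by (intro holomorphic_on_subset[OF k(1)]) auto
      show "continuous_on (closure (cball 0 r)) k"
        using r by (intro continuous_on_subset[OF holomorphic_on_imp_continuous_on[OF k(1)]]) auto
      show "nome 1 w \<in> cball 0 r" using y by (simp add: norm_nome r_def y_def)
      fix x :: complex assume "x \<in> frontier (cball 0 r)"
      hence x: "norm x = r" by simp
      have "x \<noteq> 0" "norm x < 1" using x r by auto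
      then obtain v where v: "Im v > 0" "nome 1 v = x" using nome_1_surj by blast
      have "exp (- 2 * pi * Im v) = exp (- pi * y)" using x norm_nome[of 1 v] by (simp add: v(2) r_def)
      hence Imv: "Im v = y / 2" by simp
      have "norm (k x) = norm (P v) / r ^ \<mu>"
        unfolding k(2)[OF v(1), unfolded v(2), symmetric] by (simp add: v(2) G_def norm_divide norm_power x)
      moreover have "norm (P v) * (y / 2) ^ \<mu> \<le> S" using S[OF v(1)] by (simp add: u_def Imv)
      hence "norm (P v) \<le> S / (y / 2) ^ \<mu>" using y by (simp add: pos_le_divide_eq)
      hence "norm (P v) / r ^ \<mu> \<le> S / (y / 2) ^ \<mu> / r ^ \<mu>" using r by (intro divide_right_mono) auto
      ultimately show "norm (k x) \<le> B" by (simp add: B_def)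
    qed auto
    moreover have Gw: "G w = k (nome 1 w)" using y by (intro k(2)) (simp add: y_def)
    ultimately have "norm (P w) / norm (nome 1 w) ^ \<mu> \<le> B"
      by (simp add: Gw[symmetric] G_def norm_divide norm_power)
    moreover have "norm (nome 1 w) = r ^ 2"
      by (simp add: norm_nome r_def y_def flip: exp_of_nat_mult)
    ultimately have "norm (P w) \<le> B * (r ^ 2) ^ \<mu>" using r by (simp add: divide_le_eq)
    hence "u w \<le> B * (r ^ 2) ^ \<mu> * y ^ \<mu>" unfolding u_def y_def[symmetric] using y by (intro mult_right_mono) auto
    also have "\<dots> = S * (2 * r) ^ \<mu>"
      using r y by (simp add: B_def power_divide power_mult_distrib field_simps power2_eq_square)
    also have "r \<le> exp (- pi / 2)" using y by (simp add: r_def)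
    hence "2 * r \<le> 1 / 2" using exp_neg_pi_half by linarith
    hence "(2 * r) ^ \<mu> \<le> (1 / 2) ^ \<mu>" using r by (intro power_mono) auto
    also have "\<dots> \<le> (1 / 2) ^ 1" using \<mu> by (intro power_decreasing) auto
    finally have "u w \<le> S * (1 / 2)" using S0 by (simp add: mult_left_mono)
    thus ?thesis using u_inv[OF A(1) z] by (simp add: w_def)
  qed
  have "u z \<le> K ^ \<mu> / 2 ^ n" if "Im z > 0" for z n
    using that
  proof (induction n arbitrary: z)
    case (Suc n)
    show ?case using halve[of "K ^ \<mu> / 2 ^ n" z] Suc by (simp add: field_simps)
  qed (use u_bdd in simp)
  moreover have "(\<lambda>n. K ^ \<mu> / 2 ^ n) \<longlonglongrightarrow> 0" by real_asymp
  ultimately have u0: "u z \<le> 0" if "Im z > 0" for z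
    using that by (intro LIMSEQ_le_const[of "\<lambda>n. K ^ \<mu> / 2 ^ n" 0 "u z"]) auto
  have P0: "P z = 0" if "Im z > 0" for z
    using u0[OF that] zero_less_power[OF that, of \<mu>] by (simp add: u_def mult_le_0_iff)
  \<comment> \<open>A vanishing product of holomorphic functions has a factor that vanishes
    identically; moving back by the inverse of R then kills f itself.\<close>
  have "\<exists>R\<in>coset_reps N. \<forall>z\<in>upper_half_plane. slash f R z = 0"
  proof (rule holomorphic_prod_eq_0[OF fin open_upper_half_plane connected_upper_half_plane])
    have "\<i> \<in> upper_half_plane" by (simp add: upper_half_plane_def)
    thus "upper_half_plane \<noteq> {}" by blast
  qed (use cusp_forms_slash_holomorphic[OF f] coset_reps_SL2Z P0 in \<open>auto simp: P_def norm_form_def upper_half_plane_def\<close>)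
  then obtain R where R: "R \<in> coset_reps N" "\<And>z. Im z > 0 \<Longrightarrow> slash f R z = 0"
    by (auto simp: upper_half_plane_def)
  note dR = coset_reps_det[OF R(1)]
  define v where "v = frac_lin (adj2 R) z"
  have v: "Im v > 0" "frac_lin R v = z"
    using dR z by (auto simp: v_def frac_lin_adj2 intro!: Im_frac_lin_pos)
  have "auto_factor R v \<noteq> 0" using dR v by (intro auto_factor_nonzero) auto
  thus ?thesis using R(2)[OF v(1)] by (simp add: slash_altdef v(2))
qed


section \<open>Twisting by functions of residues\<close>

definition unity_root :: "nat \<Rightarrow> nat \<Rightarrow> complex" where
  "unity_root m n = nome (real m) (of_nat n)"

lemma unity_root_eq_iff:
  assumes "m > 0"
  shows "unity_root m n = unity_root m k \<longleftrightarrow> [n = k] (mod m)"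
proof
  assume "unity_root m n = unity_root m k"
  then obtain j :: int where "(of_nat n :: complex) = of_nat k + of_int j * of_real (real m)"
    using assms unfolding unity_root_def by (auto elim!: nome_eqD[rotated])
  hence "(of_int (int n) :: complex) = of_int (int k + j * int m)" by simp
  hence "int n = int k + j * int m" by (simp only: of_int_eq_iff)
  hence "[int n = int k] (mod int m)" by (simp add: cong_def)
  thus "[n = k] (mod m)" by (simp add: cong_int_iff)
next
  assume *: "[n = k] (mod m)"
  have "nome m (of_nat x + of_nat (m * j)) = nome m (of_nat x)" for x j
  proof -
    have "2 * of_real pi * \<i> * (of_nat x + of_nat (m * j)) / of_real (real m) =
        2 * of_real pi * \<i> * of_nat x / of_real (real m) + (of_int (2 * int j) * pi) * \<i>"
      using assms by (simp add: field_simps)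
    thus ?thesis unfolding nome_def exp_eq by blast
  qed
  hence "unity_root m (x + m * j) = unity_root m x" for x j
    by (simp add: unity_root_def)
  hence "unity_root m n = unity_root m (n mod m)" "unity_root m k = unity_root m (k mod m)"
    by (metis mod_mult_div_eq)+
  thus "unity_root m n = unity_root m k" using * by (simp add: cong_def)
qed

lemma unity_root_add: "unity_root m (n + k) = unity_root m n * unity_root m k"
  by (simp add: unity_root_def nome_def add_divide_distrib distrib_left exp_add)

lemma unity_root_0 [simp]: "unity_root m 0 = 1"
  by (simp add: unity_root_def nome_def)

lemma unity_root_nonzero [simp]: "unity_root m n \<noteq> 0"
  by (simp add: unity_root_def)

lemma unity_root_mult: "unity_root m (n * k) = unity_root m n ^ k"
  by (induction k) (simp_all add: unity_root_add)

lemma sum_unity_root: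
  assumes "m > 0"
  shows "(\<Sum>u<m. unity_root m (n * u) / unity_root m (k * u)) = (if [n = k] (mod m) then of_nat m else 0)"
proof -
  define w where "w = unity_root m n / unity_root m k"
  have "(\<Sum>u<m. unity_root m (n * u) / unity_root m (k * u)) = (\<Sum>u<m. w ^ u)"
    by (simp add: w_def unity_root_mult power_divide)
  also have "\<dots> = (if [n = k] (mod m) then of_nat m else 0)"
  proof (cases "[n = k] (mod m)")
    case True
    hence "w = 1" using unity_root_eq_iff[OF assms] by (simp add: w_def)
    thus ?thesis using True by simp
  next
    case False
    hence "w \<noteq> 1" using unity_root_eq_iff[OF assms] by (simp add: w_def)
    moreover have "w ^ m = 1"
      using unity_root_eq_iff[OF assms, of "n * m" 0] unity_root_eq_iff[OF assms, of "k * m" 0]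
      by (simp add: w_def power_divide unity_root_mult cong_0_iff)
    ultimately show ?thesis using False by (simp add: geometric_sum)
  qed
  finally show ?thesis .
qed

text \<open>The finite Fourier transform of c modulo m. As c may be any function of residues, a
  character of smaller conductor than m is covered.\<close>

definition residue_coeff :: "nat \<Rightarrow> (nat \<Rightarrow> complex) \<Rightarrow> nat \<Rightarrow> complex" where
  "residue_coeff m c u = (\<Sum>r<m. c r / unity_root m (r * u)) / of_nat m"

definition residue_twist :: "nat \<Rightarrow> (nat \<Rightarrow> complex) \<Rightarrow> (complex \<Rightarrow> complex) \<Rightarrow> complex \<Rightarrow> complex" where
  "residue_twist m c f z = (\<Sum>u<m. residue_coeff m c u * f (z + of_nat u / of_nat m))"

lemma residue_coeff_inversion:
  assumes "m > 0" "c n = c (n mod m)"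
  shows "(\<Sum>u<m. residue_coeff m c u * unity_root m (n * u)) = c n"
proof -
  have "(\<Sum>u<m. residue_coeff m c u * unity_root m (n * u)) =
      (\<Sum>u<m. \<Sum>r<m. c r / of_nat m * (unity_root m (n * u) / unity_root m (r * u)))"
    unfolding residue_coeff_def sum_divide_distrib sum_distrib_right by (intro sum.cong refl) simp
  also have "\<dots> = (\<Sum>r<m. \<Sum>u<m. c r / of_nat m * (unity_root m (n * u) / unity_root m (r * u)))"
    by (rule sum.swap)
  also have "\<dots> = (\<Sum>r<m. c r / of_nat m * (if [n = r] (mod m) then of_nat m else 0))"
    unfolding sum_distrib_left[symmetric] sum_unity_root[OF assms(1)] ..
  also have "\<dots> = (\<Sum>r<m. if r = n mod m then c r else 0)"
    using assms(1) by (intro sum.cong refl) (auto simp: cong_def)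
  also have "\<dots> = c n" using assms by simp
  finally show ?thesis .
qed

lemma nome_1_shift: "nome 1 (z + of_nat u / of_nat m) = nome 1 z * unity_root m u"
  by (simp add: nome_def unity_root_def distrib_left exp_add)

lemma residue_twist_q_expansion:
  assumes "m > 0" "\<And>n. c n = c (n mod m)" "q_expansion f a"
  shows "q_expansion (residue_twist m c f) (\<lambda>n. c n * a n)"
  unfolding q_expansion_iff
proof (intro allI impI)
  fix z :: complex assume z: "Im z > 0"
  have "(\<lambda>n. \<Sum>u<m. residue_coeff m c u * (a n * nome 1 (z + of_nat u / of_nat m) ^ n)) sums residue_twist m c f z"
    unfolding residue_twist_def
  proof (intro sums_sum sums_mult)
    fix u
    have "Im (z + of_nat u / of_nat m) > 0" using z by (simp add: Im_divide_of_nat)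
    thus "(\<lambda>n. a n * nome 1 (z + of_nat u / of_nat m) ^ n) sums f (z + of_nat u / of_nat m)"
      using assms(3) by (simp add: q_expansion_iff)
  qed
  also have "(\<lambda>n. \<Sum>u<m. residue_coeff m c u * (a n * nome 1 (z + of_nat u / of_nat m) ^ n)) =
      (\<lambda>n. c n * a n * nome 1 z ^ n)"
  proof
    fix n
    have "(\<Sum>u<m. residue_coeff m c u * (a n * nome 1 (z + of_nat u / of_nat m) ^ n)) =
        (\<Sum>u<m. residue_coeff m c u * unity_root m (n * u)) * (a n * nome 1 z ^ n)"
      unfolding sum_distrib_right nome_1_shift power_mult_distrib
      by (intro sum.cong refl) (simp add: mult.commute[of n] unity_root_mult mult_ac)
    also have "(\<Sum>u<m. residue_coeff m c u * unity_root m (n * u)) = c n"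
      using assms(1,2) by (rule residue_coeff_inversion)
    finally show "(\<Sum>u<m. residue_coeff m c u * (a n * nome 1 (z + of_nat u / of_nat m) ^ n)) = c n * a n * nome 1 z ^ n"
      by (simp add: mult_ac)
  qed
  finally show "(\<lambda>n. c n * a n * nome 1 z ^ n) sums residue_twist m c f z" .
qed

lemma bij_betw_mult_mod:
  assumes "coprime v m" "m > (0 :: nat)"
  shows "bij_betw (\<lambda>u. (v * u) mod m) {..<m} {..<m}"
proof -
  have "inj_on (\<lambda>u. (v * u) mod m) {..<m}"
  proof (rule inj_onI)
    fix x y assume xy: "x \<in> {..<m}" "y \<in> {..<m}" "(v * x) mod m = (v * y) mod m"
    hence "[v * x = v * y] (mod m)" by (simp add: cong_def)
    hence "[x = y] (mod m)" using assms(1) by (simp add: cong_mult_lcancel_nat)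
    thus "x = y" using xy by (simp add: cong_def)
  qed
  moreover have "(\<lambda>u. (v * u) mod m) ` {..<m} \<subseteq> {..<m}" using assms(2) by auto
  ultimately show ?thesis by (simp add: bij_betw_def endo_inj_surj)
qed

text \<open>Invariance of c under the unit v passes to its Fourier transform by substituting v r for
  r. It is applied with a square in place of v.\<close>

lemma residue_coeff_mult:
  assumes "m > 0" "coprime v m" "\<And>n. c n = c (n mod m)" "\<And>n. c (v * n) = c n"
  shows "residue_coeff m c ((v * u) mod m) = residue_coeff m c u"
proof -
  have ur: "unity_root m x = unity_root m y" if "[x = y] (mod m)" for x y
    using unity_root_eq_iff[OF assms(1)] that by blast
  have "(\<Sum>r<m. c r / unity_root m (r * u)) = (\<Sum>r<m. c ((v * r) mod m) / unity_root m ((v * r) mod m * u))"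
    by (rule sum.reindex_bij_betw[OF bij_betw_mult_mod[OF assms(2,1)], symmetric])
  also have "\<dots> = (\<Sum>r<m. c r / unity_root m (r * ((v * u) mod m)))"
  proof (intro sum.cong refl)
    fix r
    have "[(v * r) mod m * u = r * ((v * u) mod m)] (mod m)"
      by (simp add: cong_def mod_simps mult_ac)
    thus "c ((v * r) mod m) / unity_root m ((v * r) mod m * u) = c r / unity_root m (r * ((v * u) mod m))"
      using ur assms(3)[of "v * r"] assms(4)[of r] by simp
  qed
  finally show ?thesis by (simp add: residue_coeff_def)
qed

text \<open>An upper triangular matrix fixes the cusp at infinity and sends large heights to large
  heights, so \<open>SL2Z_triangular\<close> reduces the claim to determinant 1.\<close>

lemma cusp_forms_slash_lim_det:
  assumes f: "f \<in> cusp_forms N" and B: "det B > 0"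
  shows "(slash f B \<longlongrightarrow> 0) (filtercomap Im at_top)"
proof -
  obtain G g t e where G: "G \<in> SL2Z" "g > 0" "e > 0" "B = G ** mat2 g t 0 e"
    using SL2Z_triangular[OF B] .
  have "filterlim (\<lambda>y. real_of_int g * y / real_of_int e) at_top at_top"
    using G(2,3) by real_asymp
  hence "filterlim (\<lambda>z. real_of_int g * Im z / real_of_int e) at_top (filtercomap Im at_top)"
    by (rule filterlim_filtercomapI)
  also have "(\<lambda>z. real_of_int g * Im z / real_of_int e) = (\<lambda>z. Im ((of_int g * z + of_int t) / of_int e))"
  proof
    fix z :: complex
    have "Im ((of_int g * z + of_int t) / of_real (real_of_int e)) = real_of_int g * Im z / real_of_int e"
      unfolding Im_divide_of_real by simp
    thus "real_of_int g * Im z / real_of_int e = Im ((of_int g * z + of_int t) / of_int e)" by simp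
  qed
  finally have "filterlim (\<lambda>z. (of_int g * z + of_int t) / of_int e) (filtercomap Im at_top) (filtercomap Im at_top)"
    unfolding filterlim_filtercomap_iff by (simp add: o_def)
  from filterlim_compose[OF cusp_forms_slash_lim[OF f G(1)] this]
  have "((\<lambda>z. slash f G ((of_int g * z + of_int t) / of_int e)) \<longlongrightarrow> 0) (filtercomap Im at_top)" .
  from tendsto_divide[OF this tendsto_const[of "of_int e ^ 2"]] G(3)
  have "((\<lambda>z. slash f G ((of_int g * z + of_int t) / of_int e) / of_int e ^ 2) \<longlongrightarrow> 0) (filtercomap Im at_top)" by simp
  moreover have "eventually (\<lambda>z. slash f G ((of_int g * z + of_int t) / of_int e) / of_int e ^ 2 = slash f B z) (filtercomap Im at_top)"
    unfolding eventually_filtercomap_at_top_linorder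
  proof (intro exI[of _ 1] allI impI)
    fix z :: complex assume "Im z \<ge> 1"
    hence "slash f B z = slash (slash f G) (mat2 g t 0 e) z"
      unfolding G(4) using G(1-3) by (intro slash_mult) (auto simp: SL2Z_iff)
    thus "slash f G ((of_int g * z + of_int t) / of_int e) / of_int e ^ 2 = slash f B z"
      by (simp add: slash_altdef[of "slash f G"] frac_lin_def auto_factor_def)
  qed
  ultimately show ?thesis by (rule Lim_transform_eventually)
qed

text \<open>With \<open>T u\<close> the translation by \<open>u / m\<close>, one has \<open>T u ** A = A' ** T u'\<close> for some \<open>A'\<close> in
  \<open>Gamma0 N\<close> and \<open>u' = d\<^sup>2 u\<close>, where \<open>d\<close> is the lower right entry of \<open>A\<close>.\<close>

theorem residue_twist_cusp_form:
  assumes f: "f \<in> cusp_forms N" and m: "m > 0" "m ^ 2 dvd N"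
    and per: "\<And>n. c n = c (n mod m)" and sq: "\<And>v n. coprime v m \<Longrightarrow> c (v ^ 2 * n) = c n"
  shows "residue_twist m c f \<in> cusp_forms N"
proof -
  define T where "T = (\<lambda>u :: nat. mat2 (int m) (int u) 0 (int m))"
  have dT: "det (T u) = int m ^ 2" "det (T u) > 0" for u using m(1) by (auto simp: T_def power2_eq_square)
  define tw where "tw = residue_twist m c f"
  have slash_T: "f (z + of_nat u / of_nat m) = of_nat m ^ 2 * slash f (T u) z" for z u
    using m(1) by (simp add: slash_altdef T_def frac_lin_def auto_factor_def add_divide_distrib)
  have tw_eq: "tw z = (\<Sum>u<m. residue_coeff m c u * of_nat m ^ 2 * slash f (T u) z)" for z
    by (simp add: tw_def residue_twist_def slash_T mult.assoc)
  have slash_tw: "slash tw A z = (\<Sum>u<m. residue_coeff m c u * of_nat m ^ 2 * slash f (T u ** A) z)"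
    if "det A > 0" "Im z > 0" for A z
  proof -
    have "slash tw A z = (\<Sum>u<m. residue_coeff m c u * of_nat m ^ 2 * slash (slash f (T u)) A z)"
      by (simp add: slash_altdef[of _ A] tw_eq sum_divide_distrib)
    thus ?thesis using that dT(2) by (simp add: slash_mult)
  qed
  have "tw holomorphic_on upper_half_plane"
    unfolding tw_eq[abs_def] using dT(2) cusp_forms_holomorphic[OF f]
    by (intro holomorphic_intros slash_holomorphic)
  moreover have "slash tw A z = tw z" if A: "A \<in> Gamma0 N" and z: "Im z > 0" for A z
  proof -
    define a b k d where "a = A $ 1 $ 1" and "b = A $ 1 $ 2" and "k = A $ 2 $ 1 div int m ^ 2" and "d = A $ 2 $ 2"
    have "int m ^ 2 dvd int N" using m(2) by (metis int_dvd_int_iff of_nat_power)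
    hence "int m ^ 2 dvd A $ 2 $ 1" using A by (auto simp: Gamma0_def intro: dvd_trans)
    hence k: "A $ 2 $ 1 = int m ^ 2 * k" by (simp add: k_def)
    have dA: "det A = 1" using A by (simp add: Gamma0_def SL2Z_iff)
    hence ad: "a * d - b * (int m ^ 2 * k) = 1" by (simp add: det_2 k a_def b_def d_def)
    \<comment> \<open>The symmetry of c is stated for natural numbers, so d is replaced by its
      residue.\<close>
    define v where "v = nat (d mod int m)"
    have v: "int v = d mod int m" using m(1) by (simp add: v_def)
    have "a * d + int m * (- b * int m * k) = 1" using ad by (simp add: power2_eq_square algebra_simps)
    hence "coprime d (int m)" by (metis coprimeI dvd_add dvd_mult dvd_mult2)
    hence "coprime (int v) (int m)" unfolding v by (simp add: coprime_mod_left_iff m(1) less_imp_neq[symmetric])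
    hence cop: "coprime v m" by simp
    define s where "s = (\<lambda>u. (v ^ 2 * u) mod m)"
    have shift: "slash f (T u ** A) z = slash f (T (s u)) z" for u
    proof -
      have "[int (s u) = int v ^ 2 * int u] (mod int m)"
        by (simp add: s_def cong_def of_nat_mod)
      also have "[int v ^ 2 * int u = d ^ 2 * int u] (mod int m)"
        by (intro cong_mult cong_pow cong_refl) (simp add: cong_def v)
      finally have "[int (s u) = d ^ 2 * int u] (mod int m)" .
      hence "[a * int (s u) = a * (d ^ 2 * int u)] (mod int m)" by (rule cong_scalar_left)
      also have "a * (d ^ 2 * int u) = (a * d) * (d * int u)" by (simp add: power2_eq_square)
      also have "[(a * d) * (d * int u) = 1 * (d * int u)] (mod int m)"
      proof (rule cong_scalar_right)
        have "a * d = 1 + int m * (b * int m * k)" using ad by (simp add: power2_eq_square algebra_simps)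
        thus "[a * d = 1] (mod int m)" by (simp add: cong_def)
      qed
      finally have "[a * int (s u) = d * int u] (mod int m)" by simp
      hence "int m dvd d * int u - a * int (s u)" by (metis cong_iff_dvd_diff cong_sym)
      then obtain j where "d * int u - a * int (s u) = int m * j" by (rule dvdE)
      hence j: "int u * d - a * int (s u) = int m * j" by (simp add: mult.commute)
      \<comment> \<open>This is \<open>T u ** A\<close> times the inverse of \<open>T (s u)\<close>
        as a map. Integrality of the entries rests on m^2 dividing the lower left entry of A and,
        for the upper right one, also on \<open>d * u\<close> being congruent to
        \<open>a * s u\<close> modulo m.\<close>
      define A' where "A' = mat2 (a + int u * int m * k) (b + j - int u * int (s u) * k) (int m ^ 2 * k) (d - int (s u) * int m * k)"
      have prod: "T u ** A = A' ** T (s u)"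
        unfolding mat2_eq_iff mat2_mult_nth T_def A'_def mat2_nth k a_def[symmetric] b_def[symmetric] d_def[symmetric]
        using j by (simp add: power2_eq_square algebra_simps)
      have "det A' * int m ^ 2 = 1 * int m ^ 2"
        using arg_cong[OF prod, of det] dA dT by (simp add: det_mult2)
      hence "det A' = 1" using m(1) by simp
      hence "A' \<in> Gamma0 N" using A by (simp add: Gamma0_def SL2Z_iff k A'_def)
      thus ?thesis unfolding prod by (intro cusp_forms_slash_mult[OF f]) (use dT z in auto)
    qed
    have "slash tw A z = (\<Sum>u<m. residue_coeff m c (s u) * of_nat m ^ 2 * slash f (T (s u)) z)"
    proof -
      have "residue_coeff m c (s u) = residue_coeff m c u" for u
        unfolding s_def using cop by (intro residue_coeff_mult m(1) per sq) auto
      thus ?thesis using slash_tw[of A z] dA z by (simp add: shift)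
    qed
    also have "\<dots> = tw z"
      unfolding tw_eq s_def using cop m(1) by (intro sum.reindex_bij_betw bij_betw_mult_mod) auto
    finally show ?thesis .
  qed
  moreover have "(slash tw A \<longlongrightarrow> 0) (filtercomap Im at_top)" if A: "A \<in> SL2Z" for A
  proof -
    have dA: "det A = 1" using A by (simp add: SL2Z_iff)
    have "((\<lambda>z. \<Sum>u<m. residue_coeff m c u * of_nat m ^ 2 * slash f (T u ** A) z) \<longlongrightarrow> (\<Sum>u<m. residue_coeff m c u * of_nat m ^ 2 * 0)) (filtercomap Im at_top)"
      using dT dA by (intro tendsto_sum tendsto_mult tendsto_const cusp_forms_slash_lim_det[OF f]) (simp add: det_mult2)
    hence "((\<lambda>z. \<Sum>u<m. residue_coeff m c u * of_nat m ^ 2 * slash f (T u ** A) z) \<longlongrightarrow> 0) (filtercomap Im at_top)" by simp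
    moreover have "eventually (\<lambda>z. (\<Sum>u<m. residue_coeff m c u * of_nat m ^ 2 * slash f (T u ** A) z) = slash tw A z) (filtercomap Im at_top)"
      unfolding eventually_filtercomap_at_top_linorder using slash_tw dA by (intro exI[of _ 1]) auto
    ultimately show ?thesis by (rule Lim_transform_eventually)
  qed
  ultimately show ?thesis unfolding cusp_forms_def tw_def by (auto simp: upper_half_plane_def)
qed


section \<open>Coefficients of newforms\<close>

lemma nome_1_div: "nome 1 ((z + of_nat b) / of_nat p) = nome (real p) z * unity_root p b"
  by (simp add: nome_def unity_root_def add_divide_distrib distrib_left exp_add)

lemma nome_power: "p > 0 \<Longrightarrow> nome (real p) z ^ p = nome 1 z"
  by (simp add: nome_def flip: exp_of_nat_mult)

lemma nome_1_mult: "nome 1 (of_nat p * z) = nome 1 z ^ p"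
  by (simp add: nome_def mult_ac flip: exp_of_nat_mult)

lemma strict_mono_mult_nat: "p > (0 :: nat) \<Longrightarrow> strict_mono ((*) p)"
  by (simp add: strict_mono_def)

text \<open>Summing over b modulo p kills the terms whose index is prime to p, by orthogonality of
  roots of unity, and the rest is reindexed along multiples of p. The second term belongs to the
  divisor e = 1, present only if p does not divide N.\<close>

lemma hecke_q_expansion:
  assumes p: "prime p" and f: "q_expansion f a"
  shows "q_expansion (hecke N p f)
    (\<lambda>n. a (p * n) + (if \<not> p dvd N \<and> p dvd n then of_nat p * a (n div p) else 0))"
  unfolding q_expansion_iff
proof (intro allI impI)
  fix z :: complex assume z: "Im z > 0"
  have p0: "p > 0" and p1: "p > 1" using p by (rule prime_gt_0_nat, rule prime_gt_1_nat)
  have "(\<lambda>n. \<Sum>b<p. of_nat p / of_nat p ^ 2 * (a n * nome 1 ((z + of_nat b) / of_nat p) ^ n)) sums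
      (\<Sum>b<p. of_nat p / of_nat p ^ 2 * f ((z + of_nat b) / of_nat p))"
  proof (intro sums_sum sums_mult)
    fix b
    have "Im ((z + of_nat b) / of_nat p) > 0" using z p0 by (simp add: Im_divide_of_nat)
    thus "(\<lambda>n. a n * nome 1 ((z + of_nat b) / of_nat p) ^ n) sums f ((z + of_nat b) / of_nat p)"
      using f by (simp add: q_expansion_iff)
  qed
  also have "(\<lambda>n. \<Sum>b<p. of_nat p / of_nat p ^ 2 * (a n * nome 1 ((z + of_nat b) / of_nat p) ^ n)) =
      (\<lambda>n. if p dvd n then a n * nome p z ^ n else 0)"
  proof
    fix n
    have "(\<Sum>b<p. of_nat p / of_nat p ^ 2 * (a n * nome 1 ((z + of_nat b) / of_nat p) ^ n)) =
        a n * nome p z ^ n / of_nat p * (\<Sum>b<p. unity_root p (n * b) / unity_root p (0 * b))"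
      unfolding sum_distrib_left nome_1_div power_mult_distrib
      by (intro sum.cong refl) (simp add: power2_eq_square mult.commute[of n] unity_root_mult)
    also have "\<dots> = (if p dvd n then a n * nome p z ^ n else 0)"
      unfolding sum_unity_root[OF p0] using p0 by (simp add: cong_0_iff)
    finally show "(\<Sum>b<p. of_nat p / of_nat p ^ 2 * (a n * nome 1 ((z + of_nat b) / of_nat p) ^ n)) =
        (if p dvd n then a n * nome p z ^ n else 0)" .
  qed
  finally have "(\<lambda>n. if p dvd p * n then a (p * n) * nome p z ^ (p * n) else 0) sums
      (\<Sum>b<p. of_nat p / of_nat p ^ 2 * f ((z + of_nat b) / of_nat p))"
    by (subst sums_mono_reindex[OF strict_mono_mult_nat[OF p0]]) (auto elim: dvdE)
  hence U: "(\<lambda>n. a (p * n) * nome 1 z ^ n) sums (\<Sum>b<p. of_nat p / of_nat p ^ 2 * f ((z + of_nat b) / of_nat p))"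
    using p0 by (simp add: power_mult nome_power)
  show "(\<lambda>n. (a (p * n) + (if \<not> p dvd N \<and> p dvd n then of_nat p * a (n div p) else 0)) * nome 1 z ^ n) sums hecke N p f z"
  proof (cases "p dvd N")
    case True
    hence "hecke N p f z = (\<Sum>b<p. of_nat p / of_nat p ^ 2 * f ((z + of_nat b) / of_nat p))"
      unfolding hecke_def hecke_divisors[OF p] using p0 by simp
    thus ?thesis using U True by simp
  next
    case False
    have hk: "hecke N p f z = (\<Sum>b<p. of_nat p / of_nat p ^ 2 * f ((z + of_nat b) / of_nat p)) + of_nat p * f (of_nat p * z)"
      unfolding hecke_def hecke_divisors[OF p] using False p1 by simp
    have "(\<lambda>n. of_nat p * (a n * nome 1 (of_nat p * z) ^ n)) sums (of_nat p * f (of_nat p * z))"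
      using f z p0 by (intro sums_mult) (simp add: q_expansion_iff)
    hence "(\<lambda>n. if p dvd p * n then of_nat p * a (p * n div p) * nome 1 z ^ (p * n) else 0) sums (of_nat p * f (of_nat p * z))"
      using p0 by (simp add: nome_1_mult power_mult mult.assoc)
    hence "(\<lambda>n. if p dvd n then of_nat p * a (n div p) * nome 1 z ^ n else 0) sums (of_nat p * f (of_nat p * z))"
      by (subst (asm) sums_mono_reindex[OF strict_mono_mult_nat[OF p0],
            where f = "\<lambda>n. if p dvd n then of_nat p * a (n div p) * nome 1 z ^ n else 0"]) (auto elim: dvdE)
    note sums_add[OF U this]
    also have "(\<lambda>n. a (p * n) * nome 1 z ^ n + (if p dvd n then of_nat p * a (n div p) * nome 1 z ^ n else 0)) =
        (\<lambda>n. (a (p * n) + (if \<not> p dvd N \<and> p dvd n then of_nat p * a (n div p) else 0)) * nome 1 z ^ n)"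
      using False by (simp add: fun_eq_iff distrib_right)
    finally show ?thesis unfolding hk .
  qed
qed

lemma q_expansion_cmult: "q_expansion f a \<Longrightarrow> q_expansion (\<lambda>z. c * f z) (\<lambda>n. c * a n)"
  unfolding q_expansion_iff by (auto simp: mult.assoc intro: sums_mult)

lemma q_expansion_cong: "q_expansion f a \<Longrightarrow> (\<And>z. Im z > 0 \<Longrightarrow> f z = g z) \<Longrightarrow> q_expansion g a"
  by (simp add: q_expansion_iff)

lemma q_expansion_eqD: "q_expansion f a \<Longrightarrow> q_expansion g a \<Longrightarrow> Im z > 0 \<Longrightarrow> f z = g z"
  unfolding q_expansion_iff using sums_unique2 by blast

text \<open>Comparing coefficients at 1 identifies the eigenvalue as \<open>a p\<close>; the other
  coefficients then give the recursion, at good and bad primes alike.\<close>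

lemma newform_coeffs:
  assumes "newform N f" "q_expansion f a"
  shows "a 0 = 0" "a 1 = 1"
    and "prime p \<Longrightarrow> a p * a n = a (p * n) + (if \<not> p dvd N \<and> p dvd n then of_nat p * a (n div p) else 0)"
    and "prime p \<Longrightarrow> Im z > 0 \<Longrightarrow> hecke N p f z = a p * f z"
proof -
  have cf: "f \<in> cusp_forms N" using assms(1) by (simp add: newform_def)
  have "(slash f (mat 1) \<longlongrightarrow> 0) (filtercomap Im at_top)" using cf by (rule cusp_forms_slash_lim) simp
  thus "a 0 = 0" using q_expansion_0_eq_limit[OF assms(2)] by simp
  obtain a' where "q_expansion f a'" "a' 1 = 1" using assms(1) by (auto simp: newform_def)
  thus a1: "a 1 = 1" using q_expansion_unique assms(2) by blast
  have main: "a p * a n = a (p * n) + (if \<not> p dvd N \<and> p dvd n then of_nat p * a (n div p) else 0) \<and>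
      (Im z > 0 \<longrightarrow> hecke N p f z = a p * f z)" if p: "prime p" for p n z
  proof -
    have p1: "p > 1" using p by (rule prime_gt_1_nat)
    hence "\<exists>c. \<forall>z\<in>upper_half_plane. hecke N p f z = c * f z" using assms(1) by (simp add: newform_def)
    then obtain c where c: "\<And>z. Im z > 0 \<Longrightarrow> hecke N p f z = c * f z" by (auto simp: upper_half_plane_def)
    have "q_expansion (hecke N p f) (\<lambda>n. c * a n)"
      by (rule q_expansion_cong[OF q_expansion_cmult[OF assms(2)]]) (simp add: c)
    from q_expansion_unique[OF this hecke_q_expansion[OF p assms(2)]]
    have eq: "c * a n = a (p * n) + (if \<not> p dvd N \<and> p dvd n then of_nat p * a (n div p) else 0)" for n
      by (rule fun_cong)
    from eq[of 1] have "c = a p" using p1 by (simp add: a1[simplified])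
    thus ?thesis using eq c by blast
  qed
  show "prime p \<Longrightarrow> a p * a n = a (p * n) + (if \<not> p dvd N \<and> p dvd n then of_nat p * a (n div p) else 0)"
    "prime p \<Longrightarrow> Im z > 0 \<Longrightarrow> hecke N p f z = a p * f z" using main by blast+
qed

text \<open>The recursion at p k leads back to \<open>a p\<close> and to smaller indices, so
  integrality of the prime coefficients, which will be Frobenius traces, spreads to all.\<close>

lemma hecke_recursion_integral:
  fixes a :: "nat \<Rightarrow> complex" and t :: "nat \<Rightarrow> int"
  assumes "a 0 = 0" "a 1 = 1"
    and rec: "\<And>p n. prime p \<Longrightarrow> a p * a n = a (p * n) + (if \<not> p dvd N \<and> p dvd n then of_nat p * a (n div p) else 0)"
    and t: "\<And>p. prime p \<Longrightarrow> a p = of_int (t p)"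
  obtains b :: "nat \<Rightarrow> int" where "a = (\<lambda>n. of_int (b n))"
proof -
  have "a n \<in> \<int>" for n
  proof (induction n rule: less_induct)
    case (less n)
    show ?case
    proof (cases "n \<le> 1")
      case True
      hence "n = 0 \<or> n = 1" by auto
      thus ?thesis using assms(1,2) by auto
    next
      case False
      then obtain p k where p: "prime p" "n = p * k" by (metis dvdE prime_factor_nat nat_le_linear)
      have "k > 0" using False p(2) by (cases k) auto
      moreover from this have "k < n" using p prime_gt_1_nat[OF p(1)] by simp
      ultimately have k: "k > 0" "k < n" .
      have "k div p < n" using k div_le_dividend le_less_trans by blast
      hence "of_int (t p) * a k - (if \<not> p dvd N \<and> p dvd k then of_nat p * a (k div p) else 0) \<in> \<int>"
        using less k by auto
      also have "of_int (t p) * a k - (if \<not> p dvd N \<and> p dvd k then of_nat p * a (k div p) else 0) = a n"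
        using rec[OF p(1), of k] t[OF p(1)] p(2) by simp
      finally show ?thesis .
    qed
  qed
  hence "\<forall>n. \<exists>k. a n = of_int k" by (auto elim!: Ints_cases)
  then obtain b where "\<And>n. a n = of_int (b n)" by metis
  thus ?thesis using that by blast
qed

text \<open>If \<open>ch\<close> is -1 at p k, it is -1 at p or at k; and if p divides k, it is -1
  at k / p as well, because \<open>ch p\<close> squares to 1. Both terms of the recursion are thus
  divisible by 4.\<close>

lemma hecke_recursion_dvd_4:
  fixes b :: "nat \<Rightarrow> int" and ch :: "nat \<Rightarrow> int"
  assumes "b 0 = 0"
    and rec: "\<And>p n. prime p \<Longrightarrow> b p * b n = b (p * n) + (if \<not> p dvd N \<and> p dvd n then int p * b (n div p) else 0)"
    and mult: "\<And>m n. ch (m * n) = ch m * ch n" and chi1: "ch 1 = 1" and range: "\<And>n. ch n \<in> {-1, 0, 1}"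
    and four: "\<And>p. prime p \<Longrightarrow> ch p = -1 \<Longrightarrow> 4 dvd b p"
  shows "ch n = -1 \<Longrightarrow> 4 dvd b n"
proof (induction n rule: less_induct)
  case (less n)
  show ?case
  proof (cases "n \<le> 1")
    case True
    hence "n = 0 \<or> n = 1" by auto
    thus ?thesis using assms(1) less.prems chi1 by auto
  next
    case False
    then obtain p k where p: "prime p" "n = p * k" by (metis dvdE prime_factor_nat nat_le_linear)
    have "k > 0" using False p(2) by (cases k) auto
      moreover from this have "k < n" using p prime_gt_1_nat[OF p(1)] by simp
      ultimately have k: "k > 0" "k < n" .
    have nz: "ch p \<noteq> 0" "ch p * ch k = -1" using less.prems p mult by auto
    have "4 dvd b p * b k"
    proof (cases "ch p = -1")
      case True
      thus ?thesis using four[OF p(1)] by simp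
    next
      case False
      hence "ch p = 1" using nz range[of p] by auto
      hence "ch k = -1" using nz by simp
      thus ?thesis using less.IH[OF k(2)] by simp
    qed
    moreover have "4 dvd b (k div p)" if "p dvd k"
    proof -
      have "k = p * (k div p)" using that by simp
      hence "ch n = ch p * ch p * ch (k div p)" using p(2) mult by (metis mult.assoc)
      moreover have "ch p * ch p = 1" using nz(1) range[of p] by auto
      ultimately have "ch (k div p) = -1" using less.prems by simp
      moreover have "k div p < n" using k div_le_dividend le_less_trans by blast
      ultimately show ?thesis using less.IH by blast
    qed
    moreover have "b n = b p * b k - (if \<not> p dvd N \<and> p dvd k then int p * b (k div p) else 0)"
      using rec[OF p(1), of k] p(2) by simp
    ultimately show ?thesis by auto
  qed
qed

text \<open>Complete multiplicativity and \<open>ch q ^ 2 = 1\<close> let \<open>ch q * ch n\<close>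
  be pulled out of both terms of the recursion.\<close>

lemma hecke_twist:
  fixes ch :: "nat \<Rightarrow> complex"
  assumes q: "prime q" "\<not> q dvd N"
    and rec: "\<And>n. a q * a n = a (q * n) + (if \<not> q dvd N \<and> q dvd n then of_nat q * a (n div q) else 0)"
    and mult: "\<And>m n. ch (m * n) = ch m * ch n" and sq: "ch q ^ 2 = 1"
    and g: "q_expansion g (\<lambda>n. ch n * a n)" and z: "Im z > 0"
  shows "hecke N q g z = (ch q * a q) * g z"
proof (rule q_expansion_eqD[OF _ q_expansion_cmult[OF g] z])
  have "(\<lambda>n. ch (q * n) * a (q * n) + (if \<not> q dvd N \<and> q dvd n then of_nat q * (ch (n div q) * a (n div q)) else 0)) =
      (\<lambda>n. ch q * a q * (ch n * a n))"
  proof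
    fix n
    have "ch (n div q) = ch q * ch n" if "q dvd n"
    proof -
      have "ch n = ch q * ch (n div q)" using that mult by (metis dvd_mult_div_cancel)
      thus ?thesis using sq by (simp add: power2_eq_square flip: mult.assoc)
    qed
    hence "ch (q * n) * a (q * n) + (if \<not> q dvd N \<and> q dvd n then of_nat q * (ch (n div q) * a (n div q)) else 0) =
        ch q * ch n * (a (q * n) + (if \<not> q dvd N \<and> q dvd n then of_nat q * a (n div q) else 0))"
      by (simp add: mult distrib_left)
    thus "ch (q * n) * a (q * n) + (if \<not> q dvd N \<and> q dvd n then of_nat q * (ch (n div q) * a (n div q)) else 0) =
        ch q * a q * (ch n * a n)" by (simp flip: rec)
  qed
  thus "q_expansion (hecke N q g) (\<lambda>n. ch q * a q * (ch n * a n))"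
    using hecke_q_expansion[OF q(1) g, of N] by simp
qed


section \<open>Quartic character sums\<close>

lemma Legendre_range: "Legendre a p \<in> {-1, 0, 1}"
  by (simp add: Legendre_def)

lemma Legendre_cong:
  assumes "[a = b] (mod p)"
  shows "Legendre a p = Legendre b p"
proof -
  have "[a = 0] (mod p) \<longleftrightarrow> [b = 0] (mod p)" "[y\<^sup>2 = a] (mod p) \<longleftrightarrow> [y\<^sup>2 = b] (mod p)" for y
    using assms cong_trans cong_sym by blast+
  thus ?thesis by (simp add: Legendre_def QuadRes_def)
qed

lemma Legendre_eq_0_iff: "Legendre a p = 0 \<longleftrightarrow> p dvd a"
  by (simp add: Legendre_def cong_0_iff)

text \<open>It turns the congruences of Euler's criterion into equalities, as -1, 0 and 1 are
  incongruent modulo every p > 2.\<close>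

lemma small_cong_eq:
  fixes a b p :: int
  assumes "[a = b] (mod p)" "a \<in> {-1, 0, 1}" "b \<in> {-1, 0, 1}" "p > 2"
  shows "a = b"
proof -
  have "p dvd a - b" using assms(1) by (simp add: cong_iff_dvd_diff)
  moreover have "\<bar>a - b\<bar> < p" using assms(2-4) by auto
  ultimately show ?thesis using dvd_imp_le_int[of "a - b" p] by fastforce
qed

lemma Legendre_mult:
  assumes "prime p" "p > (2 :: nat)"
  shows "Legendre (a * b) p = Legendre a p * Legendre b p"
proof (rule small_cong_eq[of _ _ "int p"])
  have "[Legendre (a * b) p = (a * b) ^ ((p - 1) div 2)] (mod int p)"
    by (rule euler_criterion[OF assms])
  also have "(a * b) ^ ((p - 1) div 2) = a ^ ((p - 1) div 2) * b ^ ((p - 1) div 2)"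
    by (rule power_mult_distrib)
  also have "[\<dots> = Legendre a p * Legendre b p] (mod int p)"
    using euler_criterion[OF assms, of a] euler_criterion[OF assms, of b] by (intro cong_mult) (simp_all add: cong_sym)
  finally show "[Legendre (a * b) p = Legendre a p * Legendre b p] (mod int p)" .
  show "Legendre a p * Legendre b p \<in> {-1, 0, 1}"
    using Legendre_range[of a p] Legendre_range[of b p] by auto
qed (use assms Legendre_range in auto)

lemma Legendre_square:
  assumes "prime p" "p > (2 :: nat)" "\<not> int p dvd a"
  shows "Legendre (a\<^sup>2) p = 1"
proof -
  have "Legendre (a\<^sup>2) p = Legendre a p * Legendre a p" by (simp add: power2_eq_square Legendre_mult[OF assms(1,2)])
  moreover have "Legendre a p \<noteq> 0" using assms(3) by (simp add: Legendre_eq_0_iff)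
  ultimately show ?thesis using Legendre_range[of a p] by auto
qed

lemma Legendre_minus_1:
  assumes "prime p" "p > (2 :: nat)"
  shows "Legendre (-1) p = (if p mod 4 = 1 then 1 else -1)"
proof (rule small_cong_eq[of _ _ "int p"])
  have odd: "odd p" using assms prime_odd_nat by auto
  have "even ((p - 1) div 2) \<longleftrightarrow> p mod 4 = 1" using odd by presburger
  hence "(- 1 :: int) ^ ((p - 1) div 2) = (if p mod 4 = 1 then 1 else -1)"
    by (metis (full_types) neg_one_even_power neg_one_odd_power)
  thus "[Legendre (-1) p = (if p mod 4 = 1 then 1 else -1)] (mod int p)"
    using euler_criterion[OF assms, of "-1"] by simp
qed (use assms Legendre_range in auto)

lemma card_square_roots:
  assumes "prime p" "p > (2 :: nat)"
  shows "int (card {y \<in> {0..<int p}. [y\<^sup>2 = k] (mod int p)}) = 1 + Legendre k p"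
proof -
  have pp: "prime (int p)" using assms by simp
  have p0: "int p > 0" using assms by simp
  have odd: "\<not> int p dvd 2"
  proof
    assume "int p dvd 2"
    hence "int p \<le> 2" by (rule zdvd_imp_le) simp
    thus False using assms by simp
  qed
  consider "int p dvd k" | "\<not> int p dvd k" "QuadRes p k" | "\<not> int p dvd k" "\<not> QuadRes p k" by blast
  thus ?thesis
  proof cases
    case 1
    have "[y\<^sup>2 = k] (mod int p) \<longleftrightarrow> y = 0" if "y \<in> {0..<int p}" for y
    proof -
      have "[y\<^sup>2 = k] (mod int p) \<longleftrightarrow> int p dvd y\<^sup>2" using 1 by (meson cong_dvd_iff cong_iff_dvd_diff dvd_diff)
      also have "\<dots> \<longleftrightarrow> int p dvd y" using pp by (simp add: prime_dvd_power_iff)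
      also have "\<dots> \<longleftrightarrow> y = 0" using that by (auto dest: zdvd_imp_le)
      finally show ?thesis .
    qed
    hence "{y \<in> {0..<int p}. [y\<^sup>2 = k] (mod int p)} = {0}" using p0 1 by (auto simp: cong_0_iff cong_sym_eq[of 0])
    thus ?thesis using 1 Legendre_eq_0_iff[of k p] by simp
  next
    case 2
    then obtain z where z: "[z\<^sup>2 = k] (mod int p)" by (auto simp: QuadRes_def)
    have nz: "\<not> int p dvd z" using 2(1) z by (metis cong_dvd_iff dvd_power pos2 dvd_trans)
    have "{y \<in> {0..<int p}. [y\<^sup>2 = k] (mod int p)} = {z mod int p, (- z) mod int p}"
    proof (intro subset_antisym subsetI)
      fix y assume "y \<in> {y \<in> {0..<int p}. [y\<^sup>2 = k] (mod int p)}"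
      hence y: "0 \<le> y" "y < int p" "[y\<^sup>2 = z\<^sup>2] (mod int p)" using cong_trans[OF _ cong_sym[OF z]] by auto
      hence "int p dvd (y - z) * (y + z)" by (simp add: cong_iff_dvd_diff power2_eq_square algebra_simps)
      hence "int p dvd y - z \<or> int p dvd y - (- z)" using pp by (simp add: prime_dvd_mult_iff)
      hence "[y = z] (mod int p) \<or> [y = - z] (mod int p)" by (simp add: cong_iff_dvd_diff)
      thus "y \<in> {z mod int p, (- z) mod int p}" using y by (auto simp: cong_def)
    next
      fix y assume "y \<in> {z mod int p, (- z) mod int p}"
      hence "y \<in> {0..<int p}" "[y = z] (mod int p) \<or> [y = - z] (mod int p)" using p0 by (auto simp: cong_def)
      moreover from this(2) have "[y\<^sup>2 = z\<^sup>2] (mod int p)" using cong_pow[of y z "int p" 2] cong_pow[of y "- z" "int p" 2] by auto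
      ultimately show "y \<in> {y \<in> {0..<int p}. [y\<^sup>2 = k] (mod int p)}" using z cong_trans by blast
    qed
    moreover have "z mod int p \<noteq> (- z) mod int p"
    proof
      assume "z mod int p = (- z) mod int p"
      hence "int p dvd z - (- z)" by (simp only: mod_eq_dvd_iff)
      hence "int p dvd 2 * z" by simp
      thus False using pp odd nz by (simp add: prime_dvd_mult_iff)
    qed
    ultimately show ?thesis using 2 by (simp add: Legendre_def cong_0_iff)
  next
    case 3
    hence "{y \<in> {0..<int p}. [y\<^sup>2 = k] (mod int p)} = {}" by (auto simp: QuadRes_def)
    moreover have "Legendre k p = -1" using 3 by (simp add: Legendre_def cong_0_iff)
    ultimately show ?thesis by (simp only: card.empty)
  qed
qed

lemma sum_affine_mod:
  fixes F :: "int \<Rightarrow> 'a::comm_monoid_add" and p a b :: int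
  assumes "p > 0" "coprime a p" "\<And>x y. [x = y] (mod p) \<Longrightarrow> F x = F y"
  shows "(\<Sum>x\<in>{0..<p}. F (a * x + b)) = (\<Sum>x\<in>{0..<p}. F x)"
proof -
  have "inj_on (\<lambda>x. (a * x + b) mod p) {0..<p}"
  proof (rule inj_onI)
    fix x y assume xy: "x \<in> {0..<p}" "y \<in> {0..<p}" "(a * x + b) mod p = (a * y + b) mod p"
    hence "[a * x + b = a * y + b] (mod p)" by (simp add: cong_def)
    hence "[a * x = a * y] (mod p)" by (simp add: cong_add_rcancel)
    hence "[x = y] (mod p)" using assms(2) by (simp add: cong_mult_lcancel)
    thus "x = y" using xy by (simp add: cong_def)
  qed
  moreover have "(\<lambda>x. (a * x + b) mod p) ` {0..<p} \<subseteq> {0..<p}" using assms(1) by auto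
  ultimately have bij: "bij_betw (\<lambda>x. (a * x + b) mod p) {0..<p} {0..<p}"
    by (simp add: bij_betw_def endo_inj_surj)
  have "(\<Sum>x\<in>{0..<p}. F (a * x + b)) = (\<Sum>x\<in>{0..<p}. F ((a * x + b) mod p))"
    by (intro sum.cong refl assms(3)) (simp add: cong_def)
  also have "\<dots> = (\<Sum>x\<in>{0..<p}. F x)" by (rule sum.reindex_bij_betw[OF bij])
  finally show ?thesis .
qed

text \<open>Count the residues y according to their squares.\<close>

lemma sum_Legendre:
  assumes "prime p" "p > (2 :: nat)"
  shows "(\<Sum>x\<in>{0..<int p}. Legendre x p) = 0"
proof -
  have "(\<Sum>x\<in>{0..<int p}. 1 + Legendre x p) = (\<Sum>x\<in>{0..<int p}. int (card {y \<in> {0..<int p}. y\<^sup>2 mod int p = x}))"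
    by (intro sum.cong refl, subst card_square_roots[OF assms, symmetric]) (auto simp: cong_def intro!: arg_cong[of _ _ card])
  also have "\<dots> = int (card (\<Union>x\<in>{0..<int p}. {y \<in> {0..<int p}. y\<^sup>2 mod int p = x}))"
    by (subst card_UN_disjoint) (auto intro: finite_subset[of _ "{0..<int p}"])
  also have "(\<Union>x\<in>{0..<int p}. {y \<in> {0..<int p}. y\<^sup>2 mod int p = x}) = {0..<int p}"
    using assms by auto
  finally show ?thesis using assms by (simp add: sum.distrib)
qed

text \<open>At an odd prime p this is minus the Frobenius trace of y^2 = x^3 - M x, a quartic twist
  of y^2 = x^3 - x; see \<open>frobenius_trace_quartic\<close>.\<close>

definition quartic_sum :: "int \<Rightarrow> nat \<Rightarrow> int" where
  "quartic_sum M p = (\<Sum>x\<in>{0..<int p}. Legendre (x ^ 3 - M * x) p)"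

lemma cubic_cong: "[x = y] (mod p) \<Longrightarrow> [x ^ 3 - M * x = y ^ 3 - M * y] (mod (p :: int))"
  by (intro cong_diff cong_pow cong_mult cong_refl)

text \<open>Modulo p the cubic is x^3, whose symbol equals that of x. This is the vanishing of a_p
  at an odd prime of additive reduction.\<close>

lemma quartic_sum_dvd:
  assumes "prime p" "p > (2 :: nat)" "int p dvd M"
  shows "quartic_sum M p = 0"
proof -
  have "Legendre (x ^ 3 - M * x) p = Legendre x p" for x
  proof -
    have "[x ^ 3 - M * x = x ^ 3] (mod int p)" using assms(3) by (simp add: cong_iff_dvd_diff)
    hence "Legendre (x ^ 3 - M * x) p = Legendre (x ^ 3) p" by (rule Legendre_cong)
    also have "\<dots> = Legendre x p * (Legendre x p * Legendre x p)"
      by (simp add: power3_eq_cube Legendre_mult[OF assms(1,2)])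
    also have "\<dots> = Legendre x p" using Legendre_range[of x p] by auto
    finally show ?thesis .
  qed
  thus ?thesis by (simp add: quartic_sum_def sum_Legendre[OF assms(1,2)])
qed

lemma Legendre_cubic_minus:
  assumes "prime p" "p > (2 :: nat)"
  shows "Legendre ((- x) ^ 3 - M * (- x)) p = Legendre (-1) p * Legendre (x ^ 3 - M * x) p"
proof -
  have "(- x) ^ 3 - M * (- x) = (-1) * (x ^ 3 - M * x)" by (simp add: power3_eq_cube)
  thus ?thesis by (simp only: Legendre_mult[OF assms])
qed

lemma quartic_sum_3_mod_4:
  assumes "prime p" "p mod 4 = 3"
  shows "quartic_sum M p = 0"
proof -
  have p2: "p > 2" using assms(2) by presburger
  have "quartic_sum M p = (\<Sum>x\<in>{0..<int p}. Legendre ((-1 * x + 0) ^ 3 - M * (-1 * x + 0)) p)"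
    unfolding quartic_sum_def using p2
    by (intro sum_affine_mod[symmetric, where F = "\<lambda>x. Legendre (x ^ 3 - M * x) p"] Legendre_cong cubic_cong) auto
  also have "Legendre ((-1 * x + 0) ^ 3 - M * (-1 * x + 0)) p = - Legendre (x ^ 3 - M * x) p" for x
    using Legendre_cubic_minus[OF assms(1) p2, of x M] Legendre_minus_1[OF assms(1) p2] assms(2) by simp
  hence "(\<Sum>x\<in>{0..<int p}. Legendre ((-1 * x + 0) ^ 3 - M * (-1 * x + 0)) p) = - quartic_sum M p"
    by (simp only: quartic_sum_def sum_negf)
  finally show ?thesis by simp
qed

text \<open>As -1 is a square, x and -x give equal terms, which yields one factor 2. As M is not a
  square, x (x^2 - M) vanishes only at x = 0, so each half consists of (p - 1) / 2 odd terms, an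
  even number of them.\<close>

lemma quartic_sum_4_dvd:
  assumes "prime p" "p mod 4 = 1" "Legendre M p = -1"
  shows "4 dvd quartic_sum M p"
proof -
  have p2: "p > 2" using assms(1,2) prime_ge_2_nat[OF assms(1)] by presburger
  define k where "k = (int p - 1) div 2"
  have k: "int p = 2 * k + 1" "even k" using assms(2) unfolding k_def by presburger+
  define F where "F = (\<lambda>x. Legendre (x ^ 3 - M * x) p)"
  have k0: "k \<ge> 0" using k(1) by presburger
  have "{0..<int p} = insert 0 ({1..k} \<union> {k+1..2*k})" using k k0 by auto
  hence "quartic_sum M p = F 0 + (sum F {1..k} + sum F {k+1..2*k})"
    unfolding quartic_sum_def F_def[symmetric] by (simp add: sum.union_disjoint)
  also have "F 0 = 0" by (simp add: F_def Legendre_eq_0_iff)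
  also have "sum F {k+1..2*k} = sum F {1..k}"
  proof (rule sum.reindex_bij_witness[of _ "\<lambda>x. int p - x" "\<lambda>x. int p - x"])
    fix x
    have "F (int p - x) = F (- x)" unfolding F_def by (intro Legendre_cong cubic_cong) (simp add: cong_iff_dvd_diff)
    also have "\<dots> = F x" using Legendre_cubic_minus[OF assms(1) p2, of x M] Legendre_minus_1[OF assms(1) p2] assms(2)
      by (simp add: F_def)
    finally show "F (int p - x) = F x" .
  qed (use k in auto)
  finally have eq: "quartic_sum M p = 2 * sum F {1..k}" by simp
  have "odd (F x)" if "x \<in> {1..k}" for x
  proof -
    have pp: "prime (int p)" using assms(1) by simp
    have nx: "\<not> int p dvd x" using that k by (auto dest: zdvd_imp_le)
    have "\<not> int p dvd x ^ 3 - M * x"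
    proof
      assume "int p dvd x ^ 3 - M * x"
      hence "int p dvd x * (x\<^sup>2 - M)" by (simp add: power3_eq_cube power2_eq_square algebra_simps)
      hence "int p dvd x\<^sup>2 - M" using pp nx by (simp add: prime_dvd_mult_iff)
      hence "Legendre (x\<^sup>2) p = Legendre M p" by (intro Legendre_cong) (simp add: cong_iff_dvd_diff)
      thus False using Legendre_square[OF assms(1) p2 nx] assms(3) by simp
    qed
    hence "F x \<noteq> 0" by (simp add: F_def Legendre_eq_0_iff)
    thus ?thesis using Legendre_range[of "x ^ 3 - M * x" p] by (auto simp: F_def)
  qed
  hence "{x \<in> {1..k}. odd (F x)} = {1..k}" by blast
  hence "even (sum F {1..k}) \<longleftrightarrow> even (card {1..k})"
    using even_sum_iff[of "{1..k}" F] by (simp only: finite_atLeastAtMost_int simp_thms)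
  hence "even (sum F {1..k})" using k k0 by (simp add: even_nat_iff)
  thus ?thesis unfolding eq by (auto elim!: evenE)
qed

text \<open>For an exponent not divisible by p - 1, multiplication by a primitive root g permutes
  the residues and multiplies the sum by g^t, which is not congruent to 1. The condition t > 0 makes
  the term at x = 0 vanish.\<close>

lemma power_sum_mod_prime:
  assumes p: "prime p" and t: "t > 0"
  shows "[(\<Sum>x\<in>{0..<int p}. x ^ t) = (if (p - 1) dvd t then -1 else 0)] (mod int p)"
proof (cases "(p - 1) dvd t")
  case True
  then obtain j where j: "t = (p - 1) * j" by blast
  have "[(\<Sum>x\<in>{0..<int p}. x ^ t) = (\<Sum>x\<in>{0..<int p}. if x = 0 then 0 else 1)] (mod int p)"
  proof (rule cong_sum)
    fix x assume x: "x \<in> {0..<int p}"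
    show "[x ^ t = (if x = 0 then 0 else 1)] (mod int p)"
    proof (cases "x = 0")
      case False
      define n where "n = nat x"
      have "x = int n" "0 < n" "n < p" using x False by (auto simp: n_def)
      hence "\<not> p dvd n" by (auto dest: dvd_imp_le)
      hence "[n ^ (p - 1) = 1] (mod p)" using p by (intro fermat_theorem)
      hence "[(n ^ (p - 1)) ^ j = 1 ^ j] (mod p)" by (rule cong_pow)
      hence "[int (n ^ t) = int 1] (mod int p)" unfolding cong_int_iff by (simp add: j power_mult)
      thus ?thesis using \<open>x = int n\<close> False by simp
    qed (use t in \<open>simp add: zero_power\<close>)
  qed
  also have "(\<Sum>x\<in>{0..<int p}. if x = 0 then 0 else 1) = int p - 1"
  proof -
    have "{0..<int p} = insert 0 {1..<int p}" using prime_gt_0_nat[OF p] by auto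
    thus ?thesis using prime_gt_0_nat[OF p] by simp
  qed
  also have "[int p - 1 = -1] (mod int p)" by (simp add: cong_iff_dvd_diff)
  finally show ?thesis using True by simp
next
  case False
  have p1: "p > 1" using p by (rule prime_gt_1_nat)
  obtain g where g: "residue_primroot p g" using prime_primitive_root_exists[OF p1] p by blast
  have ord: "ord p g = p - 1" "coprime p g" using g p by (auto simp: residue_primroot_def totient_prime)
  have ng: "\<not> [g ^ t = 1] (mod p)" unfolding ord_divides ord using False .
  \<comment> \<open>Reducing every term makes the summand a function of the residue class, as
    \<open>sum_affine_mod\<close> demands.\<close>
  define S where "S = (\<Sum>x\<in>{0..<int p}. x ^ t mod int p)"
  have cS: "[(\<Sum>x\<in>{0..<int p}. x ^ t) = S] (mod int p)"
    unfolding S_def by (intro cong_sum) (simp add: cong_def)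
  have "S = (\<Sum>x\<in>{0..<int p}. (int g * x + 0) ^ t mod int p)"
    unfolding S_def using p1 ord(2)
    by (intro sum_affine_mod[symmetric, where F = "\<lambda>x. x ^ t mod int p"])
       (auto simp: coprime_commute dest: cong_pow[of _ _ _ t] simp: cong_def[of "_ ^ _"])
  also have "[\<dots> = (\<Sum>x\<in>{0..<int p}. int g ^ t * (x ^ t mod int p))] (mod int p)"
    by (intro cong_sum) (simp add: cong_def power_mult_distrib mod_simps)
  also have "(\<Sum>x\<in>{0..<int p}. int g ^ t * (x ^ t mod int p)) = int g ^ t * S"
    by (simp add: S_def sum_distrib_left)
  finally have "int p dvd (int g ^ t - 1) * S"
    by (simp add: cong_iff_dvd_diff algebra_simps dvd_diff_commute)
  moreover have "\<not> int p dvd int g ^ t - 1"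
  proof
    assume "int p dvd int g ^ t - 1"
    hence "[int (g ^ t) = int 1] (mod int p)" by (simp add: cong_iff_dvd_diff)
    thus False using ng by (simp only: cong_int_iff)
  qed
  ultimately have "int p dvd S" using p by (simp add: prime_dvd_mult_iff)
  hence "[S = 0] (mod int p)" by (simp add: cong_0_iff)
  thus ?thesis using cS False cong_trans by auto
qed

text \<open>Nonvanishing of the Hasse invariant. With k = (p - 1) / 2, Euler's criterion replaces
  the symbol by the k-th power, and of the exponents k + 2 j, which run from k to 3 k, only 2 k is a
  multiple of p - 1. It occurs because k is even, and its coefficient is prime to p since k < p and
  p does not divide M.\<close>

lemma quartic_sum_nonzero:
  assumes p: "prime p" and p4: "p mod 4 = 1" and M: "\<not> int p dvd M"
  shows "quartic_sum M p \<noteq> 0"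
proof
  assume "quartic_sum M p = 0"
  have p2: "p > 2" using p4 prime_ge_2_nat[OF p] by presburger
  define k where "k = (p - 1) div 2"
  have k: "p - 1 = 2 * k" "even k" "k > 0" using p4 p2 unfolding k_def by presburger+
  have exp_cond: "(p - 1) dvd (k + 2 * j) \<longleftrightarrow> j = k div 2" if "j \<le> k" for j
  proof
    assume "(p - 1) dvd (k + 2 * j)"
    then obtain i where i: "k + 2 * j = 2 * k * i" using k(1) by auto
    have "2 * k * i \<le> 3 * k" using i that by linarith
    have "i < 2"
    proof (rule ccontr)
      assume "\<not> i < 2"
      hence "2 * k * 2 \<le> 2 * k * i" by (intro mult_le_mono2) simp
      thus False using \<open>2 * k * i \<le> 3 * k\<close> k(3) by linarith
    qed
    moreover have "i \<noteq> 0" using i k(3) by (intro notI) simp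
    ultimately have "i = 1" by simp
    thus "j = k div 2" using i by simp
  next
    assume "j = k div 2"
    thus "(p - 1) dvd (k + 2 * j)" using k by auto
  qed
  have "[0 = (\<Sum>x\<in>{0..<int p}. (x ^ 3 - M * x) ^ k)] (mod int p)"
  proof -
    have "[(\<Sum>x\<in>{0..<int p}. Legendre (x ^ 3 - M * x) p) = (\<Sum>x\<in>{0..<int p}. (x ^ 3 - M * x) ^ k)] (mod int p)"
      unfolding k_def by (intro cong_sum euler_criterion p p2)
    thus ?thesis using \<open>quartic_sum M p = 0\<close> by (simp add: quartic_sum_def)
  qed
  also have "(\<Sum>x\<in>{0..<int p}. (x ^ 3 - M * x) ^ k) =
      (\<Sum>x\<in>{0..<int p}. \<Sum>j\<le>k. of_nat (k choose j) * (- M) ^ (k - j) * x ^ (k + 2 * j))"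
  proof (intro sum.cong refl)
    fix x :: int
    have "(x ^ 3 - M * x) ^ k = x ^ k * (x\<^sup>2 + (- M)) ^ k"
      by (simp add: power3_eq_cube power2_eq_square algebra_simps flip: power_mult_distrib)
    also have "\<dots> = (\<Sum>j\<le>k. of_nat (k choose j) * (- M) ^ (k - j) * x ^ (k + 2 * j))"
    proof -
      have "x ^ (k + 2 * j) = x ^ k * (x\<^sup>2) ^ j" for j by (simp only: power_add power_mult)
      thus ?thesis unfolding binomial_ring sum_distrib_left by (intro sum.cong refl) (simp only: mult_ac)
    qed
    finally show "(x ^ 3 - M * x) ^ k = (\<Sum>j\<le>k. of_nat (k choose j) * (- M) ^ (k - j) * x ^ (k + 2 * j))" .
  qed
  also have "\<dots> = (\<Sum>j\<le>k. of_nat (k choose j) * (- M) ^ (k - j) * (\<Sum>x\<in>{0..<int p}. x ^ (k + 2 * j)))"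
    by (subst sum.swap) (simp add: sum_distrib_left)
  also have "[\<dots> = (\<Sum>j\<le>k. of_nat (k choose j) * (- M) ^ (k - j) * (if j = k div 2 then -1 else 0))] (mod int p)"
  proof (intro cong_sum cong_mult cong_refl)
    fix j assume "j \<in> {..k}"
    hence "((p - 1) dvd (k + 2 * j)) = (j = k div 2)" by (intro exp_cond) simp
    thus "[(\<Sum>x\<in>{0..<int p}. x ^ (k + 2 * j)) = (if j = k div 2 then -1 else 0)] (mod int p)"
      using power_sum_mod_prime[OF p, of "k + 2 * j"] k(3) by simp
  qed
  also have "(\<Sum>j\<le>k. of_nat (k choose j) * (- M) ^ (k - j) * (if j = k div 2 then -1 else 0)) =
      - (of_nat (k choose (k div 2)) * (- M) ^ (k - k div 2))"
    by (subst sum.remove[of _ "k div 2"]) auto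
  finally have "int p dvd of_nat (k choose (k div 2)) * (- M) ^ (k - k div 2)"
    by (simp add: cong_iff_dvd_diff)
  hence "int p dvd of_nat (k choose (k div 2)) \<or> int p dvd (- M) ^ (k - k div 2)"
    using p by (simp add: prime_dvd_mult_iff)
  thus False
  proof
    assume "int p dvd of_nat (k choose (k div 2))"
    hence "p dvd k choose (k div 2)" by (simp only: int_dvd_int_iff)
    hence "p dvd fact k"
      by (metis binomial_fact_lemma div_le_dividend dvd_mult)
    thus False using k p2 by (simp add: prime_dvd_fact_iff[OF p])
  next
    assume "int p dvd (- M) ^ (k - k div 2)"
    hence "int p dvd - M" using p by (intro prime_dvd_power[of "int p" "- M" "k - k div 2"]) auto
    thus False using M by simp
  qed
qed


section \<open>Minimal models and conductors\<close>

lemma weierstrass_of_int: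
  fixes W :: "int weierstrass"
  defines "V \<equiv> map_weierstrass rat_of_int W"
  shows "B2 V = of_int (B2 W)" "B4 V = of_int (B4 W)" "B6 V = of_int (B6 W)" "B8 V = of_int (B8 W)"
    "C4 V = of_int (C4 W)" "disc V = of_int (disc W)"
proof -
  show *: "B2 V = of_int (B2 W)" "B4 V = of_int (B4 W)" "B6 V = of_int (B6 W)" "B8 V = of_int (B8 W)"
    unfolding V_def by (cases W, simp add: B2_def B4_def B6_def B8_def)+
  show "C4 V = of_int (C4 W)" "disc V = of_int (disc W)"
    by (simp_all add: C4_def disc_def *)
qed

text \<open>The invariants of V depend at most on u and the shift r, as s and t cancel. They are
  computed together with their weights in u, which keeps the identities polynomial.\<close>

lemma weierstrass_iso_quartic:
  fixes m :: rat
  assumes "weierstrass_iso (Weierstrass 0 0 0 (- m) 0) V"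
  obtains u r where "u \<noteq> 0" "u\<^sup>2 * B2 V = 12 * r" "u ^ 4 * B4 V = 6 * r\<^sup>2 - 2 * m"
    "u ^ 6 * B6 V = 4 * r ^ 3 - 4 * m * r" "u ^ 12 * disc V = 64 * m ^ 3" "u ^ 4 * C4 V = 48 * m"
proof -
  obtain u r s t where u: "u \<noteq> 0" and eqs: "u * A1 V = 2 * s" "u\<^sup>2 * A2 V = 3 * r - s\<^sup>2" "u ^ 3 * A3 V = 2 * t"
    "u ^ 4 * A4 V = - m + 3 * r\<^sup>2 - 2 * s * t" "u ^ 6 * A6 V = - (r * m) + r ^ 3 - t\<^sup>2"
    using assms unfolding weierstrass_iso_def by auto
  have "u\<^sup>2 * B2 V = (u * A1 V)\<^sup>2 + 4 * (u\<^sup>2 * A2 V)" unfolding B2_def by (simp add: eval_nat_numeral algebra_simps)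
  also have "\<dots> = 12 * r" unfolding eqs by (simp add: eval_nat_numeral algebra_simps)
  finally have b2: "u\<^sup>2 * B2 V = 12 * r" .
  have "u ^ 4 * B4 V = 2 * (u ^ 4 * A4 V) + (u * A1 V) * (u ^ 3 * A3 V)" unfolding B4_def by (simp add: eval_nat_numeral algebra_simps)
  also have "\<dots> = 6 * r\<^sup>2 - 2 * m" unfolding eqs by (simp add: eval_nat_numeral algebra_simps)
  finally have b4: "u ^ 4 * B4 V = 6 * r\<^sup>2 - 2 * m" .
  have "u ^ 6 * B6 V = (u ^ 3 * A3 V)\<^sup>2 + 4 * (u ^ 6 * A6 V)" unfolding B6_def by (simp add: eval_nat_numeral algebra_simps)
  also have "\<dots> = 4 * r ^ 3 - 4 * m * r" unfolding eqs by (simp add: eval_nat_numeral algebra_simps)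
  finally have b6: "u ^ 6 * B6 V = 4 * r ^ 3 - 4 * m * r" .
  have "u ^ 8 * B8 V = (u * A1 V)\<^sup>2 * (u ^ 6 * A6 V) + 4 * (u\<^sup>2 * A2 V) * (u ^ 6 * A6 V)
      - (u * A1 V) * (u ^ 3 * A3 V) * (u ^ 4 * A4 V) + (u\<^sup>2 * A2 V) * (u ^ 3 * A3 V)\<^sup>2 - (u ^ 4 * A4 V)\<^sup>2"
    unfolding B8_def by (simp add: eval_nat_numeral algebra_simps)
  also have "\<dots> = 3 * r ^ 4 - 6 * r\<^sup>2 * m - m\<^sup>2" unfolding eqs by (simp add: eval_nat_numeral algebra_simps)
  finally have b8: "u ^ 8 * B8 V = 3 * r ^ 4 - 6 * r\<^sup>2 * m - m\<^sup>2" .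
  have "u ^ 12 * disc V = - ((u\<^sup>2 * B2 V)\<^sup>2 * (u ^ 8 * B8 V)) - 8 * (u ^ 4 * B4 V) ^ 3 - 27 * (u ^ 6 * B6 V)\<^sup>2
      + 9 * (u\<^sup>2 * B2 V) * (u ^ 4 * B4 V) * (u ^ 6 * B6 V)"
    unfolding disc_def by (simp add: eval_nat_numeral algebra_simps)
  also have "\<dots> = 64 * m ^ 3" unfolding b2 b4 b6 b8 by (simp add: eval_nat_numeral algebra_simps)
  finally have dd: "u ^ 12 * disc V = 64 * m ^ 3" .
  have "u ^ 4 * C4 V = (u\<^sup>2 * B2 V)\<^sup>2 - 24 * (u ^ 4 * B4 V)" unfolding C4_def by (simp add: eval_nat_numeral algebra_simps)
  also have "\<dots> = 48 * m" unfolding b2 b4 by (simp add: eval_nat_numeral algebra_simps)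
  finally have c4: "u ^ 4 * C4 V = 48 * m" .
  show ?thesis using that[OF u b2 b4 b6 dd c4] .
qed

text \<open>Write u = x / y in lowest terms. The twelfth power of a prime dividing x would divide 64
  M^3, so x is a unit, and the discriminant of every integral model is a multiple of 64 M^3.\<close>

lemma integral_model_quartic:
  fixes M :: int
  assumes M: "M \<noteq> 0" "\<And>p :: nat. prime p \<Longrightarrow> \<not> int p ^ 12 dvd 64 * M ^ 3"
    and W: "W \<in> integral_models (Weierstrass 0 0 0 (- of_int M) 0)"
  obtains y :: int and r :: rat where "y > 0" "disc W = 64 * M ^ 3 * y ^ 12"
    "of_int (B2 W) = 12 * r * of_int y ^ 2" "of_int (B4 W) = (6 * r\<^sup>2 - 2 * of_int M) * of_int y ^ 4"
    "of_int (B6 W) = (4 * r ^ 3 - 4 * of_int M * r) * of_int y ^ 6" "C4 W = 48 * M * y ^ 4"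
proof -
  have iso: "weierstrass_iso (Weierstrass 0 0 0 (- rat_of_int M) 0) (map_weierstrass of_int W)"
    using W by (simp add: integral_models_def)
  obtain u r :: rat where u: "u \<noteq> 0" and eqs: "u\<^sup>2 * of_int (B2 W) = 12 * r" "u ^ 4 * of_int (B4 W) = 6 * r\<^sup>2 - 2 * of_int M"
    "u ^ 6 * of_int (B6 W) = 4 * r ^ 3 - 4 * of_int M * r" "u ^ 12 * of_int (disc W) = 64 * of_int M ^ 3"
    "u ^ 4 * of_int (C4 W) = 48 * of_int M"
    by (rule weierstrass_iso_quartic[OF iso, unfolded weierstrass_of_int])
  obtain x y where xy: "quotient_of u = (x, y)" by (cases "quotient_of u")
  have uxy: "u = of_int x / of_int y" and y: "y > 0" and cop: "coprime x y"
    using quotient_of_div[OF xy] quotient_of_denom_pos[OF xy] quotient_of_coprime[OF xy] by auto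
  have "of_int (x ^ 12 * disc W) = (of_int (64 * M ^ 3 * y ^ 12) :: rat)"
    using eqs(4) y by (simp add: uxy power_divide field_simps)
  hence d: "x ^ 12 * disc W = 64 * M ^ 3 * y ^ 12" by (simp only: of_int_eq_iff)
  have "x \<noteq> 0" using u uxy by auto
  have "\<bar>x\<bar> = 1"
  proof (rule ccontr)
    assume "\<bar>x\<bar> \<noteq> 1"
    hence "nat \<bar>x\<bar> \<noteq> 1" by simp
    then obtain p where p: "prime p" "p dvd nat \<bar>x\<bar>" using prime_factor_nat by blast
    hence px: "int p dvd x" by (simp add: dvd_nat_abs_iff)
    hence "int p ^ 12 dvd x ^ 12" by (rule dvd_power_same)
    hence "int p ^ 12 dvd 64 * M ^ 3 * y ^ 12" using d by (metis dvd_mult2)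
    moreover have "coprime (int p ^ 12) (y ^ 12)"
      using coprime_divisors[OF px dvd_refl cop] by simp
    ultimately have "int p ^ 12 dvd 64 * M ^ 3" by (simp add: coprime_dvd_mult_left_iff)
    thus False using M(2)[OF p(1)] by simp
  qed
  hence x: "x = 1 \<or> x = -1" by auto
  have up: "u\<^sup>2 = 1 / of_int y ^ 2" "u ^ 4 = 1 / of_int y ^ 4" "u ^ 6 = 1 / of_int y ^ 6"
    using x by (auto simp: uxy power_divide)
  have "disc W = 64 * M ^ 3 * y ^ 12" using d x by auto
  moreover have "of_int (C4 W) = (of_int (48 * M * y ^ 4) :: rat)" using eqs(5) y by (simp add: up field_simps)
  hence "C4 W = 48 * M * y ^ 4" by (simp only: of_int_eq_iff)
  ultimately show ?thesis
    using eqs y by (intro that[of y r]) (simp_all add: up field_simps)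
qed

text \<open>The given equation is itself minimal, which forces y = 1; but the minimal model is
  picked by a choice operator, and the shift r remains unknown. The conclusion therefore consists of
  relations free of r: substituting r = b2 / 12 in b4 and b6 produces the constants 24 and
  432.\<close>

lemma minimal_model_quartic:
  fixes M :: int
  assumes M: "M \<noteq> 0" "\<And>p :: nat. prime p \<Longrightarrow> \<not> int p ^ 12 dvd 64 * M ^ 3"
  defines "W \<equiv> minimal_model (Weierstrass 0 0 0 (- of_int M) 0)"
  shows "24 * B4 W = (B2 W)\<^sup>2 - 48 * M" "432 * B6 W = B2 W ^ 3 - 144 * M * B2 W"
    "disc W = 64 * M ^ 3" "C4 W = 48 * M"
proof -
  let ?E = "Weierstrass 0 0 0 (- of_int M) 0 :: rat weierstrass"
  define W0 where "W0 = Weierstrass 0 0 0 (- M) 0"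
  define P where "P = (\<lambda>W. W \<in> integral_models ?E \<and> (\<forall>W'\<in>integral_models ?E. \<forall>p::nat. prime p \<longrightarrow>
      multiplicity (int p) (disc W) \<le> multiplicity (int p) (disc W')))"
  have W0: "W0 \<in> integral_models ?E"
    unfolding integral_models_def mem_Collect_eq weierstrass_iso_def W0_def
    by (rule exI[of _ 1], rule exI[of _ 0], rule exI[of _ 0], rule exI[of _ 0]) simp
  have d0: "disc W0 = 64 * M ^ 3"
    unfolding disc_def B2_def B4_def B6_def B8_def W0_def by (simp add: power_mult_distrib)
  have "P W0"
    unfolding P_def
  proof (intro conjI W0 ballI allI impI)
    fix W' and p :: nat assume W': "W' \<in> integral_models ?E" and p: "prime p"
    obtain y where "y > 0" "disc W' = 64 * M ^ 3 * y ^ 12" using integral_model_quartic[OF M W'] by metis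
    thus "multiplicity (int p) (disc W0) \<le> multiplicity (int p) (disc W')"
      using M(1) unfolding d0 by (intro dvd_imp_multiplicity_le) auto
  qed
  hence "P (SOME W. P W)" by (rule someI)
  hence PW: "P W" by (simp add: W_def minimal_model_def P_def)
  hence "W \<in> integral_models ?E" by (simp add: P_def)
  then obtain y :: int and r :: rat where y: "y > 0" "disc W = 64 * M ^ 3 * y ^ 12"
    "of_int (B2 W) = 12 * r * of_int y ^ 2" "of_int (B4 W) = (6 * r\<^sup>2 - 2 * of_int M) * of_int y ^ 4"
    "of_int (B6 W) = (4 * r ^ 3 - 4 * of_int M * r) * of_int y ^ 6" "C4 W = 48 * M * y ^ 4"
    using integral_model_quartic[OF M] by metis
  have "y = 1"
  proof (rule ccontr)
    assume "y \<noteq> 1"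
    hence "nat y \<noteq> 1" using y(1) by simp
    then obtain p where p: "prime p" "p dvd nat y" using prime_factor_nat by blast
    hence py: "int p dvd y" using y(1) by (metis int_dvd_int_iff int_nat_eq order_less_imp_le)
    have pp: "prime_elem (int p)" using p(1) by simp
    have "multiplicity (int p) (disc W) \<le> multiplicity (int p) (disc W0)"
      using PW W0 p(1) by (simp add: P_def)
    also have "multiplicity (int p) (disc W) = multiplicity (int p) (disc W0) + multiplicity (int p) (y ^ 12)"
      unfolding y(2) d0 using M(1) y(1) by (intro prime_elem_multiplicity_mult_distrib[OF pp]) auto
    finally have "multiplicity (int p) (y ^ 12) = 0" by simp
    moreover have "multiplicity (int p) (y ^ 12) \<ge> 1"
      using py y(1) p(1) by (intro multiplicity_geI) (auto simp: prime_elem_not_unit dvd_power_same intro: dvd_trans[OF _ dvd_power])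
    ultimately show False by simp
  qed
  show "disc W = 64 * M ^ 3" "C4 W = 48 * M" using y(2,6) \<open>y = 1\<close> by simp_all
  have b: "of_int (B2 W) = 12 * r" "of_int (B4 W) = 6 * r\<^sup>2 - 2 * of_int M" "of_int (B6 W) = 4 * r ^ 3 - 4 * of_int M * r"
    using y(3-5) \<open>y = 1\<close> by simp_all
  have "of_int (24 * B4 W) = (of_int ((B2 W)\<^sup>2 - 48 * M) :: rat)"
    unfolding of_int_mult of_int_diff of_int_power b by (simp add: power2_eq_square algebra_simps)
  thus "24 * B4 W = (B2 W)\<^sup>2 - 48 * M" by (simp only: of_int_eq_iff)
  have "of_int (432 * B6 W) = (of_int (B2 W ^ 3 - 144 * M * B2 W) :: rat)"
    unfolding of_int_mult of_int_diff of_int_power b by (simp add: power3_eq_cube algebra_simps)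
  thus "432 * B6 W = B2 W ^ 3 - 144 * M * B2 W" by (simp only: of_int_eq_iff)
qed

text \<open>Completing the square leads to a cubic h with 16 h(x) = (4 x + B)^3 - 16 M (4 x + B),
  where B = b2 / 3; modulo p this is 4 (x^3 - M x) after a shift of x. The division of b2 by 3 takes
  place over the integers and only 2 is inverted modulo p, so p = 3 is included.\<close>

lemma card_weierstrass_points:
  fixes M :: int and W :: "int weierstrass"
  assumes p: "prime p" "p > (2 :: nat)"
    and b4: "24 * B4 W = (B2 W)\<^sup>2 - 48 * M" and b6: "432 * B6 W = B2 W ^ 3 - 144 * M * B2 W"
  shows "int (card {(x, y). x \<in> {0..<int p} \<and> y \<in> {0..<int p} \<and>
      [y^2 + A1 W * x * y + A3 W * y = x^3 + A2 W * x^2 + A4 W * x + A6 W] (mod int p)}) = int p + quartic_sum M p"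
proof -
  define h where "h = (\<lambda>x. 4 * x ^ 3 + B2 W * x\<^sup>2 + 2 * B4 W * x + B6 W)"
  have p0: "int p > 0" using p by simp
  have cop2: "coprime 2 (int p)" using prime_odd_nat[OF p(1)] p(2) by (simp add: coprime_left_2_iff_odd)
  hence cop4: "coprime 4 (int p)" using coprime_power_left_iff[of 2 2 "int p"] by simp
  have "3 dvd (B2 W)\<^sup>2"
  proof -
    have "(B2 W)\<^sup>2 = 3 * (8 * B4 W + 16 * M)" using b4 by simp
    thus ?thesis by simp
  qed
  hence "3 dvd B2 W" using prime_dvd_power[of "3 :: int"] by simp
  then obtain B where B: "B2 W = 3 * B" by blast
  have b4': "8 * B4 W = 3 * B\<^sup>2 - 16 * M" using b4 by (simp add: B power_mult_distrib)
  have b6': "16 * B6 W = B ^ 3 - 16 * M * B" using b6 by (simp add: B power_mult_distrib)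
  obtain k where k: "[4 * k = 1] (mod int p)" using cong_solve_coprime_int[OF cop4] by blast
  define R where "R = k * B"
  have R: "[4 * R = B] (mod int p)" using cong_scalar_right[OF k, of B] by (simp add: R_def mult.assoc)
  have h_cong: "[h x = 4 * ((x + R) ^ 3 - M * (x + R))] (mod int p)" for x
  proof -
    have "16 * h x = (4 * x + B) ^ 3 - 16 * M * (4 * x + B)"
    proof -
      have "16 * h x = 64 * x ^ 3 + 48 * B * x\<^sup>2 + 4 * (8 * B4 W) * x + 16 * B6 W" by (simp add: h_def B algebra_simps)
      also have "\<dots> = (4 * x + B) ^ 3 - 16 * M * (4 * x + B)"
        unfolding b4' b6' by (simp add: power3_eq_cube power2_eq_square algebra_simps)
      finally show ?thesis .
    qed
    also have "[\<dots> = (4 * x + 4 * R) ^ 3 - 16 * M * (4 * x + 4 * R)] (mod int p)"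
      using R by (intro cong_diff cong_pow cong_mult cong_add cong_refl) (simp_all add: cong_sym)
    also have "(4 * x + 4 * R) ^ 3 - 16 * M * (4 * x + 4 * R) = 16 * (4 * ((x + R) ^ 3 - M * (x + R)))"
      by (simp add: power3_eq_cube algebra_simps)
    finally have "[16 * h x = 16 * (4 * ((x + R) ^ 3 - M * (x + R)))] (mod int p)" .
    moreover have "coprime 16 (int p)" using cop2 coprime_power_left_iff[of 2 4 "int p"] by simp
    ultimately show ?thesis
      using cong_mult_lcancel[of 16 "int p" "h x" "4 * ((x + R) ^ 3 - M * (x + R))"] by blast
  qed
  have fib: "int (card {y \<in> {0..<int p}. [y^2 + A1 W * x * y + A3 W * y = x^3 + A2 W * x^2 + A4 W * x + A6 W] (mod int p)})
      = 1 + Legendre ((x + R) ^ 3 - M * (x + R)) p" for x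
  proof -
    define b where "b = A1 W * x + A3 W"
    define F where "F = (\<lambda>Y. if [Y\<^sup>2 = h x] (mod int p) then 1 else 0 :: int)"
    have iff: "[y^2 + A1 W * x * y + A3 W * y = x^3 + A2 W * x^2 + A4 W * x + A6 W] (mod int p) \<longleftrightarrow> [(2 * y + b)\<^sup>2 = h x] (mod int p)" for y
    proof -
      have "(2 * y + b)\<^sup>2 - h x = 4 * ((y^2 + A1 W * x * y + A3 W * y) - (x^3 + A2 W * x^2 + A4 W * x + A6 W))"
        by (simp add: h_def b_def B2_def B4_def B6_def power2_eq_square power3_eq_cube algebra_simps)
      thus ?thesis unfolding cong_iff_dvd_diff by (metis coprime_dvd_mult_right_iff coprime_commute cop4)
    qed
    have card_eq: "int (card {y \<in> {0..<int p}. P y}) = (\<Sum>y\<in>{0..<int p}. if P y then 1 else 0)" for P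
      by (subst sum.inter_filter[symmetric]) auto
    have "int (card {y \<in> {0..<int p}. [y^2 + A1 W * x * y + A3 W * y = x^3 + A2 W * x^2 + A4 W * x + A6 W] (mod int p)})
        = (\<Sum>y\<in>{0..<int p}. F (2 * y + b))"
      unfolding iff card_eq F_def ..
    also have "\<dots> = (\<Sum>y\<in>{0..<int p}. F y)"
    proof (rule sum_affine_mod[OF p0 cop2])
      fix x' y' assume "[x' = y'] (mod int p)"
      hence "[x'\<^sup>2 = y'\<^sup>2] (mod int p)" by (rule cong_pow)
      thus "F x' = F y'" unfolding F_def by (meson cong_sym cong_trans)
    qed
    also have "\<dots> = 1 + Legendre (h x) p"
      unfolding F_def card_eq[symmetric] by (rule card_square_roots[OF p])
    also have "Legendre (h x) p = Legendre (2\<^sup>2 * ((x + R) ^ 3 - M * (x + R))) p"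
      using h_cong by (intro Legendre_cong) simp
    also have "\<dots> = Legendre ((x + R) ^ 3 - M * (x + R)) p"
    proof -
      have "\<not> int p dvd 2" using p(2) by (auto dest: zdvd_imp_le)
      from Legendre_square[OF p this] show ?thesis by (simp only: Legendre_mult[OF p] mult_1)
    qed
    finally show ?thesis .
  qed
  define G where "G = (\<lambda>x. {y \<in> {0..<int p}. [y^2 + A1 W * x * y + A3 W * y = x^3 + A2 W * x^2 + A4 W * x + A6 W] (mod int p)})"
  have fin: "finite (G x)" for x
    unfolding G_def by (rule finite_subset[of _ "{0..<int p}"]) auto
  have "{(x, y). x \<in> {0..<int p} \<and> y \<in> {0..<int p} \<and>
      [y^2 + A1 W * x * y + A3 W * y = x^3 + A2 W * x^2 + A4 W * x + A6 W] (mod int p)} = Sigma {0..<int p} G"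
    unfolding G_def by auto
  also have "int (card \<dots>) = (\<Sum>x\<in>{0..<int p}. int (card (G x)))"
    using fin by (subst card_SigmaI) auto
  also have "\<dots> = (\<Sum>x\<in>{0..<int p}. 1 + Legendre ((x + R) ^ 3 - M * (x + R)) p)"
    unfolding G_def fib ..
  also have "\<dots> = int p + (\<Sum>x\<in>{0..<int p}. Legendre ((1 * x + R) ^ 3 - M * (1 * x + R)) p)"
    using p0 by (simp add: sum.distrib)
  also have "(\<Sum>x\<in>{0..<int p}. Legendre ((1 * x + R) ^ 3 - M * (1 * x + R)) p) = quartic_sum M p"
    unfolding quartic_sum_def using p0
    by (intro sum_affine_mod[where F = "\<lambda>x. Legendre (x ^ 3 - M * x) p"] Legendre_cong cubic_cong) auto
  finally show ?thesis .
qed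

text \<open>The relations force \<open>A1 W\<close> and \<open>A3 W\<close> to be even, so modulo 2
  the equation reads y = f(x), with exactly one y for each x.\<close>

lemma card_weierstrass_points_2:
  fixes M :: int and W :: "int weierstrass"
  assumes b4: "24 * B4 W = (B2 W)\<^sup>2 - 48 * M" and b6: "432 * B6 W = B2 W ^ 3 - 144 * M * B2 W"
  shows "card {(x, y). x \<in> {0..<int 2} \<and> y \<in> {0..<int 2} \<and>
      [y^2 + A1 W * x * y + A3 W * y = x^3 + A2 W * x^2 + A4 W * x + A6 W] (mod int 2)} = 2"
proof -
  have "(B2 W)\<^sup>2 = 2 * (12 * B4 W + 24 * M)" using b4 by simp
  hence "even (B2 W)" by (metis dvd_triv_left even_power pos2)
  then obtain c where c: "B2 W = 2 * c" by blast
  have "c\<^sup>2 = 2 * (3 * B4 W + 6 * M)" using b4 by (simp add: c power_mult_distrib)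
  hence "even c" by (metis dvd_triv_left even_power pos2)
  then obtain e where e: "B2 W = 4 * e" using c by (auto elim!: evenE)
  have "(A1 W)\<^sup>2 = 2 * (2 * e - 2 * A2 W)" using e by (simp add: B2_def)
  hence A1: "even (A1 W)" by (metis dvd_triv_left even_power pos2)
  have "27 * B6 W = 4 * (e ^ 3 - 9 * M * e)" using b6 by (simp add: e power_mult_distrib)
  hence "even (B6 W)" by presburger
  hence A3: "even (A3 W)" by (simp add: B6_def)
  define f where "f = (\<lambda>x. x^3 + A2 W * x^2 + A4 W * x + A6 W)"
  have iff: "[y^2 + A1 W * x * y + A3 W * y = f x] (mod 2) \<longleftrightarrow> y = f x mod 2" if "y \<in> {0..<2}" for x y
  proof -
    have "[y^2 + A1 W * x * y + A3 W * y = f x] (mod 2) \<longleftrightarrow> even (y^2 + A1 W * x * y + A3 W * y - f x)"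
      by (simp add: cong_iff_dvd_diff)
    also have "\<dots> \<longleftrightarrow> even (y - f x)" using A1 A3 by simp
    also have "\<dots> \<longleftrightarrow> y mod 2 = f x mod 2" by (simp add: mod_eq_dvd_iff)
    also have "\<dots> \<longleftrightarrow> y = f x mod 2" using that by simp
    finally show ?thesis .
  qed
  have "{(x, y). x \<in> {0..<int 2} \<and> y \<in> {0..<int 2} \<and> [y^2 + A1 W * x * y + A3 W * y = f x] (mod int 2)} =
      (\<lambda>x. (x, f x mod 2)) ` {0..<2}"
    using iff by auto
  also have "card \<dots> = 2" by (subst card_image) (auto intro: inj_onI)
  finally show ?thesis by (simp add: f_def)
qed

section \<open>Frobenius traces and conductor of y^2 = x^3 - M x\<close>

lemma frobenius_trace_quartic:
  fixes M :: int
  assumes M: "M \<noteq> 0" "\<And>p :: nat. prime p \<Longrightarrow> \<not> int p ^ 12 dvd 64 * M ^ 3"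
  defines "E \<equiv> Weierstrass 0 0 0 (- of_int M) 0"
  shows "frobenius_trace E 2 = 0"
    and "prime p \<Longrightarrow> p > 2 \<Longrightarrow> frobenius_trace E p = - quartic_sum M p"
proof -
  note W = minimal_model_quartic[OF M, folded E_def]
  show "frobenius_trace E 2 = 0"
    using card_weierstrass_points_2[OF W(1,2)] unfolding frobenius_trace_def Let_def by simp
  show "prime p \<Longrightarrow> p > 2 \<Longrightarrow> frobenius_trace E p = - quartic_sum M p"
    using card_weierstrass_points[OF _ _ W(1,2), of p] unfolding frobenius_trace_def Let_def by simp
qed

text \<open>Each prime dividing the discriminant 64 M^3 also divides c4 = 48 M, so the reduction is
  additive at all bad primes and \<open>conductor_exponent\<close> is at least 2 there.\<close>

lemma conductor_quartic:
  fixes M :: int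
  assumes M: "M \<noteq> 0" "\<And>p :: nat. prime p \<Longrightarrow> \<not> int p ^ 12 dvd 64 * M ^ 3"
  defines "E \<equiv> Weierstrass 0 0 0 (- of_int M) 0"
  shows "conductor E > 0"
    and "prime q \<Longrightarrow> q dvd conductor E \<longleftrightarrow> int q dvd 2 * M"
    and "n > 0 \<Longrightarrow> squarefree n \<Longrightarrow> int n dvd 2 * M \<Longrightarrow> n ^ 2 dvd conductor E"
proof -
  note W = minimal_model_quartic[OF M, folded E_def]
  define S where "S = {p :: nat. prime p \<and> int p dvd disc (minimal_model E)}"
  have S_iff: "p \<in> S \<longleftrightarrow> prime p \<and> int p dvd 2 * M" for p
  proof -
    have "int p dvd 64 * M ^ 3 \<longleftrightarrow> int p dvd 2 * M" if "prime p"
    proof -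
      have pp: "prime (int p)" using that by simp
      have "int p dvd 64 * M ^ 3 \<longleftrightarrow> int p dvd 2 ^ 6 * M ^ 3" by simp
      also have "\<dots> \<longleftrightarrow> int p dvd 2 * M"
        by (simp only: prime_dvd_mult_iff[OF pp] prime_dvd_power_iff[OF pp] zero_less_numeral)
      finally show ?thesis .
    qed
    thus ?thesis by (auto simp: S_def W(3))
  qed
  have finS: "finite S"
  proof (rule finite_subset)
    show "S \<subseteq> {..nat \<bar>2 * M\<bar>}"
    proof
      fix p assume "p \<in> S"
      hence "int p \<le> \<bar>2 * M\<bar>" using M(1) dvd_imp_le_int[of "2 * M" "int p"] by (auto simp: S_iff)
      thus "p \<in> {..nat \<bar>2 * M\<bar>}" by simp
    qed
  qed auto
  have cond: "conductor E = (\<Prod>p\<in>S. p ^ conductor_exponent E p)" by (simp add: conductor_def S_def)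
  have ex: "conductor_exponent E p \<ge> 2" if "p \<in> S" for p
  proof -
    have pp: "prime (int p)" "int p dvd 2 * M" using that by (auto simp: S_iff)
    have "int p dvd 48 * M"
    proof -
      have "48 * M = 24 * (2 * M)" by simp
      thus ?thesis using pp(2) by (metis dvd_mult)
    qed
    moreover have "int p dvd disc (minimal_model E)" using that by (simp add: S_def)
    ultimately show ?thesis by (simp add: conductor_exponent_def W(4))
  qed
  show "conductor E > 0"
    unfolding cond
  proof (rule prod_pos)
    fix p assume "p \<in> S"
    hence "p > 0" using S_iff prime_gt_0_nat by blast
    thus "0 < p ^ conductor_exponent E p" by simp
  qed
  show "q dvd conductor E \<longleftrightarrow> int q dvd 2 * M" if q: "prime q"
  proof (rule iffI)
    assume "q dvd conductor E"
    hence "\<exists>p\<in>S. q dvd p ^ conductor_exponent E p"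
      unfolding cond using prime_dvd_prod_iff[OF finS q] by simp
    then obtain p where p: "p \<in> S" "q dvd p ^ conductor_exponent E p" by blast
    hence "q dvd p" using q prime_dvd_power by blast
    hence "q = p" using p(1) q S_iff primes_dvd_imp_eq by blast
    thus "int q dvd 2 * M" using p(1) by (simp add: S_iff)
  next
    assume "int q dvd 2 * M"
    hence qS: "q \<in> S" using q S_iff by blast
    have "q dvd q ^ conductor_exponent E q" using ex[OF qS] by (intro dvd_power) auto
    also have "\<dots> dvd conductor E" unfolding cond using finS qS by (rule dvd_prodI)
    finally show "q dvd conductor E" .
  qed
  assume n: "n > 0" "squarefree n" "int n dvd 2 * M"
  have sub: "prime_factors n \<subseteq> S"
    using n(1,3) by (auto simp: S_iff prime_factors_dvd intro: dvd_trans[OF of_nat_dvd_iff[THEN iffD2]])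
  have "n = (\<Prod>p\<in>prime_factors n. p ^ multiplicity p n)" using n(1) by (rule prime_factorization_nat)
  also have "\<dots> = (\<Prod>p\<in>prime_factors n. p)"
    using n(1,2) squarefree_factorial_semiring'[of n] by (intro prod.cong refl) simp
  finally have "n = (\<Prod>p\<in>prime_factors n. p)" .
  hence "n ^ 2 = (\<Prod>p\<in>prime_factors n. p) ^ 2" by (rule arg_cong)
  also have "\<dots> = (\<Prod>p\<in>prime_factors n. p ^ 2)" by (rule prod_power_distrib)
  also have "\<dots> dvd (\<Prod>p\<in>prime_factors n. p ^ conductor_exponent E p)"
    using sub ex by (intro prod_dvd_prod le_imp_power_dvd) auto
  also have "\<dots> dvd conductor E"
    unfolding cond by (rule prod_dvd_prod_subset[OF finS sub])
  finally show "n ^ 2 dvd conductor E" .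
qed


section \<open>Moduli of congruences\<close>

text \<open>The last coordinate is eliminated by means of a lattice vector that does not vanish there.\<close>

lemma congruent_moduli_divide:
  fixes L :: "(nat \<Rightarrow> int) set" and a :: "nat \<Rightarrow> int"
  assumes "\<And>v w x y. v \<in> L \<Longrightarrow> w \<in> L \<Longrightarrow> (\<lambda>n. x * v n + y * w n) \<in> L"
    and "\<And>k v. k \<noteq> 0 \<Longrightarrow> v \<in> L \<Longrightarrow> \<exists>n<B. k * a n \<noteq> v n"
  shows "\<exists>K\<noteq>0. \<forall>m. \<forall>v\<in>L. (\<forall>n<B. m dvd a n - v n) \<longrightarrow> m dvd K"
  using assms
proof (induction B arbitrary: L a)
  \<comment> \<open>Without coordinates the independence hypothesis contradicts the existence of any
    lattice vector.\<close>
  case 0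
  have "v \<notin> L" for v using "0.prems"(2)[of 1 v] by auto
  thus ?case by (intro exI[of _ 1]) auto
next
  case (Suc B)
  note comb = Suc.prems(1) and indep = Suc.prems(2)
  show ?case
  proof (cases "\<forall>v\<in>L. v B = 0")
    case True
    show ?thesis
    proof (cases "a B = 0")
      case False
      show ?thesis
      proof (intro exI[of _ "a B"] conjI allI ballI impI)
        fix m v assume "v \<in> L" "\<forall>n<Suc B. m dvd a n - v n"
        thus "m dvd a B" using True by (metis diff_zero lessI)
      qed (rule False)
    next
      case aB: True
      have "\<exists>K\<noteq>0. \<forall>m. \<forall>v\<in>L. (\<forall>n<B. m dvd a n - v n) \<longrightarrow> m dvd K"
      proof (rule Suc.IH[OF comb])
        fix k v assume k: "(k :: int) \<noteq> 0" and v: "v \<in> L"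
        obtain n where n: "n < Suc B" "k * a n \<noteq> v n" using indep[OF k v] by blast
        hence "n \<noteq> B" using True aB v by auto
        thus "\<exists>n<B. k * a n \<noteq> v n" using n by (metis less_antisym)
      qed
      thus ?thesis by (metis less_Suc_eq)
    qed
  next
    case False
    then obtain w where w: "w \<in> L" "w B \<noteq> 0" by blast
    define L' where "L' = {v \<in> L. v B = 0}"
    \<comment> \<open>Both \<open>a'\<close> and the vectors \<open>v'\<close> below vanish at the
      coordinate B. Independence is inherited: if \<open>k * a'\<close> agreed with a vector of
      \<open>L'\<close>, then \<open>(k * w B) * a\<close> would agree with one of \<open>L\<close>,
      and \<open>k * w B\<close> is nonzero.\<close>
    define a' where "a' = (\<lambda>n. w B * a n - a B * w n)"
    have "\<exists>K\<noteq>0. \<forall>m. \<forall>v\<in>L'. (\<forall>n<B. m dvd a' n - v n) \<longrightarrow> m dvd K"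
    proof (rule Suc.IH)
      fix v v' x y assume "v \<in> L'" "v' \<in> L'"
      thus "(\<lambda>n. x * v n + y * v' n) \<in> L'" using comb by (simp add: L'_def)
    next
      fix k v assume k: "(k :: int) \<noteq> 0" and v: "v \<in> L'"
      have "(\<lambda>n. 1 * v n + (k * a B) * w n) \<in> L" using v w by (intro comb) (auto simp: L'_def)
      moreover have "k * w B \<noteq> 0" using k w by simp
      ultimately obtain n where n: "n < Suc B" "(k * w B) * a n \<noteq> 1 * v n + (k * a B) * w n"
        using indep by blast
      hence ne: "k * a' n \<noteq> v n" by (simp add: a'_def algebra_simps)
      moreover have "n \<noteq> B"
      proof
        assume "n = B"
        thus False using ne v by (simp add: a'_def L'_def)
      qed
      ultimately show "\<exists>n<B. k * a' n \<noteq> v n" using n(1) by (metis less_antisym)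
    qed
    then obtain K where K: "K \<noteq> 0" "\<And>m v. v \<in> L' \<Longrightarrow> (\<And>n. n < B \<Longrightarrow> m dvd a' n - v n) \<Longrightarrow> m dvd K" by blast
    show ?thesis
    proof (intro exI[of _ K] conjI K(1) allI ballI impI)
      fix m v assume v: "v \<in> L" "\<forall>n<Suc B. m dvd a n - v n"
      define v' where "v' = (\<lambda>n. w B * v n + (- v B) * w n)"
      have "v' \<in> L'" using comb[OF v(1) w(1), of "w B" "- v B"] by (simp add: L'_def v'_def)
      moreover have "m dvd a' n - v' n" if "n < B" for n
      proof -
        have "a' n - v' n = w B * (a n - v n) - w n * (a B - v B)" by (simp add: a'_def v'_def algebra_simps)
        moreover have "m dvd a n - v n" "m dvd a B - v B" using v(2) that by auto
        ultimately show ?thesis by simp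
      qed
      ultimately show "m dvd K" by (rule K(2))
    qed
  qed
qed

section \<open>Integral forms orthogonal to f\<close>

lemma cusp_forms_sum:
  assumes "\<And>i. i \<in> I \<Longrightarrow> g i \<in> cusp_forms N"
  shows "(\<lambda>z. \<Sum>i\<in>I. c i * g i z) \<in> cusp_forms N"
proof -
  have "(\<lambda>z. \<Sum>i\<in>I. c i * g i z) holomorphic_on upper_half_plane"
    using assms cusp_forms_holomorphic by (intro holomorphic_intros) auto
  moreover have "slash (\<lambda>z. \<Sum>i\<in>I. c i * g i z) A z = (\<Sum>i\<in>I. c i * g i z)" if "A \<in> Gamma0 N" "z \<in> upper_half_plane" for A z
    unfolding slash_sum using that cusp_forms_slash_Gamma0[OF assms]
    by (intro sum.cong refl) (simp add: upper_half_plane_def)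
  moreover have "(slash (\<lambda>z. \<Sum>i\<in>I. c i * g i z) A \<longlongrightarrow> 0) (filtercomap Im at_top)" if A: "A \<in> SL2Z" for A
  proof -
    have "((\<lambda>z. \<Sum>i\<in>I. c i * slash (g i) A z) \<longlongrightarrow> (\<Sum>i\<in>I. c i * 0)) (filtercomap Im at_top)"
      using assms A by (intro tendsto_sum tendsto_mult tendsto_const cusp_forms_slash_lim)
    thus ?thesis by (simp add: slash_sum[abs_def])
  qed
  ultimately show ?thesis by (simp add: cusp_forms_def)
qed

lemma q_expansion_sum:
  assumes "\<And>i. i \<in> I \<Longrightarrow> q_expansion (g i) (a i)"
  shows "q_expansion (\<lambda>z. \<Sum>i\<in>I. c i * g i z) (\<lambda>n. \<Sum>i\<in>I. c i * a i n)"
  unfolding q_expansion_iff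
proof (intro allI impI)
  fix z :: complex assume z: "Im z > 0"
  have "(\<lambda>n. \<Sum>i\<in>I. c i * (a i n * nome 1 z ^ n)) sums (\<Sum>i\<in>I. c i * g i z)"
    using assms z by (intro sums_sum sums_mult) (auto simp: q_expansion_iff)
  thus "(\<lambda>n. (\<Sum>i\<in>I. c i * a i n) * nome 1 z ^ n) sums (\<Sum>i\<in>I. c i * g i z)"
    by (simp add: sum_distrib_right mult.assoc)
qed

definition orthogonal_lattice :: "nat \<Rightarrow> (complex \<Rightarrow> complex) \<Rightarrow> (nat \<Rightarrow> int) set" where
  "orthogonal_lattice N f = {v. \<exists>g\<in>cusp_forms N. q_expansion g (\<lambda>n. of_int (v n)) \<and> petersson N f g = 0}"

lemma orthogonal_lattice_comb:
  assumes "f \<in> cusp_forms N" "N > 0" "v \<in> orthogonal_lattice N f" "w \<in> orthogonal_lattice N f"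
  shows "(\<lambda>n. x * v n + y * w n) \<in> orthogonal_lattice N f"
proof -
  obtain g h where g: "g \<in> cusp_forms N" "q_expansion g (\<lambda>n. of_int (v n))" "petersson N f g = 0"
    and h: "h \<in> cusp_forms N" "q_expansion h (\<lambda>n. of_int (w n))" "petersson N f h = 0"
    using assms(3,4) by (auto simp: orthogonal_lattice_def)
  \<comment> \<open>A two-term combination is indexed by \<open>bool\<close>, so that the lemmas on
    finite sums apply.\<close>
  define G where "G = (\<lambda>i. if i then g else h)"
  define C where "C = (\<lambda>i. if i then of_int x else of_int y :: complex)"
  define V where "V = (\<lambda>i n. if i then of_int (v n) else of_int (w n) :: complex)"
  have cG: "G i \<in> cusp_forms N" for i using g h by (simp add: G_def)
  have "q_expansion (\<lambda>z. \<Sum>i\<in>UNIV. C i * G i z) (\<lambda>n. \<Sum>i\<in>UNIV. C i * V i n)"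
    using g h by (intro q_expansion_sum) (auto simp: G_def V_def)
  also have "(\<lambda>n. \<Sum>i\<in>UNIV. C i * V i n) = (\<lambda>n. of_int (x * v n + y * w n))"
    by (simp add: UNIV_bool C_def V_def add.commute)
  finally have "q_expansion (\<lambda>z. \<Sum>i\<in>UNIV. C i * G i z) (\<lambda>n. of_int (x * v n + y * w n))" .
  moreover have "petersson N f (\<lambda>z. \<Sum>i\<in>UNIV. C i * G i z) = 0"
    using g h cG by (subst petersson_sum_right[OF assms(1) _ assms(2)]) (auto simp: UNIV_bool G_def)
  ultimately show ?thesis
    unfolding orthogonal_lattice_def mem_Collect_eq using cusp_forms_sum[of UNIV G N C] cG by blast
qed

text \<open>If a nonzero multiple of f agreed with an orthogonal form up to the Sturm bound, the two
  would be equal; then f would be orthogonal to itself and vanish, against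
  \<open>b 1 \<noteq> 0\<close>.\<close>

lemma orthogonal_lattice_independent:
  assumes f: "f \<in> cusp_forms N" "N > 0" "q_expansion f (\<lambda>n. of_int (b n))" "b 1 \<noteq> 0"
    and k: "k \<noteq> 0" "v \<in> orthogonal_lattice N f"
  shows "\<exists>n<card (coset_reps N). k * b n \<noteq> v n"
proof (rule ccontr)
  assume "\<not> ?thesis"
  hence eq: "k * b n = v n" if "n < card (coset_reps N)" for n using that by blast
  obtain g where g: "g \<in> cusp_forms N" "q_expansion g (\<lambda>n. of_int (v n))" "petersson N f g = 0"
    using k(2) by (auto simp: orthogonal_lattice_def)
  define G where "G = (\<lambda>i. if i then f else g)"
  define C where "C = (\<lambda>i. if i then of_int k else -1 :: complex)"
  define V where "V = (\<lambda>i n. if i then of_int (b n) else of_int (v n) :: complex)"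
  define h where "h = (\<lambda>z. \<Sum>i\<in>UNIV. C i * G i z)"
  have h: "h z = of_int k * f z - g z" for z by (simp add: h_def UNIV_bool C_def G_def)
  have "h \<in> cusp_forms N" unfolding h_def using f g by (intro cusp_forms_sum) (simp add: G_def)
  moreover have "q_expansion h (\<lambda>n. \<Sum>i\<in>UNIV. C i * V i n)"
    unfolding h_def using f g by (intro q_expansion_sum) (auto simp: G_def V_def)
  moreover have "(\<Sum>i\<in>UNIV. C i * V i n) = 0" if "n < card (coset_reps N)" for n
    using eq[OF that] by (simp add: UNIV_bool C_def V_def flip: of_int_mult)
  ultimately have h0: "h z = 0" if "Im z > 0" for z using sturm_bound f(2) that by blast
  have "petersson N f h = (\<Sum>i\<in>UNIV. cnj (C i) * petersson N f (G i))"
    unfolding h_def using f g by (intro petersson_sum_right) (auto simp: G_def)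
  also have "\<dots> = of_int k * petersson N f f" using g(3) by (simp add: UNIV_bool C_def G_def)
  finally have "petersson N f h = of_int k * petersson N f f" .
  moreover have "petersson N f h = petersson N f (\<lambda>_. 0)"
    by (rule petersson_cong) (simp_all add: h0)
  moreover have "petersson N f (\<lambda>_. 0) = 0"
    by (simp add: petersson_altdef slash_altdef set_lebesgue_integral_def)
  ultimately have "petersson N f f = 0" using k(1) by simp
  hence f0: "f z = 0" if "Im z > 0" for z using petersson_definite[OF f(1,2)] that by blast
  have "q_expansion f (\<lambda>_. 0)" unfolding q_expansion_iff by (simp add: f0)
  from fun_cong[OF q_expansion_unique[OF f(3) this], of 1] show False using f(4) by simp
qed

text \<open>The moduli need not be coprime: after division by their gcd a Bezout relation
  \<open>s * k1 + t * k2 = 1\<close> supplies the weights, and \<open>lcm m1 m2\<close> divides both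
  \<open>m1 * k2\<close> and \<open>m2 * k1\<close>.\<close>

lemma congruence_lcm:
  fixes m1 m2 :: nat and a :: "nat \<Rightarrow> int"
  assumes comb: "\<And>v w x y. v \<in> L \<Longrightarrow> w \<in> L \<Longrightarrow> (\<lambda>n. x * v n + y * w n) \<in> L"
    and v: "v \<in> L" "\<And>n. [a n = v n] (mod int m1)" and w: "w \<in> L" "\<And>n. [a n = w n] (mod int m2)"
    and pos: "m1 > 0"
  shows "\<exists>u\<in>L. \<forall>n. [a n = u n] (mod int (lcm m1 m2))"
proof -
  define g where "g = gcd (int m1) (int m2)"
  have g0: "g \<noteq> 0" using pos by (simp add: g_def)
  obtain k1 k2 where k: "int m1 = g * k1" "int m2 = g * k2" unfolding g_def by (meson dvdE gcd_dvd1 gcd_dvd2)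
  obtain s t where "s * int m1 + t * int m2 = g" using bezout_int[of "int m1" "int m2"] by (auto simp: g_def)
  hence "g * (s * k1 + t * k2) = g * 1" by (simp add: k algebra_simps)
  hence st: "s * k1 + t * k2 = 1" using g0 by simp
  have lcm1: "int (lcm m1 m2) dvd int m1 * k2" "int (lcm m1 m2) dvd int m2 * k1"
  proof -
    have "lcm (int m1) (int m2) dvd g * k1 * k2" using k by (intro lcm_least) (auto simp: mult_ac)
    thus "int (lcm m1 m2) dvd int m1 * k2" "int (lcm m1 m2) dvd int m2 * k1"
      by (simp_all add: k mult_ac lcm_int_int_eq[symmetric] del: lcm_int_int_eq)
  qed
  have "(\<lambda>n. (t * k2) * v n + (s * k1) * w n) \<in> L" using v(1) w(1) by (rule comb)
  moreover have "[a n = (t * k2) * v n + (s * k1) * w n] (mod int (lcm m1 m2))" for n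
  proof -
    obtain x y where xy: "a n - v n = int m1 * x" "a n - w n = int m2 * y"
      using v(2)[of n] w(2)[of n] by (auto simp: cong_iff_dvd_diff elim!: dvdE)
    have "a n - ((t * k2) * v n + (s * k1) * w n) = (s * k1 + t * k2) * a n - ((t * k2) * v n + (s * k1) * w n)"
      by (simp add: st)
    also have "\<dots> = t * k2 * (a n - v n) + s * k1 * (a n - w n)" by (simp add: algebra_simps)
    also have "\<dots> = (int m1 * k2) * (t * x) + (int m2 * k1) * (s * y)" unfolding xy by (simp add: mult_ac)
    also have "int (lcm m1 m2) dvd \<dots>" using dvd_add[OF dvd_mult2[OF lcm1(1)] dvd_mult2[OF lcm1(2)]] .
    finally show ?thesis by (simp add: cong_iff_dvd_diff)
  qed
  ultimately show ?thesis by (intro bexI[of _ "\<lambda>n. (t * k2) * v n + (s * k1) * w n"]) auto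
qed

text \<open>A nonzero common multiple K of all moduli makes the \<open>GREATEST\<close> attained.
  The lcm of m with the greatest modulus is again a modulus and so cannot exceed it, which forces
  divisibility.\<close>

theorem dvd_congruence_number:
  assumes f: "f \<in> cusp_forms N" "N > 0" "q_expansion f (\<lambda>n. of_int (b n))" "b 1 \<noteq> 0"
    and v: "v \<in> orthogonal_lattice N f" "\<And>n. [b n = v n] (mod int m)" and m: "m > 0"
  shows "m dvd congruence_number N f" "congruence_number N f > 0"
proof -
  define L where "L = orthogonal_lattice N f"
  define P where "P = (\<lambda>m :: nat. \<exists>v\<in>L. \<forall>n. [b n = v n] (mod int m))"
  have eq: "congruence_number N f = (GREATEST m. P m)"
  proof -
    have "(\<exists>g\<in>cusp_forms N. \<exists>a b' :: nat \<Rightarrow> int.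
        q_expansion f (\<lambda>n. of_int (a n)) \<and> q_expansion g (\<lambda>n. of_int (b' n)) \<and>
        petersson N f g = 0 \<and> (\<forall>n. [a n = b' n] (mod int m))) \<longleftrightarrow> P m" for m
    proof
      assume "\<exists>g\<in>cusp_forms N. \<exists>a b' :: nat \<Rightarrow> int.
        q_expansion f (\<lambda>n. of_int (a n)) \<and> q_expansion g (\<lambda>n. of_int (b' n)) \<and>
        petersson N f g = 0 \<and> (\<forall>n. [a n = b' n] (mod int m))"
      then obtain g a b' where g: "g \<in> cusp_forms N" "q_expansion f (\<lambda>n. of_int (a n))" "q_expansion g (\<lambda>n. of_int (b' n))"
        "petersson N f g = 0" "\<And>n. [a n = b' n] (mod int m)" by blast
      have "a n = b n" for n using fun_cong[OF q_expansion_unique[OF g(2) f(3)], of n] by simp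
      hence "\<forall>n. [b n = b' n] (mod int m)" using g(5) by simp
      moreover have "b' \<in> L" using g by (auto simp: L_def orthogonal_lattice_def)
      ultimately show "P m" by (auto simp: P_def)
    next
      assume "P m"
      thus "\<exists>g\<in>cusp_forms N. \<exists>a b' :: nat \<Rightarrow> int.
        q_expansion f (\<lambda>n. of_int (a n)) \<and> q_expansion g (\<lambda>n. of_int (b' n)) \<and>
        petersson N f g = 0 \<and> (\<forall>n. [a n = b' n] (mod int m))"
        unfolding P_def L_def orthogonal_lattice_def using f(3) by blast
    qed
    thus ?thesis by (simp add: congruence_number_def)
  qed
  have comb: "(\<lambda>n. x * v n + y * w n) \<in> L" if "v \<in> L" "w \<in> L" for v w x y
    using orthogonal_lattice_comb[OF f(1,2)] that unfolding L_def by blast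
  obtain K where K: "K \<noteq> 0" "\<And>m v. v \<in> L \<Longrightarrow> (\<forall>n<card (coset_reps N). m dvd b n - v n) \<Longrightarrow> m dvd K"
    using congruent_moduli_divide[of L "card (coset_reps N)" b] comb orthogonal_lattice_independent[OF f]
    unfolding L_def by blast
  have bound: "P k \<Longrightarrow> k \<le> nat \<bar>K\<bar>" for k
  proof -
    assume "P k"
    hence "int k dvd K" using K(2) by (auto simp: P_def cong_iff_dvd_diff)
    hence "\<bar>int k\<bar> \<le> \<bar>K\<bar>" using K(1) by (intro dvd_imp_le_int)
    thus "k \<le> nat \<bar>K\<bar>" by simp
  qed
  have Pm: "P m" using v by (auto simp: P_def L_def)
  define G where "G = (GREATEST m. P m)"
  have PG: "P G" unfolding G_def using Pm bound by (rule GreatestI_nat)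
  have le: "k \<le> G" if "P k" for k unfolding G_def using that bound by (rule Greatest_le_nat)
  have "P (lcm m G)"
    using Pm PG congruence_lcm[of L _ b m _ G] comb m unfolding P_def by blast
  hence "lcm m G \<le> G" by (rule le)
  have G0: "G > 0" using le[OF Pm] m by simp
  have "G dvd lcm m G" by simp
  moreover have "lcm m G > 0" using m G0 by (simp add: lcm_pos_nat)
  ultimately have "lcm m G = G" using \<open>lcm m G \<le> G\<close> dvd_imp_le by (meson le_antisym)
  thus "m dvd congruence_number N f" unfolding eq G_def[symmetric] by (metis dvd_lcm1)
  show "congruence_number N f > 0" unfolding eq G_def[symmetric] using G0 .
qed


section \<open>Quadratic residue symbols\<close>

text \<open>For a finite set of odd primes, the quadratic character modulo their product; for the
  prime factors of a squarefree odd n it is the Jacobi symbol modulo n.\<close>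

definition legendre_prod :: "nat set \<Rightarrow> nat \<Rightarrow> int" where
  "legendre_prod S n = (\<Prod>l\<in>S. Legendre (int n) (int l))"

lemma legendre_prod_mult:
  assumes "\<And>l. l \<in> S \<Longrightarrow> prime l \<and> l > 2"
  shows "legendre_prod S (m * n) = legendre_prod S m * legendre_prod S n"
  using assms unfolding legendre_prod_def prod.distrib[symmetric]
  by (intro prod.cong refl) (simp add: Legendre_mult)

lemma legendre_prod_range: "legendre_prod S n \<in> {-1, 0, 1}"
proof (cases "finite S")
  case True
  thus ?thesis unfolding legendre_prod_def
  proof (induction S rule: finite_induct)
    case (insert l S)
    thus ?case using Legendre_range[of "int n" "int l"] by auto
  qed simp
qed (simp add: legendre_prod_def)

lemma legendre_prod_1:
  assumes "\<And>l. l \<in> S \<Longrightarrow> prime l \<and> l > 2"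
  shows "legendre_prod S 1 = 1"
proof -
  have "Legendre 1 (int l) = 1" if "l \<in> S" for l
    using Legendre_square[of l 1] assms[OF that] by simp
  thus ?thesis by (simp add: legendre_prod_def)
qed

lemma legendre_prod_mod:
  assumes "\<And>l. l \<in> S \<Longrightarrow> l dvd m"
  shows "legendre_prod S n = legendre_prod S (n mod m)"
  unfolding legendre_prod_def
proof (intro prod.cong refl Legendre_cong)
  fix l assume "l \<in> S"
  hence "[n = n mod m] (mod l)" using assms cong_dvd_modulus_nat[of n "n mod m" m l] by (simp add: cong_def)
  thus "[int n = int (n mod m)] (mod int l)" by (simp only: cong_int_iff)
qed

lemma legendre_prod_square_mult:
  assumes "\<And>l. l \<in> S \<Longrightarrow> prime l \<and> l > 2 \<and> l dvd m" "coprime v m"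
  shows "legendre_prod S (v\<^sup>2 * n) = legendre_prod S n"
proof -
  have "Legendre (int (v\<^sup>2)) (int l) = 1" if "l \<in> S" for l
  proof -
    have l: "prime l" "l > 2" "l dvd m" using assms(1)[OF that] by auto
    have "\<not> l dvd v"
    proof
      assume "l dvd v"
      hence "l dvd 1" using assms(2) l(3) coprime_common_divisor by blast
      thus False using l(1) by simp
    qed
    hence "\<not> int l dvd int v" by simp
    from Legendre_square[OF l(1,2) this] show ?thesis by simp
  qed
  hence "legendre_prod S (v\<^sup>2) = 1" by (simp add: legendre_prod_def)
  thus ?thesis using legendre_prod_mult[of S "v\<^sup>2" n] assms(1) by simp
qed

section \<open>A prime 1 modulo 4 with twisting character -1\<close>

lemma exists_prime_minus_1:
  fixes ch :: "nat \<Rightarrow> int"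
  assumes mult: "\<And>m n. ch (m * n) = ch m * ch n" and one: "ch 1 = 1" and range: "\<And>n. ch n \<in> {-1, 0, 1}"
  shows "n > 0 \<Longrightarrow> ch n = -1 \<Longrightarrow> \<exists>q. prime q \<and> q dvd n \<and> ch q = -1"
proof (induction n rule: less_induct)
  case (less n)
  have "n \<noteq> 1" using less.prems one by auto
  then obtain p k where p: "prime p" "n = p * k" by (metis dvdE prime_factor_nat)
  have "k > 0" using less.prems(1) p(2) by (cases k) auto
  moreover from this have "k < n" using p prime_gt_1_nat[OF p(1)] by simp
  ultimately have k: "k > 0" "k < n" .
  show ?case
  proof (cases "ch p = -1")
    case True
    thus ?thesis using p by auto
  next
    case False
    hence "ch k = -1" using less.prems(2) mult[of p k] range[of p] range[of k] p(2) by auto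
    then obtain q where "prime q" "q dvd k" "ch q = -1" using less.IH k by blast
    thus ?thesis using p(2) by auto
  qed
qed

text \<open>Otherwise adding 4 would lead from squares to squares modulo l; starting from 0, all
  multiples of 4 and hence all residues would be squares, against the vanishing sum of the
  symbols.\<close>

lemma exists_square_plus_4_nonresidue:
  assumes l: "prime l" "l > (2 :: nat)"
  shows "\<exists>x :: nat. Legendre (int (x\<^sup>2 + 4)) l = -1"
proof (rule ccontr)
  assume *: "\<nexists>x :: nat. Legendre (int (x\<^sup>2 + 4)) l = -1"
  have nonneg: "Legendre (x\<^sup>2 + 4) l \<noteq> -1" for x :: int
  proof -
    define n where "n = nat (x mod int l)"
    have n: "[x = int n] (mod int l)" using l by (simp add: n_def cong_def)
    have "[x\<^sup>2 + 4 = int (n\<^sup>2 + 4)] (mod int l)"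
      using cong_add[OF cong_pow[OF n, of 2] cong_refl[of 4]] by simp
    thus ?thesis using * Legendre_cong by metis
  qed
  have sq: "\<exists>x. [x\<^sup>2 = 4 * int k] (mod int l)" for k
  proof (induction k)
    case 0
    show ?case by (intro exI[of _ 0]) simp
  next
    case (Suc k)
    then obtain x where x: "[x\<^sup>2 = 4 * int k] (mod int l)" by blast
    hence x': "[x\<^sup>2 + 4 = 4 * int (Suc k)] (mod int l)"
      using cong_add[OF x cong_refl[of 4]] by (simp add: algebra_simps)
    have "\<exists>y. [y\<^sup>2 = x\<^sup>2 + 4] (mod int l)"
    proof (cases "Legendre (x\<^sup>2 + 4) l = 0")
      case True
      hence "[0\<^sup>2 = x\<^sup>2 + 4] (mod int l)" by (simp add: Legendre_eq_0_iff cong_sym_eq[of 0] cong_0_iff)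
      thus ?thesis by blast
    next
      case False
      hence "QuadRes (int l) (x\<^sup>2 + 4)" using nonneg[of x] unfolding Legendre_def by (auto split: if_splits)
      thus ?thesis by (simp add: QuadRes_def)
    qed
    thus ?case using x' cong_trans by blast
  qed
  have "Legendre x l \<ge> 0" if "x \<in> {0..<int l}" for x
  proof -
    obtain y where y: "[y\<^sup>2 = 4 * int (nat x)] (mod int l)" using sq by blast
    hence "[y\<^sup>2 = 2\<^sup>2 * x] (mod int l)" using that by simp
    hence "Legendre (y\<^sup>2) l = Legendre (2\<^sup>2) l * Legendre x l"
      using Legendre_cong Legendre_mult[OF l] by metis
    moreover have "\<not> int l dvd 2" using l(2) by (auto dest: zdvd_imp_le)
    hence "Legendre (2\<^sup>2) l = 1" by (rule Legendre_square[OF l])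
    moreover have "Legendre (y\<^sup>2) l = Legendre y l * Legendre y l"
      by (simp add: power2_eq_square Legendre_mult[OF l])
    ultimately have "Legendre x l = Legendre y l * Legendre y l" by simp
    thus ?thesis by simp
  qed
  hence "Legendre 1 l = 0"
    using sum_Legendre[OF l] l sum_nonneg_eq_0_iff[of "{0..<int l}" "\<lambda>x. Legendre x l"] by auto
  moreover have "Legendre 1 l = 1" using Legendre_square[OF l, of 1] l by simp
  ultimately show False by simp
qed

text \<open>The number m = x^2 + 4 is given symbol -1 at one prime l0 of S, while x is a multiple of
  the other primes l of n, where the symbol becomes (4/l) = 1. So its character is -1, and the same
  holds for some prime factor q of m; as -4 is a square modulo q, this q is 1 modulo 4.\<close>

lemma exists_split_prime:
  assumes n: "odd n" "n > 0" "squarefree n" and S: "S \<subseteq> prime_factors n" "S \<noteq> {}"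
  shows "\<exists>q. prime q \<and> q mod 4 = 1 \<and> \<not> q dvd n \<and> legendre_prod S q = -1"
proof -
  have PF: "prime l \<and> l > 2 \<and> l dvd n" if "l \<in> prime_factors n" for l
  proof -
    have "prime l" "l dvd n" using that by auto
    moreover have "l \<noteq> 2" using \<open>l dvd n\<close> n(1) by auto
    ultimately show ?thesis using prime_ge_2_nat[of l] by auto
  qed
  obtain l0 where l0: "l0 \<in> S" using S(2) by blast
  have l0': "prime l0" "l0 > 2" "l0 dvd n" using PF l0 S(1) by auto
  obtain x0 :: nat where x0: "Legendre (int (x0\<^sup>2 + 4)) l0 = -1" using exists_square_plus_4_nonresidue[OF l0'(1,2)] by blast
  define n' where "n' = n div l0"
  have nn: "n = l0 * n'" using l0'(3) by (simp add: n'_def)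
  have cop: "coprime l0 n'"
  proof (rule ccontr)
    assume "\<not> coprime l0 n'"
    hence "l0 dvd n'" using l0'(1) prime_imp_coprime by blast
    hence "l0\<^sup>2 dvd n" by (simp add: nn power2_eq_square)
    from squarefreeD[OF n(3) this] show False using l0'(1) by simp
  qed
  obtain x1 where x1: "[x1 = x0] (mod l0)" "[x1 = 0] (mod n')" using binary_chinese_remainder_nat[OF cop] by blast
  have "coprime n 2" using n(1) by simp
  \<comment> \<open>Oddness of x keeps the prime 2 out of m.\<close>
  then obtain x where x: "[x = x1] (mod n)" "[x = 1] (mod 2)" using binary_chinese_remainder_nat by blast
  define m where "m = x\<^sup>2 + 4"
  have oddx: "odd x" using x(2) by (simp add: cong_def odd_iff_mod_2_eq_one)
  hence oddm: "odd m" by (simp add: m_def)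
  have leg: "Legendre (int m) (int l) = (if l = l0 then -1 else 1)" if l: "l \<in> prime_factors n" for l
  proof (cases "l = l0")
    case True
    have "[x = x1] (mod l0)" using x(1) l0'(3) cong_dvd_modulus_nat by blast
    hence "[x = x0] (mod l0)" using x1(1) cong_trans by blast
    hence "[m = x0\<^sup>2 + 4] (mod l0)" unfolding m_def by (intro cong_add cong_pow cong_refl)
    hence "[int m = int (x0\<^sup>2 + 4)] (mod int l0)" by (simp only: cong_int_iff)
    thus ?thesis using x0 Legendre_cong True by auto
  next
    case False
    have l': "prime l" "l > 2" "l dvd n" using PF l by auto
    have "coprime l l0" using False l'(1) l0'(1) by (simp add: primes_coprime)
    hence "l dvd n'" using l'(3) by (simp add: nn coprime_dvd_mult_right_iff)
    have "[x = x1] (mod l)" using x(1) l'(3) cong_dvd_modulus_nat by blast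
    moreover have "[x1 = 0] (mod l)" using x1(2) \<open>l dvd n'\<close> cong_dvd_modulus_nat by blast
    ultimately have "[x = 0] (mod l)" using cong_trans by blast
    hence "[m = 0\<^sup>2 + 4] (mod l)" unfolding m_def by (intro cong_add cong_pow cong_refl)
    hence "[int m = int (0\<^sup>2 + 4)] (mod int l)" by (simp only: cong_int_iff)
    hence "Legendre (int m) (int l) = Legendre (2\<^sup>2) (int l)" by (intro Legendre_cong) simp
    moreover have "\<not> int l dvd 2" using l'(2) by (auto dest: zdvd_imp_le)
    ultimately show ?thesis using Legendre_square[OF l'(1,2), of 2] False by simp
  qed
  have "finite S" using S(1) finite_subset by blast
  hence "legendre_prod S m = (\<Prod>l\<in>S. if l = l0 then -1 else 1)"
    unfolding legendre_prod_def using leg S(1) by (intro prod.cong refl) auto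
  also have "\<dots> = -1" using l0 \<open>finite S\<close> by (simp add: prod.delta)
  finally have m1: "legendre_prod S m = -1" .
  have PS: "prime l \<and> l > 2" if "l \<in> S" for l using PF S(1) that by blast
  have "m > 0" by (simp add: m_def)
  then obtain q where q: "prime q" "q dvd m" "legendre_prod S q = -1"
    using exists_prime_minus_1[of "legendre_prod S", OF legendre_prod_mult[OF PS] legendre_prod_1[OF PS] legendre_prod_range] m1 by blast
  have "q \<noteq> 2" using oddm q(2) by auto
  hence q2: "q > 2" using prime_ge_2_nat[OF q(1)] by simp
  \<comment> \<open>The symbol of m at every prime of n is nonzero, so no such prime divides
    m.\<close>
  have "\<not> q dvd n"
  proof
    assume "q dvd n"
    hence "q \<in> prime_factors n" using q(1) n(2) by (simp add: prime_factors_dvd)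
    hence "Legendre (int m) (int q) \<noteq> 0" using leg by auto
    thus False using q(2) by (simp add: Legendre_eq_0_iff)
  qed
  moreover have "q mod 4 = 1"
  proof -
    have nx: "\<not> int q dvd int x"
    proof
      assume "int q dvd int x"
      hence "q dvd x\<^sup>2" by (simp add: dvd_power_iff power2_eq_square)
      hence "q dvd 4" using q(2) by (simp add: m_def dvd_add_right_iff)
      hence "q dvd 2 ^ 2" by simp
      hence "q dvd 2" using q(1) prime_dvd_power by blast
      hence "q \<le> 2" by (rule dvd_imp_le) simp
      thus False using q2 by simp
    qed
    have "int q dvd int m" using q(2) by simp
    hence "[(int x)\<^sup>2 = -1 * 2\<^sup>2] (mod int q)" by (simp add: cong_iff_dvd_diff m_def)
    hence "Legendre ((int x)\<^sup>2) q = Legendre (-1 * 2\<^sup>2) q" by (rule Legendre_cong)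
    moreover have "\<not> int q dvd 2" using q2 by (auto dest: zdvd_imp_le)
    ultimately have "Legendre (-1) q = 1"
      using Legendre_square[OF q(1) q2 nx] Legendre_square[OF q(1) q2, of 2] Legendre_mult[OF q(1) q2, of "-1" "2\<^sup>2"] by simp
    thus ?thesis using Legendre_minus_1[OF q(1) q2] by (simp split: if_splits)
  qed
  ultimately show ?thesis using q by blast
qed

text \<open>For q = 1 modulo 4 every sign in the reciprocity law is 1, so the symbols can be
  inverted prime by prime.\<close>

lemma Legendre_prod_reciprocity:
  assumes q: "prime q" "q mod 4 = 1" and n: "odd n" "n > 0" "squarefree n" and nd: "\<not> q dvd n"
  shows "Legendre (int n) (int q) = legendre_prod (prime_factors n) q"
proof -
  have q2: "q > 2" using q prime_ge_2_nat[OF q(1)] by presburger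
  have "n = (\<Prod>l\<in>prime_factors n. l ^ multiplicity l n)" using n(2) by (rule prime_factorization_nat)
  also have "\<dots> = (\<Prod>l\<in>prime_factors n. l)"
    using n(2,3) squarefree_factorial_semiring'[of n] by (intro prod.cong refl) simp
  finally have "Legendre (int n) (int q) = Legendre (int (\<Prod>l\<in>prime_factors n. l)) (int q)" by (rule arg_cong)
  also have "\<dots> = (\<Prod>l\<in>prime_factors n. Legendre (int l) (int q))"
  proof -
    have "Legendre (int (\<Prod>l\<in>A. l)) (int q) = (\<Prod>l\<in>A. Legendre (int l) (int q))" if "finite A" for A
      using that
    proof (induction A rule: finite_induct)
      case empty
      show ?case using Legendre_square[OF q(1) q2, of 1] q2 by simp
    next
      case (insert l A)
      thus ?case using Legendre_mult[OF q(1) q2, of "int l" "int (\<Prod>l\<in>A. l)"] by simp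
    qed
    thus ?thesis by simp
  qed
  also have "\<dots> = legendre_prod (prime_factors n) q"
    unfolding legendre_prod_def
  proof (intro prod.cong refl)
    fix l assume "l \<in> prime_factors n"
    hence l: "prime l" "l dvd n" by auto
    have "l \<noteq> 2" using l(2) n(1) by auto
    hence l2: "l > 2" using prime_ge_2_nat[OF l(1)] by simp
    have lq: "l \<noteq> q" using l nd by auto
    have "even ((q - 1) div 2)" using q(2) by presburger
    hence rec: "Legendre (int l) (int q) * Legendre (int q) (int l) = 1"
      using Quadratic_Reciprocity[OF l(1) l2 q(1) q2 lq] by simp
    show "Legendre (int l) (int q) = Legendre (int q) (int l)"
      using rec Legendre_range[of "int l" "int q"] Legendre_range[of "int q" "int l"] by auto
  qed
  finally show ?thesis .
qed

text \<open>M divides d^3 with d squarefree, so an odd prime occurs in M^3 at most 9 times; and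
  divisibility by 2^12 = 64 * 64 would require M to be even.\<close>

lemma quartic_twelfth_power_free:
  fixes d D M :: int
  assumes d: "d > 1" "odd d" "squarefree d" "D dvd d" and M: "M = d * D\<^sup>2"
  shows "M \<noteq> 0" "prime p \<Longrightarrow> \<not> int p ^ 12 dvd 64 * M ^ 3"
proof -
  have D0: "D \<noteq> 0" using d by auto
  thus "M \<noteq> 0" using d M by simp
  assume p: "prime p"
  show "\<not> int p ^ 12 dvd 64 * M ^ 3"
  proof
    assume dv: "int p ^ 12 dvd 64 * M ^ 3"
    show False
    proof (cases "p = 2")
      case True
      have "(64 :: int) * 64 dvd 64 * M ^ 3" using dv True by simp
      hence "64 dvd M ^ 3" by (subst (asm) dvd_mult_cancel_left) simp
      hence "even (M ^ 3)" by (rule dvd_trans[rotated]) simp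
      moreover have "odd D" using d(2,4) dvd_trans by blast
      ultimately show False using d(2) by (simp add: M)
    next
      case False
      have pp: "prime (int p)" using p by simp
      have "odd p" using False p prime_odd_nat prime_ge_2_nat[OF p] by fastforce
      hence "coprime (int p) 2" by simp
      hence "coprime (int p ^ 12) (2 ^ 6)" by (simp only: coprime_power_left_iff coprime_power_right_iff simp_thms)
      hence "coprime (int p ^ 12) 64" by simp
      hence "int p ^ 12 dvd M ^ 3" using dv by (simp add: coprime_dvd_mult_right_iff)
      also have "M ^ 3 dvd (d ^ 3) ^ 3"
      proof (rule dvd_power_same)
        have "D\<^sup>2 dvd d\<^sup>2" using d(4) by (rule dvd_power_same)
        hence "d * D\<^sup>2 dvd d * d\<^sup>2" by (rule mult_dvd_mono[OF dvd_refl])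
        thus "M dvd d ^ 3" by (simp add: M power3_eq_cube power2_eq_square)
      qed
      finally have "int p ^ 12 dvd d ^ 9" by (simp flip: power_mult)
      hence "12 \<le> multiplicity (int p) (d ^ 9)"
        using d pp by (intro multiplicity_geI) (auto simp: prime_elem_not_unit)
      also have "multiplicity (int p) (d ^ 9) = 9 * multiplicity (int p) d"
        using d pp by (intro prime_elem_multiplicity_power_distrib) auto
      also have "multiplicity (int p) d \<le> 1"
        using d pp squarefree_factorial_semiring''[of d] by simp
      finally show False by simp
    qed
  qed
qed

lemma prime_factors_int_nat:
  assumes "n > 0"
  shows "prime_factors (int n) = int ` prime_factors n"
proof (intro subset_antisym subsetI)
  fix p assume "p \<in> prime_factors (int n)"
  hence p: "prime p" "p dvd int n" by auto
  hence "p = int (nat p)" using prime_gt_0_int[of p] by simp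
  moreover have "nat p \<in> prime_factors n"
    using p assms \<open>p = int (nat p)\<close> by (metis in_prime_factors_iff int_dvd_int_iff less_not_refl prime_int_nat_transfer)
  ultimately show "p \<in> int ` prime_factors n" by blast
next
  fix p assume "p \<in> int ` prime_factors n"
  thus "p \<in> prime_factors (int n)" using assms by (auto simp: prime_factors_dvd)
qed


section \<open>The congruence number\<close>

text \<open>What the curve hands over to the argument on forms: n is d as a natural number, M is d
  D^2, N is the conductor, and b lists the integral coefficients of f.\<close>

locale quartic_newform =
  fixes n :: nat and M :: int and f :: "complex \<Rightarrow> complex" and b :: "nat \<Rightarrow> int" and N :: nat
  assumes n: "n > 1" "odd n" "squarefree n"
    and M: "int n dvd M" "\<And>p. prime p \<Longrightarrow> p > 2 \<Longrightarrow> int p dvd M \<longleftrightarrow> p dvd n"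
    and Legendre_M: "\<And>p. prime p \<Longrightarrow> p > 2 \<Longrightarrow> \<not> p dvd n \<Longrightarrow> Legendre M p = Legendre (int n) p"
    and N: "N > 0" "n ^ 2 dvd N" and prime_dvd_N: "\<And>p. prime p \<Longrightarrow> p dvd N \<longleftrightarrow> int p dvd 2 * M"
    and newform: "newform N f" and f_expansion: "q_expansion f (\<lambda>k. of_int (b k))"
    and b_2: "b 2 = 0" and b_prime: "\<And>p. prime p \<Longrightarrow> p > 2 \<Longrightarrow> b p = - quartic_sum M p"
begin

section \<open>Coefficients at the primes of n and modulo 4\<close>

lemma f_cusp: "f \<in> cusp_forms N"
  using newform by (simp add: newform_def)

lemma n_pos: "n > 0"
  using n(1) by simp

lemma b_0: "b 0 = 0" and b_1: "b 1 = 1"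
  using newform_coeffs(1,2)[OF newform f_expansion] by simp_all

lemma b_rec:
  assumes "prime p"
  shows "b p * b k = b (p * k) + (if \<not> p dvd N \<and> p dvd k then int p * b (k div p) else 0)"
proof -
  have "(of_int (b p * b k) :: complex) = of_int (b (p * k) + (if \<not> p dvd N \<and> p dvd k then int p * b (k div p) else 0))"
    using newform_coeffs(3)[OF newform f_expansion assms, of k] by (cases "p dvd N"; cases "p dvd k") simp_all
  thus ?thesis by (simp only: of_int_eq_iff)
qed

lemma prime_factorsD: "l \<in> prime_factors n \<Longrightarrow> prime l \<and> l > 2 \<and> l dvd n"
proof -
  assume "l \<in> prime_factors n"
  hence l: "prime l" "l dvd n" by auto
  moreover have "l \<noteq> 2" using l(2) n(2) by auto
  ultimately show ?thesis using prime_ge_2_nat[of l] by auto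
qed

text \<open>At a prime l of n the recursion has no second term, because l divides N, and
  \<open>b l = 0\<close>. So the coefficients of f live on indices prime to n, where every symbol is
  1 or -1.\<close>

lemma b_bad:
  assumes "l \<in> prime_factors n" "l dvd k"
  shows "b k = 0"
proof -
  have l: "prime l" "l > 2" "l dvd n" using prime_factorsD assms(1) by auto
  have lM: "int l dvd M" using M(2)[OF l(1,2)] l(3) by simp
  hence "l dvd N" using prime_dvd_N[OF l(1)] by simp
  moreover have "b l = 0" using b_prime[OF l(1,2)] quartic_sum_dvd[OF l(1,2) lM] by simp
  moreover have "k = l * (k div l)" using assms(2) by simp
  ultimately show ?thesis using b_rec[OF l(1), of "k div l"] by simp
qed

lemma legendre_prod_full_ne_0:
  assumes "legendre_prod (prime_factors n) k \<noteq> 0" "prime p" "p dvd k"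
  shows "\<not> p dvd n"
proof
  assume "p dvd n"
  hence "p \<in> prime_factors n" using assms(2) n_pos by (simp add: prime_factors_dvd)
  moreover have "Legendre (int k) (int p) = 0" using assms(3) by (simp add: Legendre_eq_0_iff)
  ultimately show False using assms(1) by (auto simp: legendre_prod_def)
qed

text \<open>For p = 1 modulo 4, reciprocity makes M a nonresidue modulo p, as
  \<open>quartic_sum_4_dvd\<close> requires. The prime 2 is covered by
  \<open>b 2 = 0\<close>.\<close>

lemma b_prime_dvd_4:
  assumes p: "prime p" "legendre_prod (prime_factors n) p = -1"
  shows "4 dvd b p"
proof (cases "p = 2")
  case True
  thus ?thesis by (simp add: b_2)
next
  case False
  hence p2: "p > 2" using prime_ge_2_nat[OF p(1)] by simp
  have nd: "\<not> p dvd n" using legendre_prod_full_ne_0[of p p] p by simp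
  have "odd p" using p(1) p2 prime_odd_nat by blast
  hence "p mod 4 = 1 \<or> p mod 4 = 3" by presburger
  thus ?thesis
  proof
    assume "p mod 4 = 3"
    thus ?thesis using b_prime[OF p(1) p2] quartic_sum_3_mod_4[OF p(1)] by simp
  next
    assume p4: "p mod 4 = 1"
    have "Legendre M p = legendre_prod (prime_factors n) p"
      using Legendre_M[OF p(1) p2 nd] Legendre_prod_reciprocity[OF p(1) p4 n(2) n_pos n(3) nd] by simp
    thus ?thesis using b_prime[OF p(1) p2] quartic_sum_4_dvd[OF p(1) p4, of M] p(2) by simp
  qed
qed

lemma b_dvd_4: "legendre_prod (prime_factors n) k = -1 \<Longrightarrow> 4 dvd b k"
proof (rule hecke_recursion_dvd_4[where N = N and ch = "legendre_prod (prime_factors n)"])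
  show "legendre_prod (prime_factors n) (i * j) = legendre_prod (prime_factors n) i * legendre_prod (prime_factors n) j" for i j
    by (rule legendre_prod_mult) (use prime_factorsD in blast)
  show "legendre_prod (prime_factors n) 1 = 1"
    by (rule legendre_prod_1) (use prime_factorsD in blast)
qed (assumption | rule b_0 b_rec legendre_prod_range b_prime_dvd_4)+

section \<open>Twists of f and the resulting congruence\<close>

definition twist :: "nat set \<Rightarrow> complex \<Rightarrow> complex" where
  "twist S = residue_twist n (\<lambda>k. of_int (legendre_prod S k)) f"

lemma twist_cusp_form:
  assumes "S \<subseteq> prime_factors n"
  shows "twist S \<in> cusp_forms N"
  unfolding twist_def
proof (rule residue_twist_cusp_form[OF f_cusp n_pos N(2)])
  show "(of_int (legendre_prod S k) :: complex) = of_int (legendre_prod S (k mod n))" for k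
    using legendre_prod_mod[of S n k] prime_factorsD assms by (metis subsetD)
  fix v k assume "coprime v n"
  hence "legendre_prod S (v\<^sup>2 * k) = legendre_prod S k"
    using prime_factorsD assms by (intro legendre_prod_square_mult[where m = n]) blast+
  thus "(of_int (legendre_prod S (v\<^sup>2 * k)) :: complex) = of_int (legendre_prod S k)" by simp
qed

lemma twist_expansion:
  assumes "S \<subseteq> prime_factors n"
  shows "q_expansion (twist S) (\<lambda>k. of_int (legendre_prod S k) * of_int (b k))"
  unfolding twist_def
proof (rule residue_twist_q_expansion[OF n_pos _ f_expansion])
  show "(of_int (legendre_prod S k) :: complex) = of_int (legendre_prod S (k mod n))" for k
    using legendre_prod_mod[of S n k] prime_factorsD assms by (metis subsetD)
qed

lemma twist_orthogonal:
  assumes S: "S \<subseteq> prime_factors n" "S \<noteq> {}"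
  shows "petersson N f (twist S) = 0"
proof -
  obtain q where q: "prime q" "q mod 4 = 1" "\<not> q dvd n" "legendre_prod S q = -1"
    using exists_split_prime[OF n(2) n_pos n(3) S] by blast
  have q2: "q > 2" using q(2) prime_ge_2_nat[OF q(1)] by presburger
  have qM: "\<not> int q dvd M" using M(2)[OF q(1) q2] q(3) by simp
  have "\<not> int q dvd 2" using q2 by (auto dest: zdvd_imp_le)
  hence qN: "\<not> q dvd N" using prime_dvd_N[OF q(1)] qM q(1) by (simp add: prime_dvd_mult_iff)
  have bq: "b q \<noteq> 0" using b_prime[OF q(1) q2] quartic_sum_nonzero[OF q(1,2) qM] by simp
  have PS: "prime l \<and> l > 2" if "l \<in> S" for l using prime_factorsD S(1) that by blast
  have twist: "hecke N q (twist S) z = (of_int (legendre_prod S q) * of_int (b q)) * twist S z" if "Im z > 0" for z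
  proof (rule hecke_twist[OF q(1) qN _ _ _ twist_expansion[OF S(1)] that])
    show "(of_int (b q) :: complex) * of_int (b k) = of_int (b (q * k)) + (if \<not> q dvd N \<and> q dvd k then of_nat q * of_int (b (k div q)) else 0)" for k
      by (rule newform_coeffs(3)[OF newform f_expansion q(1)])
    show "(of_int (legendre_prod S (i * j)) :: complex) = of_int (legendre_prod S i) * of_int (legendre_prod S j)" for i j
      using legendre_prod_mult[OF PS] by simp
  qed (simp add: q(4))
  show ?thesis
  proof (rule hecke_eigenforms_orthogonal[OF q(1) qN f_cusp twist_cusp_form[OF S(1)] N(1) _ twist])
    show "hecke N q f z = of_int (b q) * f z" if "Im z > 0" for z
      by (rule newform_coeffs(4)[OF newform f_expansion q(1) that])
    show "(of_int (b q) :: complex) \<noteq> cnj (of_int (legendre_prod S q) * of_int (b q))"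
      using bq by (simp add: q(4) eq_neg_iff_add_eq_0 flip: of_int_add)
  qed
qed

theorem two_power_dvd_congruence_number:
  "2 ^ (card (prime_factors n) + 2) dvd congruence_number N f" "congruence_number N f > 0"
proof -
  define P where "P = prime_factors n"
  have finP: "finite P" by (simp add: P_def)
  have "P \<noteq> {}" using n(1) by (simp add: P_def prime_factorization_empty_iff)
  then obtain l0 where l0: "l0 \<in> P" by blast
  \<comment> \<open>The simplest signs with product -1; the condition n > 1 provides l0.\<close>
  define s :: "nat \<Rightarrow> int" where "s = (\<lambda>l. if l = l0 then -1 else 1)"
  define c where "c = (\<lambda>k. \<Prod>l\<in>P. 1 + s l * Legendre (int k) (int l))"
  define \<sigma> where "\<sigma> = (\<lambda>S. \<Prod>l\<in>S. s l)"
  have c_sum: "c k = (\<Sum>S\<in>Pow P. \<sigma> S * legendre_prod S k)" for k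
  proof -
    have "c k = (\<Prod>l\<in>P. s l * Legendre (int k) (int l) + 1)" by (simp add: c_def add.commute)
    also have "\<dots> = (\<Sum>S\<in>Pow P. (\<Prod>l\<in>S. s l * Legendre (int k) (int l)) * (\<Prod>l\<in>P - S. 1))"
      by (rule prod_add[OF finP])
    finally show ?thesis by (simp add: \<sigma>_def legendre_prod_def prod.distrib)
  qed
  define I where "I = Pow P - {{}}"
  define g where "g = (\<lambda>z. \<Sum>S\<in>I. of_int (- \<sigma> S) * twist S z)"
  \<comment> \<open>These are the coefficients of g: the empty set contributes 1 to
    \<open>c k\<close>, so the sum over the nonempty sets is \<open>c k - 1\<close>.\<close>
  define v where "v = (\<lambda>k. b k - c k * b k)"
  have IP: "S \<subseteq> prime_factors n" "S \<noteq> {}" if "S \<in> I" for S using that by (auto simp: I_def P_def)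
  have finI: "finite I" by (simp add: I_def finP)
  have "g \<in> cusp_forms N" unfolding g_def by (intro cusp_forms_sum twist_cusp_form IP(1))
  moreover have "q_expansion g (\<lambda>k. \<Sum>S\<in>I. of_int (- \<sigma> S) * (of_int (legendre_prod S k) * of_int (b k)))"
    unfolding g_def by (intro q_expansion_sum twist_expansion IP(1))
  moreover have "(\<Sum>S\<in>I. of_int (- \<sigma> S) * (of_int (legendre_prod S k) * of_int (b k))) = (of_int (v k) :: complex)" for k
  proof -
    have "c k = \<sigma> {} * legendre_prod {} k + (\<Sum>S\<in>I. \<sigma> S * legendre_prod S k)"
      unfolding c_sum I_def using finP by (intro sum.remove) auto
    hence *: "(\<Sum>S\<in>I. \<sigma> S * legendre_prod S k) = c k - 1" by (simp add: \<sigma>_def legendre_prod_def)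
    have "- (\<Sum>S\<in>I. \<sigma> S * legendre_prod S k) * b k = v k" unfolding * v_def by (simp add: algebra_simps)
    hence "(\<Sum>S\<in>I. - \<sigma> S * (legendre_prod S k * b k)) = v k"
      by (simp add: sum_distrib_right mult.assoc sum_negf)
    thus ?thesis by (metis (no_types, lifting) of_int_mult of_int_sum sum.cong)
  qed
  moreover have "petersson N f g = 0"
    unfolding g_def using petersson_sum_right[OF f_cusp _ N(1) finI, of twist "\<lambda>S. of_int (- \<sigma> S)"]
      IP twist_cusp_form twist_orthogonal by simp
  ultimately have v: "v \<in> orthogonal_lattice N f" by (auto simp: orthogonal_lattice_def)
  \<comment> \<open>For \<open>b k \<noteq> 0\<close> all symbols are 1 or -1, so every factor of
    \<open>c k\<close> is 2 or 0. If none is 0, the character at k is the product of the signs, -1,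
    and \<open>b k\<close> supplies the factor 4.\<close>
  have "2 ^ (card P + 2) dvd c k * b k" for k
  proof (cases "b k = 0")
    case False
    hence unit: "Legendre (int k) (int l) \<in> {-1, 1}" if "l \<in> P" for l
      using b_bad[of l k] that Legendre_range[of "int k" "int l"] Legendre_eq_0_iff[of "int k" "int l"]
      by (auto simp: P_def)
    show ?thesis
    proof (cases "\<forall>l\<in>P. Legendre (int k) (int l) = s l")
      case True
      have "legendre_prod P k = (\<Prod>l\<in>P. s l)" unfolding legendre_prod_def using True by (intro prod.cong) auto
      also have "\<dots> = -1" unfolding s_def using l0 finP by (simp add: prod.delta)
      finally have "4 dvd b k" using b_dvd_4 by (simp add: P_def)
      moreover have "c k = (\<Prod>l\<in>P. 2)" unfolding c_def using True by (intro prod.cong refl) (simp add: s_def)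
      hence "c k = 2 ^ card P" by simp
      ultimately show ?thesis by (simp add: power_add)
    next
      case False
      then obtain l where l: "l \<in> P" "Legendre (int k) (int l) \<noteq> s l" by blast
      hence "1 + s l * Legendre (int k) (int l) = 0" using unit[OF l(1)] by (auto simp: s_def split: if_splits)
      hence "c k = 0" unfolding c_def using finP l(1) by (simp add: prod_zero_iff) blast
      thus ?thesis by simp
    qed
  qed simp
  hence cong: "[b k = v k] (mod int (2 ^ (card P + 2)))" for k by (simp add: cong_iff_dvd_diff v_def)
  have "b 1 \<noteq> 0" "(2 :: nat) ^ (card P + 2) > 0" using b_1 by simp_all
  from dvd_congruence_number[OF f_cusp N(1) f_expansion this(1) v cong this(2)]
  show "2 ^ (card (prime_factors n) + 2) dvd congruence_number N f" "congruence_number N f > 0"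
    by (simp_all add: P_def)
qed

end

theorem theorem1p4:
  fixes d D :: int and E :: "rat weierstrass" and f :: "complex \<Rightarrow> complex"
  assumes "d > 1" and "odd d" and "squarefree d" and "D dvd d"
    and "E = Weierstrass 0 0 0 (- of_int (d * D ^ 2)) 0"
    and "associated_newform E f"
  shows "2 * ((card (prime_factors d) + 1) div 2) + 1
           \<le> multiplicity 2 (congruence_number (conductor E) f)"
proof -
  define n where "n = nat d"
  define M where "M = d * D\<^sup>2"
  define N where "N = conductor E"
  have dn: "d = int n" using assms(1) by (simp add: n_def)
  have M0: "M \<noteq> 0" "\<And>p :: nat. prime p \<Longrightarrow> \<not> int p ^ 12 dvd 64 * M ^ 3"
    using quartic_twelfth_power_free[OF assms(1-4) M_def] by blast+
  have E: "E = Weierstrass 0 0 0 (- of_int M) 0" using assms(5) by (simp add: M_def)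
  note cond = conductor_quartic[OF M0, folded E, folded N_def]
  note frob = frobenius_trace_quartic[OF M0, folded E]
  have n: "n > 1" "odd n" using assms(1,2) by (simp_all add: dn)
  have sqf: "squarefree n"
  proof (rule squarefreeI)
    fix x assume "x\<^sup>2 dvd n"
    hence "(int x)\<^sup>2 dvd d" by (simp add: dn flip: of_nat_power)
    from squarefreeD[OF assms(3) this] show "x dvd 1" by simp
  qed
  have nf: "newform N f" using assms(6) by (simp add: associated_newform_def N_def)
  obtain a where a: "q_expansion f a" "\<And>p. prime p \<Longrightarrow> a p = of_int (frobenius_trace E p)"
    using assms(6) by (auto simp: associated_newform_def)
  obtain b where b: "a = (\<lambda>k. of_int (b k))"
    using hecke_recursion_integral[OF newform_coeffs(1-3)[OF nf a(1)] a(2)] by blast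
  have bp: "b p = frobenius_trace E p" if "prime p" for p
    using a(2)[OF that] by (simp add: b)
  have M_iff: "int p dvd M \<longleftrightarrow> p dvd n" if "prime p" for p
  proof
    have pp: "prime (int p)" using that by simp
    assume "int p dvd M"
    hence "int p dvd d \<or> int p dvd D" using pp by (simp add: M_def prime_dvd_mult_iff prime_dvd_power_iff)
    hence "int p dvd d" using assms(4) dvd_trans by blast
    thus "p dvd n" by (simp add: dn)
  qed (simp add: M_def dn)
  interpret quartic_newform n M f b N
  proof
    show "Legendre M (int p) = Legendre (int n) (int p)" if p: "prime p" "p > 2" "\<not> p dvd n" for p
    proof -
      have "\<not> int p dvd D" using p(3) assms(4) dn dvd_trans int_dvd_int_iff by metis
      from Legendre_square[OF p(1,2) this] show ?thesis
        by (simp add: M_def dn Legendre_mult[OF p(1,2)])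
    qed
    show "n\<^sup>2 dvd N"
      using cond(3)[of n] n sqf by (simp add: M_def dn)
    show "q_expansion f (\<lambda>k. of_int (b k))" using a(1) by (simp add: b)
    show "b 2 = 0" using bp[of 2] frob(1) by simp
    show "b p = - quartic_sum M p" if "prime p" "p > 2" for p using bp[OF that(1)] frob(2)[of p] that by simp
  qed (use n sqf cond(1,2) nf M_iff in \<open>auto simp: M_def dn\<close>)
  have "card (prime_factors d) = card (prime_factors n)"
    unfolding dn using n by (subst prime_factors_int_nat) (auto simp: card_image)
  \<comment> \<open>Positivity of the congruence number enters here, since the multiplicity in 0 is
    0 by convention.\<close>
  moreover have "card (prime_factors n) + 2 \<le> multiplicity 2 (congruence_number N f)"
    using two_power_dvd_congruence_number by (intro multiplicity_geI) auto
  ultimately show ?thesis by (simp add: N_def)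
qed

end
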